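(* Let $f:X\to U\subseteq\mathbb R^n$ be a stitched Lagrangian fibration as in the context, and let $\ell_1$ be the section of $\mathfrak L^*$ defined by $\ell_1(\bar\eta_j)=a_j$, $j=2,\dots,n$, where $a_j$ are the $S^1$-invariant functions on $Z$ determined by $(\eta_j^+-\eta_j^-)|_Z=a_j\,\eta_1|_Z$. Then $\ell_1$ is fibrewise closed.
   Context: Smooth means $C^\infty$. The Hamiltonian vector field $\eta_h$ of $h$ satisfies $\iota_{\eta_h}\omega=dh$; an $S^1$-action ($S^1=\mathbb R/\mathbb Z$) with moment map $\mu$ is the flow of $\eta_\mu$. **Stitched Lagrangian fibration.** $(X,\omega)$ is a smooth $2n$-dimensional symplectic manifold with a free Hamiltonian $S^1$-action with moment map $\mu$, $X^+=\{\mu\ge0\}$, $X^-=\{\mu\le0\}$. A map $f=(\mu,G):X\to\mathbb R\times M$, with $M$ a smooth $(n-1)$-manifold, is a stitched Lagrangian fibration if $G$ is continuous and $S^1$-invariant, $G|_{X^\pm}$ are restrictions of $C^\infty$ maps on $X$, and $f^\pm=f|_{X^\pm}$ is a proper (onto its image) submersion with connected Lagrangian fibres. The seam is $Z=\mu^{-1}(0)$. **Setting.** $M=\mathbb R^{n-1}$ and $f(X)=U\subseteq\mathbb R^n$ is a contractible open neighbourhood of $0$ with coordinates $(b_1,\dots,b_n)$; $\Gamma=U\cap\{b_1=0\}$, with $(U,\Gamma)$ homeomorphic to $(D^n,D^{n-1})$. Thus $f_1=\mu$ and $Z=f^{-1}(\Gamma)$. $\eta_1$ and $\eta_j^\pm$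 ($j=2,\dots,n$) are the Hamiltonian vector fields of $f_1$ and $f_j^\pm=f_j|_{X^\pm}$. Let $p:Z\to\bar Z=Z/S^1$ be the quotient, $\bar f:\bar Z\to\Gamma$ the map with $\bar f\circ p=f|_Z$, $\bar F_b=\bar f^{-1}(b)$, and $\mathfrak L=\ker\bar f_*\subset T\bar Z$. There exist $S^1$-invariant functions $a_j$ on $Z$ (regarded as functions on $\bar Z$) with $(\eta_j^+-\eta_j^-)|_Z=a_j\eta_1|_Z$; hence $p_*\eta_j^+=p_*\eta_j^-=:\bar\eta_j$, and $(\bar\eta_2,\dots,\bar\eta_n)$ is a frame of $\mathfrak L$. A section of $\mathfrak L^*$ is fibrewise closed if its restriction to each fibre $\bar F_b$ is a closed 1-form. *)

theory Defs
  imports "HOL-Analysis.Analysis"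
begin

section \<open>Smooth maps on open subsets of a linear subspace\<close>

text \<open>
  Manifolds are modelled on a linear subspace \<open>E\<close> of a Euclidean space. In this way submanifolds
  of all dimensions, including dimension 0, can be handled with the same types, and with \<open>E = UNIV\<close>
  one has the usual notions. Let \<open>S\<close> be open in \<open>E\<close>. The derivative within \<open>S\<close> at a point of \<open>S\<close> is
  then determined on \<open>E\<close> (but not outside \<open>E\<close>), so every derivative below is applied to
  vectors of \<open>E\<close> only.
\<close>

fun Ck_on :: "nat \<Rightarrow> 'e::real_normed_vector set \<Rightarrow> 'e set \<Rightarrow> ('e \<Rightarrow> 'b::real_normed_vector) \<Rightarrow> bool" where
  "Ck_on 0 E S f \<longleftrightarrow> continuous_on S f"
| "Ck_on (Suc k) E S f \<longleftrightarrow>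
     (\<exists>D. (\<forall>y\<in>S. (f has_derivative D y) (at y within S)) \<and> (\<forall>u\<in>E. Ck_on k E S (\<lambda>y. D y u)))"

definition smooth_on :: "'e::real_normed_vector set \<Rightarrow> 'e set \<Rightarrow> ('e \<Rightarrow> 'b::real_normed_vector) \<Rightarrow> bool" where
  "smooth_on E S f \<longleftrightarrow> (\<forall>k. Ck_on k E S f)"

definition linear_on_subspace :: "'e::real_vector set \<Rightarrow> ('e \<Rightarrow> real) \<Rightarrow> bool" where
  "linear_on_subspace E l \<longleftrightarrow> (\<forall>u\<in>E. \<forall>v\<in>E. \<forall>r s. l (r *\<^sub>R u + s *\<^sub>R v) = r * l u + s * l v)"


section \<open>Smooth manifolds\<close>

text \<open>
  A manifold has as points a subset of a topological space, with the subspace topology; a chart is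
  a pair of a domain and a coordinate map. (Hausdorffness and second countability come from the type
  classes in \<open>smooth_manifold\<close>.)
\<close>

type_synonym ('m, 'e) chart = "'m set \<times> ('m \<Rightarrow> 'e)"

record ('m, 'e) mfd =
  pts :: "'m set"
  model :: "'e set"
  charts :: "('m, 'e) chart set"

definition coord_inv :: "('m, 'e) chart \<Rightarrow> 'e \<Rightarrow> 'm" where
  "coord_inv c = inv_into (fst c) (snd c)"

definition smooth_transition ::
    "'e::real_normed_vector set \<Rightarrow> ('m, 'e) chart \<Rightarrow> ('m, 'e) chart \<Rightarrow> bool" where
  "smooth_transition E c c' \<longleftrightarrow> smooth_on E (snd c ` (fst c \<inter> fst c')) (snd c' \<circ> coord_inv c)"

text \<open>Membership in the maximal atlas determined by the charts of \<open>M\<close>.\<close>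

definition smooth_chart :: "('m::topological_space, 'e::real_normed_vector) mfd \<Rightarrow> ('m, 'e) chart \<Rightarrow> bool" where
  "smooth_chart M c \<longleftrightarrow>
     openin (top_of_set (pts M)) (fst c) \<and>
     openin (top_of_set (model M)) (snd c ` fst c) \<and>
     homeomorphism (fst c) (snd c ` fst c) (snd c) (coord_inv c) \<and>
     (\<forall>c'\<in>charts M. smooth_transition (model M) c c' \<and> smooth_transition (model M) c' c)"

definition smooth_manifold ::
    "nat \<Rightarrow> ('m::{t2_space,second_countable_topology}, 'e::euclidean_space) mfd \<Rightarrow> bool" where
  "smooth_manifold d M \<longleftrightarrow>
     subspace (model M) \<and> dim (model M) = d \<and>
     pts M = (\<Union>c\<in>charts M. fst c) \<and> (\<forall>c\<in>charts M. smooth_chart M c)"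


subsection \<open>Tangent vectors and differentials\<close>

text \<open>
  The tangent space at \<open>x\<close> is \<open>model M\<close>: a tangent vector is given by its coordinates in the
  preferred chart \<open>chart_at M x\<close>. The vector at \<open>x\<close> whose coordinates in
  another chart \<open>c\<close> are \<open>u\<close> is \<open>coord_vec M c x u\<close>.
\<close>

definition chart_at :: "('m, 'e) mfd \<Rightarrow> 'm \<Rightarrow> ('m, 'e) chart" where
  "chart_at M x = (SOME c. c \<in> charts M \<and> x \<in> fst c)"

definition coord_vec ::
    "('m, 'e::real_normed_vector) mfd \<Rightarrow> ('m, 'e) chart \<Rightarrow> 'm \<Rightarrow> 'e \<Rightarrow> 'e" where
  "coord_vec M c x u =
     (let k = chart_at M x in
       frechet_derivative (snd k \<circ> coord_inv c) (at (snd c x) within snd c ` (fst c \<inter> fst k)) u)"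

definition smooth_fun ::
    "('m, 'e::real_normed_vector) mfd \<Rightarrow> ('m \<Rightarrow> 'b::real_normed_vector) \<Rightarrow> bool" where
  "smooth_fun M h \<longleftrightarrow> (\<forall>c\<in>charts M. smooth_on (model M) (snd c ` fst c) (h \<circ> coord_inv c))"

definition dfun ::
    "('m, 'e::real_normed_vector) mfd \<Rightarrow> ('m \<Rightarrow> 'b::real_normed_vector) \<Rightarrow> 'm \<Rightarrow> 'e \<Rightarrow> 'b" where
  "dfun M h x u =
     (let k = chart_at M x in
       frechet_derivative (h \<circ> coord_inv k) (at (snd k x) within snd k ` fst k) u)"

definition smooth_map ::
    "('m::topological_space, 'e::real_normed_vector) mfd \<Rightarrow>
     ('m1::topological_space, 'e1::real_normed_vector) mfd \<Rightarrow> ('m \<Rightarrow> 'm1) \<Rightarrow> bool" where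
  "smooth_map M N F \<longleftrightarrow>
     F ` pts M \<subseteq> pts N \<and> continuous_on (pts M) F \<and>
     (\<forall>c\<in>charts M. \<forall>k\<in>charts N.
        smooth_on (model M) (snd c ` (fst c \<inter> F -` fst k)) (snd k \<circ> F \<circ> coord_inv c))"

definition dmap ::
    "('m, 'e::real_normed_vector) mfd \<Rightarrow> ('m1, 'e1::real_normed_vector) mfd \<Rightarrow>
     ('m \<Rightarrow> 'm1) \<Rightarrow> 'm \<Rightarrow> 'e \<Rightarrow> 'e1" where
  "dmap M N F x u =
     (let c = chart_at M x; k = chart_at N (F x) in
       frechet_derivative (snd k \<circ> F \<circ> coord_inv c)
         (at (snd c x) within snd c ` (fst c \<inter> F -` fst k)) u)"

text \<open>The product manifold of the real line with \<open>M\<close>.\<close>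

definition line_times :: "('m, 'e) mfd \<Rightarrow> (real \<times> 'm, real \<times> 'e) mfd" where
  "line_times M =
     \<lparr> pts = UNIV \<times> pts M, model = UNIV \<times> model M,
       charts = (\<lambda>c. (UNIV \<times> fst c, \<lambda>(t, x). (t, snd c x))) ` charts M \<rparr>"


subsection \<open>Embedded submanifolds\<close>

text \<open>
  A slice chart for \<open>S\<close> is a smooth chart of the ambient manifold in which \<open>S\<close> is the
  intersection with the subspace \<open>E0\<close>; the charts of \<open>S\<close> are the restrictions of all slice charts.
\<close>

definition slice_chart ::
    "('m::topological_space, 'e::real_normed_vector) mfd \<Rightarrow> 'e set \<Rightarrow> 'm set \<Rightarrow> ('m, 'e) chart \<Rightarrow> bool" where
  "slice_chart M E0 S c \<longleftrightarrow> smooth_chart M c \<and> snd c ` (fst c \<inter> S) = snd c ` fst c \<inter> E0"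

definition embedded_submanifold ::
    "('m::topological_space, 'e::real_normed_vector) mfd \<Rightarrow> 'e set \<Rightarrow> 'm set \<Rightarrow> bool" where
  "embedded_submanifold M E0 S \<longleftrightarrow>
     subspace E0 \<and> E0 \<subseteq> model M \<and> S \<subseteq> pts M \<and> (\<forall>x\<in>S. \<exists>c. slice_chart M E0 S c \<and> x \<in> fst c)"

definition submfd ::
    "('m::topological_space, 'e::real_normed_vector) mfd \<Rightarrow> 'e set \<Rightarrow> 'm set \<Rightarrow> ('m, 'e) mfd" where
  "submfd M E0 S =
     \<lparr> pts = S, model = E0, charts = {(fst c \<inter> S, snd c) | c. slice_chart M E0 S c} \<rparr>"


section \<open>Differential forms\<close>

text \<open>\<open>\<alpha> x\<close> is a covector and \<open>\<omega> x\<close> a bilinear form on the tangent space at \<open>x\<close>. The exterior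
  derivatives are computed in charts on constant coordinate vector fields.\<close>

definition coeff1 ::
    "('m, 'e::real_normed_vector) mfd \<Rightarrow> ('m \<Rightarrow> 'e \<Rightarrow> real) \<Rightarrow> ('m, 'e) chart \<Rightarrow> 'e \<Rightarrow> 'e \<Rightarrow> real" where
  "coeff1 M \<alpha> c u y = (let x = coord_inv c y in \<alpha> x (coord_vec M c x u))"

definition one_form :: "('m, 'e::real_normed_vector) mfd \<Rightarrow> ('m \<Rightarrow> 'e \<Rightarrow> real) \<Rightarrow> bool" where
  "one_form M \<alpha> \<longleftrightarrow>
     (\<forall>x\<in>pts M. linear_on_subspace (model M) (\<alpha> x)) \<and>
     (\<forall>c\<in>charts M. \<forall>u\<in>model M. smooth_on (model M) (snd c ` fst c) (coeff1 M \<alpha> c u))"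

definition closed_one_form :: "('m, 'e::real_normed_vector) mfd \<Rightarrow> ('m \<Rightarrow> 'e \<Rightarrow> real) \<Rightarrow> bool" where
  "closed_one_form M \<alpha> \<longleftrightarrow>
     one_form M \<alpha> \<and>
     (\<forall>c\<in>charts M. \<forall>y\<in>snd c ` fst c. \<forall>u\<in>model M. \<forall>v\<in>model M.
        frechet_derivative (coeff1 M \<alpha> c v) (at y within snd c ` fst c) u
      - frechet_derivative (coeff1 M \<alpha> c u) (at y within snd c ` fst c) v = 0)"

definition coeff2 ::
    "('m, 'e::real_normed_vector) mfd \<Rightarrow> ('m \<Rightarrow> 'e \<Rightarrow> 'e \<Rightarrow> real) \<Rightarrow> ('m, 'e) chart \<Rightarrow> 'e \<Rightarrow> 'e \<Rightarrow> 'e \<Rightarrow> real" where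
  "coeff2 M \<omega> c u v y =
     (let x = coord_inv c y in \<omega> x (coord_vec M c x u) (coord_vec M c x v))"

definition two_form :: "('m, 'e::real_normed_vector) mfd \<Rightarrow> ('m \<Rightarrow> 'e \<Rightarrow> 'e \<Rightarrow> real) \<Rightarrow> bool" where
  "two_form M \<omega> \<longleftrightarrow>
     (\<forall>x\<in>pts M. (\<forall>v\<in>model M. linear_on_subspace (model M) (\<lambda>u. \<omega> x u v)) \<and>
                 (\<forall>u\<in>model M. \<forall>v\<in>model M. \<omega> x u v = - \<omega> x v u)) \<and>
     (\<forall>c\<in>charts M. \<forall>u\<in>model M. \<forall>v\<in>model M.
        smooth_on (model M) (snd c ` fst c) (coeff2 M \<omega> c u v))"

definition closed_two_form :: "('m, 'e::real_normed_vector) mfd \<Rightarrow> ('m \<Rightarrow> 'e \<Rightarrow> 'e \<Rightarrow> real) \<Rightarrow> bool" where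
  "closed_two_form M \<omega> \<longleftrightarrow>
     two_form M \<omega> \<and>
     (\<forall>c\<in>charts M. \<forall>y\<in>snd c ` fst c. \<forall>u\<in>model M. \<forall>v\<in>model M. \<forall>w\<in>model M.
        frechet_derivative (coeff2 M \<omega> c v w) (at y within snd c ` fst c) u
      + frechet_derivative (coeff2 M \<omega> c w u) (at y within snd c ` fst c) v
      + frechet_derivative (coeff2 M \<omega> c u v) (at y within snd c ` fst c) w = 0)"


section \<open>Symplectic manifolds and Hamiltonian circle actions\<close>

definition symplectic_manifold ::
    "nat \<Rightarrow> ('m::{t2_space,second_countable_topology}, 'e::euclidean_space) mfd \<Rightarrow>
     ('m \<Rightarrow> 'e \<Rightarrow> 'e \<Rightarrow> real) \<Rightarrow> bool" where
  "symplectic_manifold d M \<omega> \<longleftrightarrow>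
     smooth_manifold d M \<and> closed_two_form M \<omega> \<and>
     (\<forall>x\<in>pts M. \<forall>u\<in>model M. (\<forall>v\<in>model M. \<omega> x u v = 0) \<longrightarrow> u = 0)"

definition ham_vf ::
    "('m, 'e::real_normed_vector) mfd \<Rightarrow> ('m \<Rightarrow> 'e \<Rightarrow> 'e \<Rightarrow> real) \<Rightarrow> ('m \<Rightarrow> real) \<Rightarrow> 'm \<Rightarrow> 'e" where
  "ham_vf M \<omega> h x = (THE v. v \<in> model M \<and> (\<forall>u\<in>model M. \<omega> x v u = dfun M h x u))"

definition lagrangian_submanifold ::
    "nat \<Rightarrow> ('m::topological_space, 'e::euclidean_space) mfd \<Rightarrow>
     ('m \<Rightarrow> 'e \<Rightarrow> 'e \<Rightarrow> real) \<Rightarrow> 'm set \<Rightarrow> bool" where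
  "lagrangian_submanifold n M \<omega> L \<longleftrightarrow>
     (\<exists>E0. embedded_submanifold M E0 L \<and> dim E0 = n \<and>
        (\<forall>x\<in>L. \<forall>u\<in>E0. \<forall>v\<in>E0.
           \<omega> x (dmap (submfd M E0 L) M id x u) (dmap (submfd M E0 L) M id x v) = 0))"

text \<open>An action of the circle \<open>\<real>/\<int>\<close> is an action \<open>\<theta>\<close> of the real line for which 1 acts trivially;
  it is free if only integers fix a point.\<close>

definition smooth_circle_action ::
    "('m::topological_space, 'e::real_normed_vector) mfd \<Rightarrow> (real \<Rightarrow> 'm \<Rightarrow> 'm) \<Rightarrow> bool" where
  "smooth_circle_action M \<theta> \<longleftrightarrow>
     smooth_map (line_times M) M (\<lambda>(t, x). \<theta> t x) \<and>
     (\<forall>x\<in>pts M. \<theta> 0 x = x \<and> \<theta> 1 x = x \<and> (\<forall>s t. \<theta> (s + t) x = \<theta> s (\<theta> t x)))"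

definition free_circle_action :: "('m, 'e) mfd \<Rightarrow> (real \<Rightarrow> 'm \<Rightarrow> 'm) \<Rightarrow> bool" where
  "free_circle_action M \<theta> \<longleftrightarrow> (\<forall>x\<in>pts M. \<forall>t. \<theta> t x = x \<longrightarrow> t \<in> \<int>)"

definition hamiltonian_circle_action ::
    "('m::topological_space, 'e::real_normed_vector) mfd \<Rightarrow> ('m \<Rightarrow> 'e \<Rightarrow> 'e \<Rightarrow> real) \<Rightarrow>
     (real \<Rightarrow> 'm \<Rightarrow> 'm) \<Rightarrow> ('m \<Rightarrow> real) \<Rightarrow> bool" where
  "hamiltonian_circle_action M \<omega> \<theta> \<mu> \<longleftrightarrow>
     smooth_circle_action M \<theta> \<and> smooth_fun M \<mu> \<and>
     (\<forall>x\<in>pts M. \<forall>t.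
        ((\<lambda>s. snd (chart_at M (\<theta> t x)) (\<theta> s x)) has_vector_derivative ham_vf M \<omega> \<mu> (\<theta> t x)) (at t))"


section \<open>Stitched Lagrangian fibrations\<close>

text \<open>
  One half \<open>f|P\<close> of the fibration, \<open>P\<close> being \<open>{\<mu> \<ge> 0}\<close> or \<open>{\<mu> \<le> 0}\<close>; \<open>g\<close> is a smooth map on all of \<open>X\<close>
  that restricts to it. The differential of \<open>f|P\<close> at a point of \<open>P\<close>, boundary points included, is
  that of \<open>g\<close>.
\<close>

definition lagrangian_half ::
    "('m::topological_space, 'e::euclidean_space) mfd \<Rightarrow> ('m \<Rightarrow> 'e \<Rightarrow> 'e \<Rightarrow> real) \<Rightarrow>
     'm set \<Rightarrow> ('m \<Rightarrow> real^'n) \<Rightarrow> ('m \<Rightarrow> real^'n) \<Rightarrow> bool" where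
  "lagrangian_half X \<omega> P f g \<longleftrightarrow>
     smooth_fun X g \<and> (\<forall>x\<in>P. g x = f x) \<and>
     proper_map (top_of_set P) (top_of_set (f ` P)) f \<and>
     (\<forall>x\<in>P. dfun X g x ` model X = UNIV) \<and>
     (\<forall>b\<in>f ` P. connected {x\<in>P. f x = b} \<and>
                 lagrangian_submanifold CARD('n) X \<omega> {x\<in>P. f x = b})"

text \<open>
  The case \<open>M = \<real>\<^sup>n\<^sup>-\<^sup>1\<close>. The target \<open>\<real> \<times> M\<close> is \<open>real^'n\<close>, where the index \<open>one\<close> is that of the
  coordinate \<open>b\<^sub>1\<close>; so \<open>\<mu>\<close> is \<open>\<lambda>x. f x $ one\<close>, and the map \<open>G\<close> consists of the other components.
  \<open>fp\<close> and \<open>fm\<close> are smooth maps restricting to \<open>f\<close> on \<open>X\<^sup>+\<close> and \<open>X\<^sup>-\<close>.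
\<close>

definition stitched_lagrangian_fibration ::
    "('m::{t2_space,second_countable_topology}, 'e::euclidean_space) mfd \<Rightarrow>
     ('m \<Rightarrow> 'e \<Rightarrow> 'e \<Rightarrow> real) \<Rightarrow> (real \<Rightarrow> 'm \<Rightarrow> 'm) \<Rightarrow> 'n::finite \<Rightarrow>
     ('m \<Rightarrow> real^'n) \<Rightarrow> ('m \<Rightarrow> real^'n) \<Rightarrow> ('m \<Rightarrow> real^'n) \<Rightarrow> bool" where
  "stitched_lagrangian_fibration X \<omega> \<theta> one f fp fm \<longleftrightarrow>
     symplectic_manifold (2 * CARD('n)) X \<omega> \<and>
     hamiltonian_circle_action X \<omega> \<theta> (\<lambda>x. f x $ one) \<and> free_circle_action X \<theta> \<and>
     continuous_on (pts X) f \<and>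
     (\<forall>x\<in>pts X. \<forall>t. \<forall>j. j \<noteq> one \<longrightarrow> f (\<theta> t x) $ j = f x $ j) \<and>
     lagrangian_half X \<omega> {x\<in>pts X. f x $ one \<ge> 0} f fp \<and>
     lagrangian_half X \<omega> {x\<in>pts X. f x $ one \<le> 0} f fm"

definition seam :: "('m, 'e) mfd \<Rightarrow> 'n \<Rightarrow> ('m \<Rightarrow> real^'n) \<Rightarrow> 'm set" where
  "seam X one f = {x\<in>pts X. f x $ one = 0}"

text \<open>\<open>p : Z \<rightarrow> B\<close> is the quotient of the manifold \<open>Z\<close> by the free circle action, as a manifold: a
  smooth surjective submersion whose fibres are the orbits.\<close>

definition orbit_quotient ::
    "('m::topological_space, 'e::euclidean_space) mfd \<Rightarrow> (real \<Rightarrow> 'm \<Rightarrow> 'm) \<Rightarrow>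
     ('c::{t2_space,second_countable_topology}, 'd::euclidean_space) mfd \<Rightarrow> ('m \<Rightarrow> 'c) \<Rightarrow> bool" where
  "orbit_quotient Z \<theta> B p \<longleftrightarrow>
     smooth_manifold (dim (model Z) - 1) B \<and> smooth_map Z B p \<and> p ` pts Z = pts B \<and>
     (\<forall>x\<in>pts Z. dmap Z B p x ` model Z = model B) \<and>
     (\<forall>x\<in>pts Z. \<forall>y\<in>pts Z. p x = p y \<longleftrightarrow> (\<exists>t. y = \<theta> t x))"

text \<open>\<open>w = p\<^sub>* v\<close>, for \<open>v\<close> a tangent vector of \<open>X\<close> at \<open>x\<close> that is tangent to the submanifold \<open>Z\<close>.\<close>

definition pushes_to ::
    "('m, 'e::real_normed_vector) mfd \<Rightarrow> ('m, 'e) mfd \<Rightarrow> ('c, 'd::real_normed_vector) mfd \<Rightarrow>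
     ('m \<Rightarrow> 'c) \<Rightarrow> 'm \<Rightarrow> 'e \<Rightarrow> 'd \<Rightarrow> bool" where
  "pushes_to X Z B p x v w \<longleftrightarrow> (\<exists>u\<in>model Z. dmap Z X id x u = v \<and> dmap Z B p x u = w)"

definition ker_dfun ::
    "('m, 'e::real_normed_vector) mfd \<Rightarrow> ('m \<Rightarrow> 'b::real_normed_vector) \<Rightarrow> 'm \<Rightarrow> 'e set" where
  "ker_dfun M h x = {u\<in>model M. dfun M h x u = 0}"

text \<open>
  \<open>l z\<close> is a linear functional on the kernel of the differential of \<open>h\<close> at \<open>z\<close>; its restriction to a
  fibre of \<open>h\<close> is the pull-back under the inclusion. The existential quantifier only says that
  the fibre is a submanifold; its smooth structure does not depend on \<open>E0\<close>.
\<close>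

definition fibrewise_closed ::
    "('m::topological_space, 'e::real_normed_vector) mfd \<Rightarrow> ('m \<Rightarrow> 'b::real_normed_vector) \<Rightarrow>
     'b set \<Rightarrow> ('m \<Rightarrow> 'e \<Rightarrow> real) \<Rightarrow> bool" where
  "fibrewise_closed M h B l \<longleftrightarrow>
     (\<forall>b\<in>B. let F = {z\<in>pts M. h z = b} in
        \<exists>E0. embedded_submanifold M E0 F \<and>
             closed_one_form (submfd M E0 F) (\<lambda>z u. l z (dmap (submfd M E0 F) M id z u)))"

end

(*
Restrict to a fibre of f in the seam and contract its tangent vectors v with omega. Since the fibre is
Lagrangian, omega(v, .) is a combination of the differentials of the components of fp, and also of fm;
its coefficients are 1-forms on the fibre. As d fp_j - d fm_j = a_j d mu along the seam, the two
coefficient vectors differ in the first entry only, and the difference of the first entries is the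
pull-back of ell. So it suffices that each first coefficient is closed. It is the contraction of omega
with a vector field W over the direction of b_1. In coordinates in which W is a constant field, omega
vanishes on the fibres of one half, hence its one-sided derivative along W vanishes on the fibre, and
d omega = 0 turns this into closedness of the contraction.
*)
theory Submission
  imports Defs
begin

section \<open>Calculus of smooth maps on open subsets of a subspace\<close>

text \<open>The fibres of \<open>fp\<close> and of \<open>fm\<close> are known to be Lagrangian only
  on their own side of the seam. One side is enough because all data are smooth across the seam: a
  derivative that exists on both sides can be computed from one of them. Hence the transversal field
  must point into its half. For the minus half it lies over -e_1, and the sign is restored when the
  two contractions are combined. The field may otherwise be chosen freely: the fibre directions form
  a Lagrangian kernel, so contracting such a direction with \<open>\<omega>\<close> depends on the
  other argument only through its image in R^n. Coordinates can therefore be chosen anew at each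
  point and for each half. The statement itself concerns the quotient of the seam, so a patch of a
  fibre there is lifted to X by a local section of \<open>p\<close>; the lift is irrelevant since
  the final difference depends on the projected vector only. Charts take values in subspaces, where
  derivatives are determined on the subspace alone; composition with orthogonal projections leads
  back to open sets of the whole space.\<close>

definition onb :: "'e::euclidean_space set \<Rightarrow> 'e set" where
  "onb E = (SOME B. B \<subseteq> E \<and> pairwise orthogonal B \<and> (\<forall>x\<in>B. norm x = 1) \<and>
                    independent B \<and> span B = E)"

text \<open>The orthogonal projection onto a subspace E. It is used to expand vectors of E in
  coordinates and, by composition, to extend maps from open subsets of E to open subsets of the
  whole space.\<close>

definition orth_proj :: "'e::euclidean_space set \<Rightarrow> 'e \<Rightarrow> 'e" where
  "orth_proj E x = (\<Sum>b\<in>onb E. (x \<bullet> b) *\<^sub>R b)"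

lemma onb:
  assumes "subspace E"
  shows "onb E \<subseteq> E" "pairwise orthogonal (onb E)" "\<And>x. x \<in> onb E \<Longrightarrow> norm x = 1"
    "independent (onb E)" "span (onb E) = E" "finite (onb E)"
proof -
  have "\<exists>B. B \<subseteq> E \<and> pairwise orthogonal B \<and> (\<forall>x\<in>B. norm x = 1) \<and> independent B \<and> span B = E"
    using orthonormal_basis_subspace[OF assms] by metis
  from someI_ex[OF this] show "onb E \<subseteq> E" "pairwise orthogonal (onb E)"
    "\<And>x. x \<in> onb E \<Longrightarrow> norm x = 1" "independent (onb E)" "span (onb E) = E"
    unfolding onb_def[symmetric] by auto
  then show "finite (onb E)" by (simp add: independent_imp_finite)
qed

lemma bounded_linear_orth_proj: "bounded_linear (orth_proj E)"
  unfolding orth_proj_def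
  by (intro bounded_linear_sum bounded_linear_compose[OF bounded_linear_scaleR_left]
      bounded_linear_inner_left)

lemma linear_orth_proj: "linear (orth_proj E)"
  using bounded_linear_orth_proj bounded_linear.linear by blast

lemma orth_proj_in: "subspace E \<Longrightarrow> orth_proj E x \<in> E"
  unfolding orth_proj_def using onb(1) by (intro subspace_sum subspace_scale) auto

lemma orth_proj_eq:
  assumes "subspace E" "x \<in> E" shows "orth_proj E x = x"
proof -
  note B = onb[OF assms(1)]
  have eq: "orth_proj E b = b" if "b \<in> onb E" for b
  proof -
    have "orth_proj E b = (\<Sum>c\<in>onb E. if c = b then b else 0)"
      unfolding orth_proj_def
    proof (intro sum.cong refl)
      fix c assume c: "c \<in> onb E"
      show "(b \<bullet> c) *\<^sub>R c = (if c = b then b else 0)"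
        using B(2,3)[unfolded pairwise_def orthogonal_def] that c
        by (auto simp: norm_eq_1)
    qed
    also have "\<dots> = b" using that B(6) by simp
    finally show ?thesis .
  qed
  have "x \<in> span (onb E)" using B(5) assms(2) by simp
  then show ?thesis
    using linear_eq_on_span[OF linear_orth_proj linear_ident, of "onb E"] eq by blast
qed

lemma orth_proj_diff: "subspace E \<Longrightarrow> orth_proj E (x - orth_proj E x) = 0"
  by (simp add: linear_diff[OF linear_orth_proj] orth_proj_eq orth_proj_in)

lemma onb_expand: "subspace E \<Longrightarrow> x \<in> E \<Longrightarrow> (\<Sum>b\<in>onb E. (x \<bullet> b) *\<^sub>R b) = x"
  using orth_proj_eq unfolding orth_proj_def by blast


section \<open>Derivatives within relatively open subsets of a subspace\<close>

lemma at_within_openin: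
  assumes "openin (top_of_set S) T" "y \<in> T"
  shows "at y within T = at y within S"
proof -
  obtain O' where "open O'" "T = S \<inter> O'" using assms(1) by (auto simp: openin_open)
  then show ?thesis using assms(2) by (intro at_within_nhd[of _ O']) auto
qed

lemma openin_line:
  fixes E :: "'e::real_normed_vector set"
  assumes "subspace E" "openin (top_of_set E) S" "y \<in> S" "u \<in> E"
  obtains e where "0 < e" "\<And>t. \<bar>t\<bar> < e \<Longrightarrow> y + t *\<^sub>R u \<in> S"
proof -
  obtain O' where O': "open O'" "S = E \<inter> O'" using assms(2) by (auto simp: openin_open)
  have "((\<lambda>t. y + t *\<^sub>R u) \<longlongrightarrow> y + 0 *\<^sub>R u) (at 0)" by (intro tendsto_intros)
  then have "\<forall>\<^sub>F t in at 0. y + t *\<^sub>R u \<in> O'"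
    using O' assms(3) by (auto dest!: topological_tendstoD)
  then obtain e where e: "0 < e" "\<And>t. t \<noteq> 0 \<Longrightarrow> \<bar>t\<bar> < e \<Longrightarrow> y + t *\<^sub>R u \<in> O'"
    by (auto simp: eventually_at dist_real_def)
  have "y + t *\<^sub>R u \<in> S" if "\<bar>t\<bar> < e" for t
    using e(2)[of t] that O'(2) assms by (cases "t = 0") (auto intro: subspace_add subspace_scale)
  then show ?thesis using that e(1) by blast
qed

lemma has_vector_derivative_line:
  fixes E :: "'e::real_normed_vector set"
  assumes "subspace E" "openin (top_of_set E) S" "y \<in> S" "u \<in> E"
    and "(f has_derivative D) (at y within S)"
  shows "((\<lambda>t. f (y + t *\<^sub>R u)) has_vector_derivative D u) (at 0)"
proof -
  obtain e where e: "0 < e" "\<And>t. \<bar>t\<bar> < e \<Longrightarrow> y + t *\<^sub>R u \<in> S"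
    using openin_line[OF assms(1-4)] by blast
  let ?T = "{-e<..<e}"
  have l: "((\<lambda>t. y + t *\<^sub>R u) has_derivative (\<lambda>t. t *\<^sub>R u)) (at 0 within ?T)"
    by (auto intro!: derivative_eq_intros)
  have "(f has_derivative D) (at (y + 0 *\<^sub>R u) within (\<lambda>t. y + t *\<^sub>R u) ` ?T)"
    using has_derivative_subset[OF assms(5), of "(\<lambda>t. y + t *\<^sub>R u) ` ?T"] e(2) by (simp add: image_subset_iff abs_less_iff)
  from has_derivative_in_compose[OF l this]
  have "((\<lambda>t. f (y + t *\<^sub>R u)) has_derivative (\<lambda>t. D (t *\<^sub>R u))) (at 0)"
    using e(1) by (simp add: at_within_open[of _ ?T])
  then show ?thesis
    by (simp add: has_vector_derivative_def linear_scale has_derivative_linear[OF assms(5)])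
qed

text \<open>A line through y in a direction of E stays in S for small times, so both values are the
  velocity of one curve. Nothing is determined in directions outside E.\<close>

lemma has_derivative_unique_on:
  fixes E :: "'e::real_normed_vector set"
  assumes "subspace E" "openin (top_of_set E) S" "y \<in> S" "u \<in> E"
    and "(f has_derivative D) (at y within S)" "(f has_derivative D') (at y within S)"
  shows "D u = D' u"
  using vector_derivative_unique_at has_vector_derivative_line[OF assms(1-4)] assms(5,6) by blast

lemma frechet_derivative_on:
  fixes E :: "'e::real_normed_vector set"
  assumes "subspace E" "openin (top_of_set E) S" "y \<in> S" "u \<in> E"
    and "(f has_derivative D) (at y within S)"
  shows "frechet_derivative f (at y within S) u = D u"
  using has_derivative_unique_on[OF assms(1-4) _ assms(5)] assms(5)
    frechet_derivative_works differentiable_def by blast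

text \<open>Projecting f onto E' does not change f, so the projection of D is another derivative of
  f; uniqueness on E equates the two.\<close>

lemma has_derivative_in_subspace:
  fixes E :: "'e::real_normed_vector set" and E' :: "'b::euclidean_space set"
  assumes "subspace E" "openin (top_of_set E) S" "y \<in> S" "u \<in> E"
    and "(f has_derivative D) (at y within S)" "subspace E'" "f ` S \<subseteq> E'"
  shows "D u \<in> E'"
proof -
  have "((\<lambda>y. orth_proj E' (f y)) has_derivative (\<lambda>v. orth_proj E' (D v))) (at y within S)"
    by (rule bounded_linear.has_derivative[OF bounded_linear_orth_proj assms(5)])
  then have "(f has_derivative (\<lambda>v. orth_proj E' (D v))) (at y within S)"
    by (rule has_derivative_transform[rotated 2])
      (use assms in \<open>auto simp: orth_proj_eq image_subset_iff\<close>)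
  from has_derivative_unique_on[OF assms(1-5) this]
  show ?thesis using orth_proj_in[OF assms(6)] by metis
qed


section \<open>Calculus of C^k maps\<close>

lemma Ck_on_SucI:
  "(\<And>y. y \<in> S \<Longrightarrow> (f has_derivative D y) (at y within S)) \<Longrightarrow>
   (\<And>u. u \<in> E \<Longrightarrow> Ck_on k E S (\<lambda>y. D y u)) \<Longrightarrow> Ck_on (Suc k) E S f"
  by auto

lemma Ck_on_SucE:
  assumes "Ck_on (Suc k) E S f"
  obtains D where "\<forall>y\<in>S. (f has_derivative D y) (at y within S)"
    "\<forall>u\<in>E. Ck_on k E S (\<lambda>y. D y u)"
  using assms by auto

declare Ck_on.simps(2) [simp del]

lemma Ck_on_transform:
  assumes "Ck_on k E S f" "\<And>y. y \<in> S \<Longrightarrow> f y = g y"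
  shows "Ck_on k E S g"
proof (cases k)
  case 0
  then show ?thesis using assms by (auto simp: continuous_on_eq)
next
  case (Suc m)
  then obtain D where D: "\<forall>y\<in>S. (f has_derivative D y) (at y within S)"
    "\<forall>u\<in>E. Ck_on m E S (\<lambda>y. D y u)" using assms(1) Ck_on_SucE by blast
  have "\<forall>y\<in>S. (g has_derivative D y) (at y within S)"
    using D(1) assms(2) by (auto intro: has_derivative_transform[of _ S g f])
  then show ?thesis using D(2) Suc Ck_on_SucI by blast
qed

lemma Ck_on_SucD: "Ck_on (Suc k) E S f \<Longrightarrow> Ck_on k E S f"
proof (induction k arbitrary: f)
  case 0
  then show ?case by (auto elim!: Ck_on_SucE intro: has_derivative_continuous_on)
next
  case (Suc k)
  then obtain D where D: "\<forall>y\<in>S. (f has_derivative D y) (at y within S)"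
    "\<forall>u\<in>E. Ck_on (Suc k) E S (\<lambda>y. D y u)" using Ck_on_SucE by blast
  then show ?case using Suc.IH by (intro Ck_on_SucI) blast+
qed

lemma Ck_on_mono:
  assumes "Ck_on k E S f" "E' \<subseteq> E" "S' \<subseteq> S"
  shows "Ck_on k E' S' f"
  using assms(1)
proof (induction k arbitrary: f)
  case 0
  then show ?case using assms continuous_on_subset by auto
next
  case (Suc k)
  then obtain D where D: "\<forall>y\<in>S. (f has_derivative D y) (at y within S)"
    "\<forall>u\<in>E. Ck_on k E S (\<lambda>y. D y u)" using Ck_on_SucE by blast
  have "\<forall>y\<in>S'. (f has_derivative D y) (at y within S')"
    using D(1) assms(3) by (auto intro: has_derivative_subset)
  then show ?case using D(2) Suc.IH assms(2) by (intro Ck_on_SucI[of S' f D]) blast+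
qed

lemma Ck_on_const: "Ck_on k E S (\<lambda>_. c)"
proof (induction k arbitrary: c)
  case (Suc k)
  then show ?case by (intro Ck_on_SucI[of _ _ "\<lambda>_ _. 0"]) auto
qed simp

lemma Ck_on_ident: "Ck_on k E S (\<lambda>y. y)"
proof (cases k)
  case (Suc m)
  then show ?thesis by (auto intro!: Ck_on_SucI[of _ _ "\<lambda>_ u. u"] Ck_on_const)
qed (simp add: continuous_on_id)

lemma Ck_on_linear:
  assumes "bounded_linear L" "Ck_on k E S f"
  shows "Ck_on k E S (\<lambda>y. L (f y))"
  using assms(2)
proof (induction k arbitrary: f)
  case 0
  then show ?case using bounded_linear.continuous_on[OF assms(1)] by auto
next
  case (Suc k)
  then obtain D where D: "\<forall>y\<in>S. (f has_derivative D y) (at y within S)"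
    "\<forall>u\<in>E. Ck_on k E S (\<lambda>y. D y u)" using Ck_on_SucE by blast
  show ?case
    by (auto intro!: Ck_on_SucI[of _ _ "\<lambda>y u. L (D y u)"] Suc.IH D(2)[rule_format]
        bounded_linear.has_derivative[OF assms(1)] D(1)[rule_format])
qed

lemma Ck_on_add: "Ck_on k E S f \<Longrightarrow> Ck_on k E S g \<Longrightarrow> Ck_on k E S (\<lambda>y. f y + g y)"
proof (induction k arbitrary: f g)
  case 0
  then show ?case by (auto intro: continuous_on_add)
next
  case (Suc k)
  from Suc.prems(1) obtain D where D: "\<forall>y\<in>S. (f has_derivative D y) (at y within S)"
    "\<forall>u\<in>E. Ck_on k E S (\<lambda>y. D y u)" using Ck_on_SucE by blast
  from Suc.prems(2) obtain D' where D': "\<forall>y\<in>S. (g has_derivative D' y) (at y within S)"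
    "\<forall>u\<in>E. Ck_on k E S (\<lambda>y. D' y u)" using Ck_on_SucE by blast
  show ?case
    by (auto intro!: Ck_on_SucI[of _ _ "\<lambda>y u. D y u + D' y u"] Suc.IH D(2)[rule_format] D'(2)[rule_format]
        has_derivative_add D(1)[rule_format] D'(1)[rule_format])
qed

lemma Ck_on_sum:
  "(\<And>i. i \<in> I \<Longrightarrow> Ck_on k E S (f i)) \<Longrightarrow> Ck_on k E S (\<lambda>y. \<Sum>i\<in>I. f i y)"
  by (induction I rule: infinite_finite_induct) (auto intro: Ck_on_const Ck_on_add)

lemma Ck_on_bilinear:
  assumes "bounded_bilinear pr" "Ck_on k E S f" "Ck_on k E S g"
  shows "Ck_on k E S (\<lambda>y. pr (f y) (g y))"
  using assms(2,3)
proof (induction k arbitrary: f g)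
  case 0
  then show ?case using bounded_bilinear.continuous_on[OF assms(1)] by auto
next
  case (Suc k)
  from Suc.prems(1) obtain D where D: "\<forall>y\<in>S. (f has_derivative D y) (at y within S)"
    "\<forall>u\<in>E. Ck_on k E S (\<lambda>y. D y u)" using Ck_on_SucE by blast
  from Suc.prems(2) obtain D' where D': "\<forall>y\<in>S. (g has_derivative D' y) (at y within S)"
    "\<forall>u\<in>E. Ck_on k E S (\<lambda>y. D' y u)" using Ck_on_SucE by blast
  note c = Ck_on_SucD[OF Suc.prems(1)] Ck_on_SucD[OF Suc.prems(2)]
  show ?case
    by (auto intro!: Ck_on_SucI[of _ _ "\<lambda>y u. pr (f y) (D' y u) + pr (D y u) (g y)"] Suc.IH c Ck_on_add
        D(2)[rule_format] D'(2)[rule_format] bounded_bilinear.FDERIV[OF assms(1)]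
        D(1)[rule_format] D'(1)[rule_format])
qed

text \<open>The derivative \<open>D' (f y) (D y u)\<close> has a moving direction, whereas
  \<open>Ck_on\<close> controls derivatives in fixed directions only. Since \<open>D y u\<close>
  lies in E', expanding it in an orthonormal basis of E' gives a finite sum of products to which the
  induction hypothesis applies.\<close>

lemma Ck_on_compose:
  fixes E :: "'e::real_normed_vector set" and E' :: "'b::euclidean_space set"
  assumes "subspace E" "openin (top_of_set E) S" "subspace E'" "f ` S \<subseteq> T" "T \<subseteq> E'"
    and "Ck_on k E S f" "Ck_on k E' T g"
  shows "Ck_on k E S (\<lambda>y. g (f y))"
  using assms(6,7)
proof (induction k arbitrary: g)
  case 0
  then show ?case using assms(4) by (auto intro: continuous_on_compose2)
next
  case (Suc k)
  from Suc.prems(1) obtain D where D: "\<forall>y\<in>S. (f has_derivative D y) (at y within S)"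
    "\<forall>u\<in>E. Ck_on k E S (\<lambda>y. D y u)" using Ck_on_SucE by blast
  from Suc.prems(2) obtain D' where D': "\<forall>y\<in>T. (g has_derivative D' y) (at y within T)"
    "\<forall>u\<in>E'. Ck_on k E' T (\<lambda>y. D' y u)" using Ck_on_SucE by blast
  have d: "((\<lambda>y. g (f y)) has_derivative (\<lambda>u. D' (f y) (D y u))) (at y within S)" if "y \<in> S" for y
    using has_derivative_in_compose2[of T g D'] D(1) D'(1) assms(4) that by blast
  have "Ck_on k E S (\<lambda>y. D' (f y) (D y u))" if "u \<in> E" for u
  proof (rule Ck_on_transform)
    show "Ck_on k E S (\<lambda>y. \<Sum>b\<in>onb E'. (D y u \<bullet> b) *\<^sub>R D' (f y) b)"
    proof (intro Ck_on_sum Ck_on_bilinear[OF bounded_bilinear_scaleR])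
      fix b assume "b \<in> onb E'"
      then have "b \<in> E'" using onb(1)[OF assms(3)] by blast
      then show "Ck_on k E S (\<lambda>y. D' (f y) b)"
        using Suc.IH[OF Ck_on_SucD[OF Suc.prems(1)]] D'(2) by blast
      show "Ck_on k E S (\<lambda>y. D y u \<bullet> b)"
        using Ck_on_linear[OF bounded_linear_inner_left] D(2) that by blast
    qed
    fix y assume y: "y \<in> S"
    have "D y u \<in> E'"
      using has_derivative_in_subspace[OF assms(1,2) y that _ assms(3)] D(1) y assms(4,5) by blast
    then have "D' (f y) (D y u) = D' (f y) (\<Sum>b\<in>onb E'. (D y u \<bullet> b) *\<^sub>R b)"
      using onb_expand[OF assms(3)] by simp
    moreover have "linear (D' (f y))" using D'(1) assms(4) y has_derivative_linear by blast
    ultimately show "(\<Sum>b\<in>onb E'. (D y u \<bullet> b) *\<^sub>R D' (f y) b) = D' (f y) (D y u)"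
      by (simp add: linear_sum linear_scale)
  qed
  then show ?case using d by (auto intro!: Ck_on_SucI[of _ _ "\<lambda>y u. D' (f y) (D y u)"])
qed

text \<open>On vectors of E every local derivative agrees with the Frechet derivative within S, so
  this one function serves on all of S and the local choices need not be glued.\<close>

lemma Ck_on_local:
  fixes E :: "'e::real_normed_vector set"
  assumes "subspace E" "openin (top_of_set E) S"
    and "\<And>y. y \<in> S \<Longrightarrow> \<exists>T. y \<in> T \<and> openin (top_of_set E) T \<and> T \<subseteq> S \<and> Ck_on k E T f"
  shows "Ck_on k E S f"
  using assms(3)
proof (induction k arbitrary: f)
  case 0
  have "\<forall>y\<in>S. continuous (at y within S) f"
  proof
    fix y assume y: "y \<in> S"
    obtain T where T: "y \<in> T" "openin (top_of_set E) T" "T \<subseteq> S" "Ck_on 0 E T f"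
      using 0[OF y] by blast
    have "at y within T = at y within S"
      using at_within_openin[OF openin_subset_trans[OF T(2,3) openin_imp_subset[OF assms(2)]] T(1)] .
    moreover have "continuous (at y within T) f"
      using T(1,4) continuous_on_eq_continuous_within by (metis Ck_on.simps(1))
    ultimately show "continuous (at y within S) f" by simp
  qed
  then show ?case using continuous_on_eq_continuous_within by (metis Ck_on.simps(1))
next
  case (Suc k)
  have *: "\<exists>T. y \<in> T \<and> openin (top_of_set E) T \<and> T \<subseteq> S \<and>
     (\<forall>z\<in>T. (f has_derivative frechet_derivative f (at z within S)) (at z within S)) \<and>
     (\<forall>u\<in>E. Ck_on k E T (\<lambda>z. frechet_derivative f (at z within S) u))"
    if y: "y \<in> S" for y
  proof -
    obtain T where T: "y \<in> T" "openin (top_of_set E) T" "T \<subseteq> S" "Ck_on (Suc k) E T f"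
      using Suc.prems[OF y] by blast
    obtain D where D: "\<forall>y\<in>T. (f has_derivative D y) (at y within T)"
      "\<forall>u\<in>E. Ck_on k E T (\<lambda>y. D y u)" using T(4) Ck_on_SucE by blast
    have eq: "at z within T = at z within S" if "z \<in> T" for z
      using at_within_openin[OF openin_subset_trans[OF T(2,3) openin_imp_subset[OF assms(2)]] that] .
    have d: "(f has_derivative D z) (at z within S)" if "z \<in> T" for z
      using D(1) eq[OF that] that by metis
    then have "\<forall>z\<in>T. (f has_derivative frechet_derivative f (at z within S)) (at z within S)"
      using frechet_derivative_works differentiable_def by blast
    moreover have "\<forall>u\<in>E. Ck_on k E T (\<lambda>z. frechet_derivative f (at z within S) u)"
    proof
      fix u assume u: "u \<in> E"
      have "Ck_on k E T (\<lambda>y. D y u)" using D(2) u by blast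
      then show "Ck_on k E T (\<lambda>z. frechet_derivative f (at z within S) u)"
        by (rule Ck_on_transform)
          (use frechet_derivative_on[OF assms(1,2) _ u d] T(3) in auto)
    qed
    ultimately show ?thesis using T by blast
  qed
  show ?case
  proof (rule Ck_on_SucI)
    fix u assume u: "u \<in> E"
    show "Ck_on k E S (\<lambda>z. frechet_derivative f (at z within S) u)"
    proof (rule Suc.IH)
      fix y assume "y \<in> S"
      then show "\<exists>T. y \<in> T \<and> openin (top_of_set E) T \<and> T \<subseteq> S \<and>
          Ck_on k E T (\<lambda>z. frechet_derivative f (at z within S) u)"
        using *[of y] u by blast
    qed
  next
    fix z assume "z \<in> S"
    then show "(f has_derivative frechet_derivative f (at z within S)) (at z within S)"
      using *[of z] by blast
  qed
qed


section \<open>Smooth maps\<close>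

lemma smooth_on_transform:
  "smooth_on E S f \<Longrightarrow> (\<And>y. y \<in> S \<Longrightarrow> f y = g y) \<Longrightarrow> smooth_on E S g"
  by (auto simp: smooth_on_def intro: Ck_on_transform)

lemma smooth_on_mono: "smooth_on E S f \<Longrightarrow> E' \<subseteq> E \<Longrightarrow> S' \<subseteq> S \<Longrightarrow> smooth_on E' S' f"
  by (auto simp: smooth_on_def intro: Ck_on_mono)

lemma smooth_on_const: "smooth_on E S (\<lambda>_. c)"
  by (auto simp: smooth_on_def intro: Ck_on_const)

lemma smooth_on_ident: "smooth_on E S (\<lambda>y. y)"
  by (auto simp: smooth_on_def intro: Ck_on_ident)

lemma smooth_on_linear: "bounded_linear L \<Longrightarrow> smooth_on E S f \<Longrightarrow> smooth_on E S (\<lambda>y. L (f y))"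
  by (auto simp: smooth_on_def intro: Ck_on_linear)

lemma smooth_on_add: "smooth_on E S f \<Longrightarrow> smooth_on E S g \<Longrightarrow> smooth_on E S (\<lambda>y. f y + g y)"
  by (auto simp: smooth_on_def intro: Ck_on_add)

lemma smooth_on_diff:
  assumes "smooth_on E S f" "smooth_on E S g" shows "smooth_on E S (\<lambda>y. f y - g y)"
  using smooth_on_add[OF assms(1) smooth_on_linear[OF bounded_linear_minus[OF bounded_linear_ident] assms(2)]]
  by simp

lemma smooth_on_sum:
  "(\<And>i. i \<in> I \<Longrightarrow> smooth_on E S (f i)) \<Longrightarrow> smooth_on E S (\<lambda>y. \<Sum>i\<in>I. f i y)"
  by (auto simp: smooth_on_def intro: Ck_on_sum)

lemma smooth_on_bilinear:
  "bounded_bilinear pr \<Longrightarrow> smooth_on E S f \<Longrightarrow> smooth_on E S g \<Longrightarrow> smooth_on E S (\<lambda>y. pr (f y) (g y))"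
  by (auto simp: smooth_on_def intro: Ck_on_bilinear)

lemma smooth_on_compose:
  fixes E :: "'e::real_normed_vector set" and E' :: "'b::euclidean_space set"
  assumes "subspace E" "openin (top_of_set E) S" "subspace E'" "f ` S \<subseteq> T" "T \<subseteq> E'"
    and "smooth_on E S f" "smooth_on E' T g"
  shows "smooth_on E S (\<lambda>y. g (f y))"
  using assms(6,7) by (auto simp: smooth_on_def intro: Ck_on_compose[OF assms(1-5)])

lemma smooth_on_local:
  fixes E :: "'e::real_normed_vector set"
  assumes "subspace E" "openin (top_of_set E) S"
    and "\<And>y. y \<in> S \<Longrightarrow> \<exists>T. y \<in> T \<and> openin (top_of_set E) T \<and> T \<subseteq> S \<and> smooth_on E T f"
  shows "smooth_on E S f"
proof -
  have "Ck_on k E S f" for k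
  proof (rule Ck_on_local[OF assms(1,2)])
    fix y assume y: "y \<in> S"
    obtain T where T: "y \<in> T" "openin (top_of_set E) T" "T \<subseteq> S" "smooth_on E T f"
      using assms(3)[OF y] by (elim exE conjE)
    then show "\<exists>T. y \<in> T \<and> openin (top_of_set E) T \<and> T \<subseteq> S \<and> Ck_on k E T f"
      by (intro exI[of _ T]) (simp add: smooth_on_def)
  qed
  then show ?thesis by (simp add: smooth_on_def)
qed

lemma smooth_on_continuous: "smooth_on E S f \<Longrightarrow> continuous_on S f"
  unfolding smooth_on_def by (metis Ck_on.simps(1))

lemma smooth_on_has_derivative:
  assumes "smooth_on E S f" "y \<in> S"
  shows "(f has_derivative frechet_derivative f (at y within S)) (at y within S)"
proof -
  have "Ck_on (Suc 0) E S f" using assms(1) unfolding smooth_on_def by blast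
  then obtain D where "\<forall>y\<in>S. (f has_derivative D y) (at y within S)" using Ck_on_SucE by blast
  then show ?thesis using assms(2) frechet_derivative_works unfolding differentiable_def by blast
qed

text \<open>The derivative provided by \<open>Ck_on\<close> may depend on the order k; uniqueness on
  E identifies all of these with the Frechet derivative.\<close>

lemma smooth_on_frechet:
  fixes E :: "'e::real_normed_vector set"
  assumes "subspace E" "openin (top_of_set E) S" "smooth_on E S f" "u \<in> E"
  shows "smooth_on E S (\<lambda>y. frechet_derivative f (at y within S) u)"
  unfolding smooth_on_def
proof
  fix k
  have "Ck_on (Suc k) E S f" using assms(3) unfolding smooth_on_def by blast
  then obtain D where D: "\<forall>y\<in>S. (f has_derivative D y) (at y within S)"
    "\<forall>u\<in>E. Ck_on k E S (\<lambda>y. D y u)" using Ck_on_SucE by blast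
  have "Ck_on k E S (\<lambda>y. D y u)" using D assms by blast
  then show "Ck_on k E S (\<lambda>y. frechet_derivative f (at y within S) u)"
    by (rule Ck_on_transform)
      (rule frechet_derivative_on[OF assms(1,2) _ assms(4), symmetric], use D(1) in auto)
qed


subsection \<open>The smooth inverse function theorem\<close>

text \<open>Continuity of the inverse operators comes from invariance of domain, applied to
  \<open>(y, u) \<mapsto> (y, A y u)\<close>; the same map yields their differentiability.\<close>

lemma Ck_on_operator_inverse:
  fixes A J :: "'e::euclidean_space \<Rightarrow> 'e \<Rightarrow> 'e"
  assumes V: "open V" and lin: "\<And>y. y \<in> V \<Longrightarrow> linear (A y)"
    and AJ: "\<And>y u. y \<in> V \<Longrightarrow> A y (J y u) = u" and JA: "\<And>y u. y \<in> V \<Longrightarrow> J y (A y u) = u"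
    and C: "\<And>u. Ck_on k UNIV V (\<lambda>y. A y u)"
  shows "Ck_on k UNIV V (\<lambda>y. J y u)"
proof -
  let ?H = "\<lambda>z. (fst z, A (fst z) (snd z))"
  have A_exp: "A y u = (\<Sum>i\<in>Basis. (u \<bullet> i) *\<^sub>R A y i)" if "y \<in> V" for y u
  proof -
    have "A y u = A y (\<Sum>i\<in>Basis. (u \<bullet> i) *\<^sub>R i)" by (simp add: euclidean_representation)
    then show ?thesis using lin[OF that] by (simp add: linear_sum linear_scale)
  qed
  have linJ: "linear (J y)" if "y \<in> V" for y
  proof (rule linearI)
    fix u v and c :: real
    show "J y (u + v) = J y u + J y v"
      using AJ[OF that] JA[OF that] linear_add[OF lin[OF that]] by metis
    show "J y (c *\<^sub>R u) = c *\<^sub>R J y u"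
      using AJ[OF that] JA[OF that] linear_scale[OF lin[OF that]] by metis
  qed
  have J_exp: "J y u = (\<Sum>i\<in>Basis. (u \<bullet> i) *\<^sub>R J y i)" if "y \<in> V" for y u
  proof -
    have "J y u = J y (\<Sum>i\<in>Basis. (u \<bullet> i) *\<^sub>R i)" by (simp add: euclidean_representation)
    then show ?thesis using linJ[OF that] by (simp add: linear_sum linear_scale)
  qed
  have cont: "continuous_on (V \<times> UNIV) (\<lambda>z. J (fst z) (snd z))"
    if c: "\<And>u. continuous_on V (\<lambda>y. A y u)"
  proof -
    have "continuous_on (V \<times> UNIV) (\<lambda>z. (fst z, \<Sum>i\<in>Basis. (snd z \<bullet> i) *\<^sub>R A (fst z) i))"
      by (intro continuous_intros continuous_on_compose2[OF c continuous_on_fst]) auto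
    then have cH: "continuous_on (V \<times> UNIV) ?H"
      by (rule continuous_on_eq) (use A_exp in auto)
    have inj: "inj_on ?H (V \<times> UNIV)"
    proof (rule inj_onI)
      fix x y assume h: "x \<in> V \<times> UNIV" "y \<in> V \<times> UNIV" "?H x = ?H y"
      have e: "fst x = fst y" "A (fst x) (snd x) = A (fst y) (snd y)"
        using arg_cong[OF h(3), of fst] arg_cong[OF h(3), of snd] by (simp_all only: fst_conv snd_conv)
      have "fst x \<in> V" "fst y \<in> V" using h(1,2) by (simp_all add: mem_Times_iff)
      then have "snd x = snd y" using JA e by metis
      then show "x = y" using e(1) by (simp add: prod_eq_iff)
    qed
    have im: "?H ` (V \<times> UNIV) = V \<times> UNIV"
    proof (intro equalityI subsetI)
      fix z assume "z \<in> V \<times> (UNIV :: 'e set)"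
      then have "fst z \<in> V" by (simp add: mem_Times_iff)
      moreover from this have "z = ?H (fst z, J (fst z) (snd z))" by (simp add: AJ)
      ultimately
      show "z \<in> ?H ` (V \<times> UNIV)" by (intro image_eqI) auto
    qed auto
    obtain g where g: "homeomorphism (V \<times> UNIV) (?H ` (V \<times> UNIV)) ?H g"
      using invariance_of_domain_homeomorphism[OF open_Times[OF V open_UNIV] cH _ inj] by auto
    have gJ: "g z = (fst z, J (fst z) (snd z))" if "z \<in> V \<times> UNIV" for z
    proof -
      have z: "fst z \<in> V" using that by (simp add: mem_Times_iff)
      then have "?H (fst z, J (fst z) (snd z)) = z" by (simp add: AJ)
      moreover have "g (?H (fst z, J (fst z) (snd z))) = (fst z, J (fst z) (snd z))"
        using homeomorphism_apply1[OF g, of "(fst z, J (fst z) (snd z))"] z by simp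
      ultimately show ?thesis by simp
    qed
    have "continuous_on (V \<times> UNIV) (\<lambda>z. snd (g z))"
      using homeomorphism_cont2[OF g] unfolding im by (rule continuous_on_snd)
    then show ?thesis by (rule continuous_on_eq) (use gJ in auto)
  qed
  show ?thesis using C
  proof (induction k arbitrary: u)
    case 0
    have "continuous_on V (\<lambda>y. J (fst (y, u)) (snd (y, u)))"
      by (rule continuous_on_compose2[OF cont]) (use 0 in \<open>auto intro!: continuous_intros\<close>)
    then show ?case by simp
  next
    case (Suc k)
    have C0: "continuous_on V (\<lambda>y. A y u)" for u
      using Suc.prems[of u] by (auto elim!: Ck_on_SucE intro: has_derivative_continuous_on)
    have "\<exists>D. (\<forall>y\<in>V. ((\<lambda>y. A y u) has_derivative D y) (at y within V)) \<and>
              (\<forall>h\<in>UNIV. Ck_on k UNIV V (\<lambda>y. D y h))" for u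
      using Suc.prems[of u] Ck_on_SucE by blast
    then obtain D where D0: "\<And>u. (\<forall>y\<in>V. ((\<lambda>y. A y u) has_derivative D u y) (at y within V)) \<and>
              (\<forall>h\<in>UNIV. Ck_on k UNIV V (\<lambda>y. D u y h))" by metis
    then have D: "\<And>u y. y \<in> V \<Longrightarrow> ((\<lambda>y. A y u) has_derivative D u y) (at y within V)"
      "\<And>u h. Ck_on k UNIV V (\<lambda>y. D u y h)" by simp_all
    have CA: "Ck_on k UNIV V (\<lambda>y. A y u)" for u using Suc.prems Ck_on_SucD by blast
    note CJ = Suc.IH[OF CA]
    \<comment> \<open>Differentiating A J u = u gives dJ = -J (dA) J u. Here \<open>T y h\<close> is
      the factor (dA)(h) applied to \<open>J y u\<close>, written in a basis because A is
      differentiable on fixed vectors.\<close>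
    define T where "T y h = (\<Sum>i\<in>Basis. (J y u \<bullet> i) *\<^sub>R D i y h)" for y h
    have "((\<lambda>y. J y u) has_derivative (\<lambda>h. - J y (T y h))) (at y within V)" if y: "y \<in> V" for y
    proof -
      have atV: "at y within V = at y" using V y at_within_open by blast
      have bl: "bounded_linear (D i y)" for i using D(1)[OF y] has_derivative_bounded_linear by blast
      have dH: "(?H has_derivative (\<lambda>z. (fst z, A y (snd z) + T y (fst z)))) (at (y, J y u))"
      proof -
        have Di: "((\<lambda>z. A (fst z) i) has_derivative (\<lambda>z. D i y (fst z))) (at (y, J y u))" for i
        proof -
          have "((\<lambda>y. A y i) has_derivative D i y) (at (fst (y, J y u)))"
            using D(1)[OF y] atV by simp
          then show ?thesis
            using has_derivative_compose[OF has_derivative_fst[OF has_derivative_ident]] by blast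
        qed
        have "((\<lambda>z. (fst z, \<Sum>i\<in>Basis. (snd z \<bullet> i) *\<^sub>R A (fst z) i)) has_derivative
           (\<lambda>z. (fst z, \<Sum>i\<in>Basis. (J y u \<bullet> i) *\<^sub>R D i y (fst z) + (snd z \<bullet> i) *\<^sub>R A y i))) (at (y, J y u))"
          by (auto intro!: derivative_eq_intros Di)
        then have "(?H has_derivative
           (\<lambda>z. (fst z, \<Sum>i\<in>Basis. (J y u \<bullet> i) *\<^sub>R D i y (fst z) + (snd z \<bullet> i) *\<^sub>R A y i))) (at (y, J y u))"
          by (rule has_derivative_transform_within_open[OF _ open_Times[OF V open_UNIV]])
            (use y A_exp in auto)
        moreover have "(\<Sum>i\<in>Basis. (J y u \<bullet> i) *\<^sub>R D i y (fst z) + (snd z \<bullet> i) *\<^sub>R A y i) =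
            A y (snd z) + T y (fst z)" for z
          using A_exp[OF y, of "snd z"] by (simp add: T_def sum.distrib add.commute)
        ultimately show ?thesis by simp
      qed
      let ?G = "\<lambda>z. (fst z, J (fst z) (snd z))"
      \<comment> \<open>Solving w = A v + T h for v inverts the derivative of
        \<open>?H\<close>.\<close>
      let ?g' = "\<lambda>z. (fst z, J y (snd z - T y (fst z)))"
      have blJ: "bounded_linear (J y)" using linJ[OF y] linear_linear by blast
      have blT: "bounded_linear (T y)" unfolding T_def
        by (intro bounded_linear_sum bounded_linear_scaleR_const bounded_linear_compose[OF bounded_linear_scaleR_right] bl)
      have "(?G has_derivative ?g') (at (y, u))"
      proof (rule has_derivative_inverse_basic[where f = ?H and T = "V \<times> UNIV"])
        show "(?H has_derivative (\<lambda>z. (fst z, A y (snd z) + T y (fst z)))) (at (?G (y, u)))"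
          using dH by simp
        show "bounded_linear ?g'"
          by (intro bounded_linear_Pair bounded_linear_fst bounded_linear_compose[OF blJ]
              bounded_linear_sub bounded_linear_snd bounded_linear_compose[OF blT])
        show "?g' \<circ> (\<lambda>z. (fst z, A y (snd z) + T y (fst z))) = id"
          using JA[OF y] by (auto simp: fun_eq_iff)
        have "continuous_on (V \<times> UNIV) ?G"
          by (intro continuous_on_Pair continuous_on_fst continuous_on_id cont C0)
        then show "continuous (at (y, u)) ?G"
          using continuous_on_eq_continuous_at[OF open_Times[OF V open_UNIV]] y by blast
        show "open (V \<times> (UNIV :: 'e set))" using V by (simp add: open_Times)
      qed (use y AJ in auto)
      then have "((\<lambda>z. snd (?G z)) has_derivative (\<lambda>z. snd (?g' z))) (at (y, u))"
        by (rule has_derivative_snd)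
      moreover have "((\<lambda>w. (w, u)) has_derivative (\<lambda>h. (h, 0))) (at y)"
        by (intro has_derivative_Pair has_derivative_ident has_derivative_const)
      ultimately have "((\<lambda>w. snd (?G (w, u))) has_derivative (\<lambda>h. snd (?g' (h, 0)))) (at y)"
        using has_derivative_compose[of "\<lambda>w. (w, u)" "\<lambda>h. (h, 0)" y UNIV "\<lambda>z. snd (?G z)"] by blast
      then show ?thesis using linear_diff[OF linJ[OF y], of 0] linear_0[OF linJ[OF y]] atV by simp
    qed
    moreover have "Ck_on k UNIV V (\<lambda>y. - J y (T y h))" for h
    proof -
      have "Ck_on k UNIV V (\<lambda>y. T y h)" unfolding T_def
        by (intro Ck_on_sum Ck_on_bilinear[OF bounded_bilinear_scaleR] D(2)
            Ck_on_linear[OF bounded_linear_inner_left] CJ)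
      then have "Ck_on k UNIV V (\<lambda>y. - (\<Sum>i\<in>Basis. (T y h \<bullet> i) *\<^sub>R J y i))"
        by (intro Ck_on_linear[OF bounded_linear_minus[OF bounded_linear_ident]] Ck_on_sum
            Ck_on_bilinear[OF bounded_bilinear_scaleR] Ck_on_linear[OF bounded_linear_inner_left] CJ)
      then show ?thesis by (rule Ck_on_transform) (simp add: J_exp[symmetric])
    qed
    ultimately show ?case by (rule Ck_on_SucI)
  qed
qed

text \<open>Bootstrapping: the derivative of g at y is the inverse of the operator
  \<open>?D (g y)\<close>. If g is C^k, these operators depend on y in a C^k way, hence so do their
  inverses, and g is C^(k+1).\<close>

lemma smooth_inverse_function_UNIV:
  fixes f :: "'e::euclidean_space \<Rightarrow> 'e"
  assumes f: "smooth_on UNIV S f" and S: "open S" "x0 \<in> S"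
    and inj: "\<And>u. frechet_derivative f (at x0) u = 0 \<Longrightarrow> u = 0"
  obtains U V g where "open U" "x0 \<in> U" "U \<subseteq> S" "open V" "homeomorphism U V f g"
    "smooth_on UNIV V g"
proof -
  let ?D = "\<lambda>x. frechet_derivative f (at x)"
  have at: "at x within S = at x" if "x \<in> S" for x using S that at_within_open by blast
  have D: "(f has_derivative ?D x) (at x)" if "x \<in> S" for x
    using smooth_on_has_derivative[OF f that] at[OF that] by simp
  have bl: "bounded_linear (?D x)" if "x \<in> S" for x using D[OF that] has_derivative_bounded_linear by blast
  have smD: "smooth_on UNIV S (\<lambda>x. ?D x u)" for u
  proof (rule smooth_on_transform)
    show "smooth_on UNIV S (\<lambda>x. frechet_derivative f (at x within S) u)"
      using smooth_on_frechet[of UNIV S f u] f S by simp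
  qed (simp add: at)
  define f' where "f' x = Blinfun (?D x)" for x
  have f': "blinfun_apply (f' x) = ?D x" if "x \<in> S" for x
    unfolding f'_def using bl[OF that] by (simp add: bounded_linear_Blinfun_apply)
  have cont: "continuous_on S f'"
  proof (rule continuous_on_blinfun_componentwise)
    fix i :: 'e assume "i \<in> Basis"
    have "continuous_on S (\<lambda>x. ?D x i)" using smooth_on_continuous[OF smD] .
    then show "continuous_on S (\<lambda>x. blinfun_apply (f' x) i)"
      by (rule continuous_on_eq) (simp add: f')
  qed
  have "linear (?D x0)" "inj (?D x0)"
    using bl[OF S(2)] bounded_linear.linear inj linear_injective_0 by blast+
  then obtain h where h: "linear h" "h \<circ> ?D x0 = id"
    using linear_injective_left_inverse by blast
  have inv: "Blinfun h o\<^sub>L f' x0 = id_blinfun"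
    by (rule blinfun_eqI)
      (use h f'[OF S(2)] in \<open>simp add: bounded_linear_Blinfun_apply linear_linear[symmetric] linear_conv_bounded_linear fun_eq_iff\<close>)
  obtain U V g g' where g: "open U" "U \<subseteq> S" "x0 \<in> U" "open V" "f x0 \<in> V" "homeomorphism U V f g"
    "\<And>y. y \<in> V \<Longrightarrow> (g has_derivative (g' y)) (at y)"
    "\<And>y. y \<in> V \<Longrightarrow> g' y = inv (blinfun_apply (f'(g y)))"
    "\<And>y. y \<in> V \<Longrightarrow> bij (blinfun_apply (f'(g y)))"
    using inverse_function_theorem[OF S(1) _ cont S(2) inv] D f' by metis
  have gV: "g ` V \<subseteq> S" using g(2,6) unfolding homeomorphism_def by blast
  have "Ck_on k UNIV V g" for k
  proof (induction k)
    case 0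
    then show ?case using g(6) unfolding homeomorphism_def by simp
  next
    case (Suc k)
    show ?case
    proof (rule Ck_on_SucI)
      fix y assume "y \<in> V"
      then show "(g has_derivative g' y) (at y within V)"
        using g(7) has_derivative_at_withinI by blast
    next
      fix u :: 'e
      show "Ck_on k UNIV V (\<lambda>y. g' y u)"
      proof (rule Ck_on_operator_inverse[where A = "\<lambda>y. ?D (g y)"])
        show "open V" by (rule g(4))
        fix y assume y: "y \<in> V"
        then have gy: "g y \<in> S" using gV by blast
        show "linear (?D (g y))" using bl[OF gy] bounded_linear.linear by blast
        fix u
        show "?D (g y) (g' y u) = u" "g' y (?D (g y) u) = u"
          using g(8,9)[OF y] f'[OF gy] by (metis bij_inv_eq_iff)+
      next
        fix u
        show "Ck_on k UNIV V (\<lambda>y. ?D (g y) u)"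
          using Ck_on_compose[of UNIV V UNIV g S k "\<lambda>x. ?D x u"] g(4) gV Suc smD[of u]
          unfolding smooth_on_def by simp
      qed
    qed
  qed
  then show ?thesis using that[of U V g] g unfolding smooth_on_def by blast
qed

text \<open>The map F acts as f on the component in E and as the identity on the orthogonal
  component. It has an injective derivative on the whole space wherever f has one on E, and its
  local inverse preserves E.\<close>

theorem smooth_inverse_function:
  fixes f :: "'e::euclidean_space \<Rightarrow> 'e"
  assumes E: "subspace E" "openin (top_of_set E) S" and f: "smooth_on E S f" "f ` S \<subseteq> E"
    and x0: "x0 \<in> S" "(f has_derivative D) (at x0 within S)" "\<And>u. u \<in> E \<Longrightarrow> D u = 0 \<Longrightarrow> u = 0"
  obtains U V g where "openin (top_of_set E) U" "x0 \<in> U" "U \<subseteq> S" "openin (top_of_set E) V"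
    "homeomorphism U V f g" "smooth_on E V g"
proof -
  let ?P = "orth_proj E"
  define S' where "S' = ?P -` S"
  have S': "open S'"
  proof -
    have "openin (top_of_set UNIV) (UNIV \<inter> ?P -` S)"
      by (rule continuous_openin_preimage[OF _ _ E(2)])
        (auto simp: orth_proj_in[OF E(1)] linear_continuous_on[OF bounded_linear_orth_proj])
    then show ?thesis by (simp add: S'_def)
  qed
  have SE: "S \<subseteq> E" using E(2) openin_imp_subset by blast
  have P_S: "?P x = x" if "x \<in> E" for x using orth_proj_eq E that by blast
  have SS': "S \<subseteq> S'" using SE P_S unfolding S'_def by auto
  define F where "F x = f (?P x) + (x - ?P x)" for x
  have smP: "smooth_on UNIV S' ?P"
    using smooth_on_linear[OF bounded_linear_orth_proj smooth_on_ident] .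
  have smF: "smooth_on UNIV S' F" unfolding F_def
    by (intro smooth_on_add smooth_on_diff smooth_on_ident smP smooth_on_compose[OF _ _ E(1) _ SE smP f(1)])
      (use S' in \<open>auto simp: S'_def\<close>)
  have D_in: "D u \<in> E" if "u \<in> E" for u
    using has_derivative_in_subspace[OF E x0(1) that x0(2) E(1) f(2)] .
  have x0E: "?P x0 = x0" using x0 SE P_S by blast
  have dF: "(F has_derivative (\<lambda>u. D (?P u) + (u - ?P u))) (at x0 within S')"
  proof -
    have dP: "(?P has_derivative ?P) (at x0 within S')"
      using bounded_linear_imp_has_derivative[OF bounded_linear_orth_proj] .
    have "(f has_derivative D) (at (?P x0) within ?P ` S')"
      using has_derivative_subset[OF x0(2)] x0E by (auto simp: S'_def)
    from has_derivative_in_compose[OF dP this]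
    show ?thesis unfolding F_def by (intro derivative_intros dP)
  qed
  obtain U V g where g: "open U" "x0 \<in> U" "U \<subseteq> S'" "open V" "homeomorphism U V F g"
    "smooth_on UNIV V g"
  proof (rule smooth_inverse_function_UNIV[OF smF S'])
    show "x0 \<in> S'" using x0 SS' by blast
    then have "at x0 within S' = at x0" using at_within_open S' by blast
    then have "(F has_derivative (\<lambda>u. D (?P u) + (u - ?P u))) (at x0)"
      using dF by simp
    then have eq: "frechet_derivative F (at x0) = (\<lambda>u. D (?P u) + (u - ?P u))"
      using frechet_derivative_at by metis
    fix u assume "frechet_derivative F (at x0) u = 0"
    then have z: "D (?P u) + (u - ?P u) = 0" unfolding eq .
    then have "?P (D (?P u)) + ?P (u - ?P u) = 0"
      using linear_add[OF linear_orth_proj] linear_0[OF linear_orth_proj] by metis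
    then have "D (?P u) = 0" using orth_proj_diff[OF E(1)] P_S D_in orth_proj_in[OF E(1)] by simp
    moreover from this have "?P u = 0" using x0(3) orth_proj_in[OF E(1)] by blast
    ultimately show "u = 0" using z by simp
  qed
  have Ff: "F x = f x" if "x \<in> E" for x using P_S[OF that] by (simp add: F_def)
  have US: "U \<inter> E \<subseteq> S" using g(3) P_S unfolding S'_def by auto
  \<comment> \<open>The orthogonal component of \<open>g y\<close> equals y - f(P(g y)), a vector of
    E, and so vanishes.\<close>
  have gE: "g y \<in> U \<inter> E" if "y \<in> V \<inter> E" for y
  proof -
    have gU: "g y \<in> U" "F (g y) = y" using g(5) that unfolding homeomorphism_def by auto
    then have "g y - ?P (g y) = y - f (?P (g y))" unfolding F_def by (simp add: algebra_simps)
    moreover have "f (?P (g y)) \<in> E" using gU(1) g(3) f(2) unfolding S'_def by auto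
    ultimately have "g y - ?P (g y) \<in> E" using that subspace_diff[OF E(1)] by auto
    then have "g y - ?P (g y) = 0" using orth_proj_diff[OF E(1)] P_S by metis
    then show ?thesis using gU(1) orth_proj_in[OF E(1)] by (metis IntI eq_iff_diff_eq_0)
  qed
  have fE: "f x \<in> V \<inter> E" if "x \<in> U \<inter> E" for x
    using that US f(2) Ff g(5) unfolding homeomorphism_def by (metis IntD1 IntD2 IntI image_subset_iff subset_iff image_eqI)
  have hom: "homeomorphism (U \<inter> E) (V \<inter> E) f g"
    unfolding homeomorphism_def
  proof (intro conjI ballI)
    show c: "continuous_on (U \<inter> E) f" using smooth_on_continuous[OF f(1)] US continuous_on_subset by blast
    show "continuous_on (V \<inter> E) g"
      by (rule continuous_on_subset[OF homeomorphism_cont2[OF g(5)]]) simp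
    show gf: "g (f x) = x" if "x \<in> U \<inter> E" for x
      using homeomorphism_apply1[OF g(5), of x] that Ff by simp
    show fg: "f (g y) = y" if "y \<in> V \<inter> E" for y
      using homeomorphism_apply2[OF g(5), of y] that gE[OF that] Ff by simp
    show "f ` (U \<inter> E) = V \<inter> E"
      using fE gE fg by (intro equalityI subsetI) (auto, metis IntI imageI)
    show "g ` (V \<inter> E) = U \<inter> E"
      using fE gE gf by (intro equalityI subsetI) (auto, metis IntI imageI)
  qed
  show ?thesis
  proof (rule that[OF _ _ US _ hom])
    show "x0 \<in> U \<inter> E" using g x0 SE by blast
    show "openin (top_of_set E) (U \<inter> E)" "openin (top_of_set E) (V \<inter> E)"
      using g by (auto simp: openin_open)
    show "smooth_on E (V \<inter> E) g" using smooth_on_mono[OF g(6)] by auto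
  qed
qed


section \<open>Closed two-forms in coordinates\<close>

lemma smooth_has_derivative_at:
  assumes "smooth_on UNIV S f" "open S" "y \<in> S"
  shows "(f has_derivative frechet_derivative f (at y)) (at y)"
  using smooth_on_has_derivative[OF assms(1,3)] unfolding at_within_open[OF assms(3,2)] .

lemma smooth_frechet_at:
  fixes f :: "'e::euclidean_space \<Rightarrow> 'b::real_normed_vector"
  assumes "smooth_on UNIV S f" "open S"
  shows "smooth_on UNIV S (\<lambda>y. frechet_derivative f (at y) u)"
proof -
  have "smooth_on UNIV S (\<lambda>y. frechet_derivative f (at y within S) u)"
    using assms by (intro smooth_on_frechet) simp_all
  then show ?thesis
    by (rule smooth_on_transform) (simp only: at_within_open[OF _ assms(2)])
qed

lemma frechet_derivative_at_eq: "(f has_derivative D) (at y) \<Longrightarrow> frechet_derivative f (at y) u = D u"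
  by (drule frechet_derivative_at) (simp add: fun_eq_iff)

lemma frechet_linear:
  assumes "smooth_on UNIV S f" "open S" "y \<in> S"
  shows "linear (frechet_derivative f (at y))"
  using has_derivative_linear[OF smooth_has_derivative_at[OF assms]] .

lemma has_real_derivative_line:
  fixes f :: "'e::real_normed_vector \<Rightarrow> real"
  assumes "(f has_derivative D) (at (x + s *\<^sub>R u))"
  shows "((\<lambda>s. f (x + s *\<^sub>R u)) has_real_derivative D u) (at s)"
proof -
  have "((\<lambda>s. x + s *\<^sub>R u) has_derivative (\<lambda>s. s *\<^sub>R u)) (at s)"
    by (auto intro!: derivative_eq_intros)
  from has_derivative_compose[OF this assms]
  show ?thesis
    using linear_scale[OF has_derivative_linear[OF assms]]
    by (simp add: has_field_derivative_def mult_commute_abs)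
qed

text \<open>The mean value theorem is applied twice: to the increment of f along v as a function of
  the u-coordinate, and then to the resulting increment of the u-derivative along v. The left-hand
  side is symmetric in u and v, the right-hand side is not visibly so.\<close>

lemma second_difference_mean_value:
  fixes f :: "'e::euclidean_space \<Rightarrow> real"
  assumes f: "smooth_on UNIV S f" "open S" and h: "0 < h"
    and box: "\<And>s t. 0 \<le> s \<Longrightarrow> s \<le> h \<Longrightarrow> 0 \<le> t \<Longrightarrow> t \<le> h \<Longrightarrow> x + s *\<^sub>R u + t *\<^sub>R v \<in> S"
  obtains s t where "0 < s" "s < h" "0 < t" "t < h"
    "f (x + h *\<^sub>R u + h *\<^sub>R v) - f (x + h *\<^sub>R u) - f (x + h *\<^sub>R v) + f x =
     h * h * frechet_derivative (\<lambda>y. frechet_derivative f (at y) u) (at (x + s *\<^sub>R u + t *\<^sub>R v)) v"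
proof -
  let ?a = "\<lambda>y. frechet_derivative f (at y) u"
  let ?G = "\<lambda>s. f (x + h *\<^sub>R v + s *\<^sub>R u) - f (x + s *\<^sub>R u)"
  have "(?G has_real_derivative ?a (x + h *\<^sub>R v + s *\<^sub>R u) - ?a (x + s *\<^sub>R u)) (at s)"
    if "0 \<le> s" "s \<le> h" for s
    using box[of s h] box[of s 0] that h
    by (intro DERIV_diff has_real_derivative_line smooth_has_derivative_at[OF f])
      (simp_all add: algebra_simps)
  from MVT2[OF h this] obtain s where s: "0 < s" "s < h"
    "?G h - ?G 0 = h * (?a (x + h *\<^sub>R v + s *\<^sub>R u) - ?a (x + s *\<^sub>R u))"
    by auto
  have "((\<lambda>t. ?a (x + s *\<^sub>R u + t *\<^sub>R v)) has_real_derivative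
      frechet_derivative ?a (at (x + s *\<^sub>R u + t *\<^sub>R v)) v) (at t)" if "0 \<le> t" "t \<le> h" for t
    using box[of s t] that s
    by (intro has_real_derivative_line smooth_has_derivative_at[OF smooth_frechet_at[OF f] f(2)]) simp_all
  from MVT2[OF h this] obtain t where t: "0 < t" "t < h"
    "?a (x + s *\<^sub>R u + h *\<^sub>R v) - ?a (x + s *\<^sub>R u) =
      h * frechet_derivative ?a (at (x + s *\<^sub>R u + t *\<^sub>R v)) v"
    by auto
  show ?thesis
    by (rule that[OF s(1,2) t(1,2)]) (use s(3) t(3) in \<open>simp add: algebra_simps\<close>)
qed

text \<open>The two mixed derivatives agree at suitable points of every small parallelogram at x,
  since both represent the same second difference. Continuity carries the equality to x.\<close>

lemma symmetric_second_derivative_real: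
  fixes f :: "'e::euclidean_space \<Rightarrow> real"
  assumes f: "smooth_on UNIV S f" "open S" "x \<in> S"
  shows "frechet_derivative (\<lambda>y. frechet_derivative f (at y) u) (at x) v =
         frechet_derivative (\<lambda>y. frechet_derivative f (at y) v) (at x) u"
proof (rule ccontr)
  let ?D2 = "\<lambda>u v x. frechet_derivative (\<lambda>y. frechet_derivative f (at y) u) (at x) v"
  assume ne: "?D2 u v x \<noteq> ?D2 v u x"
  \<comment> \<open>Half the supposed gap: two errors below e cannot bridge it.\<close>
  define e where "e = \<bar>?D2 u v x - ?D2 v u x\<bar> / 2"
  have e: "0 < e" using ne by (simp add: e_def)
  have c: "isCont (?D2 u v) x" for u v
    using smooth_on_continuous[OF smooth_frechet_at[OF smooth_frechet_at[OF f(1,2)] f(2)]]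
      continuous_on_eq_continuous_at[OF f(2)] f(3) by blast
  have "\<forall>\<^sub>F y in nhds x. y \<in> S \<and> dist (?D2 u v y) (?D2 u v x) < e \<and> dist (?D2 v u y) (?D2 v u x) < e"
    using c[of u v] c[of v u] e f(2,3) unfolding isCont_def
    by (intro eventually_conj) (auto simp: tendsto_iff eventually_at_filter elim!: eventually_mono
        intro: eventually_nhds_in_open)
  then obtain d where d: "0 < d" and near: "\<And>y. dist y x < d \<Longrightarrow>
      y \<in> S \<and> dist (?D2 u v y) (?D2 u v x) < e \<and> dist (?D2 v u y) (?D2 v u x) < e"
    unfolding eventually_nhds_metric by blast
  \<comment> \<open>The parallelogram with edges h u and h v then lies within distance d of x; the
    summand 1 avoids division by zero and makes the estimate strict.\<close>
  define h where "h = d / (norm u + norm v + 1)"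
  have pos: "0 < norm u + norm v + 1" by (simp add: add_nonneg_pos)
  then have h: "0 < h" using d by (simp add: h_def)
  have nr: "dist (x + s *\<^sub>R u + t *\<^sub>R v) x < d" if "0 \<le> s" "s \<le> h" "0 \<le> t" "t \<le> h" for s t u' v'
  proof -
    have "dist (x + s *\<^sub>R u + t *\<^sub>R v) x = norm (s *\<^sub>R u + t *\<^sub>R v)"
      by (simp add: dist_norm algebra_simps)
    also have "\<dots> \<le> norm (s *\<^sub>R u) + norm (t *\<^sub>R v)" by (rule norm_triangle_ineq)
    also have "\<dots> = s * norm u + t * norm v" using that by simp
    also have "\<dots> \<le> h * norm u + h * norm v" using that by (intro add_mono mult_right_mono) auto
    also have "\<dots> < h * (norm u + norm v + 1)" using h by (simp add: algebra_simps)
    also have "\<dots> = d" using pos by (simp add: h_def)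
    finally show ?thesis .
  qed
  obtain s t where st: "0 < s" "s < h" "0 < t" "t < h"
    "f (x + h *\<^sub>R u + h *\<^sub>R v) - f (x + h *\<^sub>R u) - f (x + h *\<^sub>R v) + f x = h * h * ?D2 u v (x + s *\<^sub>R u + t *\<^sub>R v)"
    using second_difference_mean_value[OF f(1,2) h, of x u v] near nr by blast
  have nr': "dist (x + t *\<^sub>R v + s *\<^sub>R u) x < d" if "0 \<le> s" "s \<le> h" "0 \<le> t" "t \<le> h" for s t
    using nr[OF that] by (simp add: algebra_simps)
  obtain t' s' where st': "0 < t'" "t' < h" "0 < s'" "s' < h"
    "f (x + h *\<^sub>R v + h *\<^sub>R u) - f (x + h *\<^sub>R v) - f (x + h *\<^sub>R u) + f x = h * h * ?D2 v u (x + t' *\<^sub>R v + s' *\<^sub>R u)"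
    using second_difference_mean_value[OF f(1,2) h, of x v u] near nr' by blast
  have "h * h * ?D2 u v (x + s *\<^sub>R u + t *\<^sub>R v) = h * h * ?D2 v u (x + t' *\<^sub>R v + s' *\<^sub>R u)"
    using st(5) st'(5) by (simp add: algebra_simps)
  then have eq: "?D2 u v (x + s *\<^sub>R u + t *\<^sub>R v) = ?D2 v u (x + t' *\<^sub>R v + s' *\<^sub>R u)" using h by simp
  have "dist (?D2 u v (x + s *\<^sub>R u + t *\<^sub>R v)) (?D2 u v x) < e"
    using near[OF nr[of s t]] st by simp
  moreover have "dist (?D2 v u (x + t' *\<^sub>R v + s' *\<^sub>R u)) (?D2 v u x) < e"
    using near[OF nr'[of s' t']] st' by simp
  moreover have "\<bar>a - b\<bar> < 2 * e" if "dist p a < e" "dist p b < e" for a b p :: real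
    using that by (simp add: dist_real_def)
  ultimately have "\<bar>?D2 u v x - ?D2 v u x\<bar> < 2 * e" using eq by metis
  then show False by (simp add: e_def)
qed

lemma symmetric_second_derivative:
  fixes f :: "'e::euclidean_space \<Rightarrow> 'b::euclidean_space"
  assumes f: "smooth_on UNIV S f" "open S" "x \<in> S"
  shows "frechet_derivative (\<lambda>y. frechet_derivative f (at y) u) (at x) v =
         frechet_derivative (\<lambda>y. frechet_derivative f (at y) v) (at x) u"
proof (rule euclidean_eqI)
  fix b :: 'b assume "b \<in> Basis"
  have sm: "smooth_on UNIV S (\<lambda>y. f y \<bullet> b)" using smooth_on_linear[OF bounded_linear_inner_left f(1)] .
  have d1: "frechet_derivative (\<lambda>y. f y \<bullet> b) (at y) u = frechet_derivative f (at y) u \<bullet> b"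
    if "y \<in> S" for y u
    by (rule frechet_derivative_at_eq)
      (rule bounded_linear.has_derivative[OF bounded_linear_inner_left smooth_has_derivative_at[OF f(1,2) that]])
  have d2: "frechet_derivative (\<lambda>y. frechet_derivative (\<lambda>y. f y \<bullet> b) (at y) u) (at x) v =
      frechet_derivative (\<lambda>y. frechet_derivative f (at y) u) (at x) v \<bullet> b" for u v
  proof (rule frechet_derivative_at_eq)
    have "((\<lambda>y. frechet_derivative f (at y) u \<bullet> b) has_derivative
       (\<lambda>v. frechet_derivative (\<lambda>y. frechet_derivative f (at y) u) (at x) v \<bullet> b)) (at x)"
      by (rule bounded_linear.has_derivative[OF bounded_linear_inner_left
            smooth_has_derivative_at[OF smooth_frechet_at[OF f(1,2)] f(2,3)]])
    then show "((\<lambda>y. frechet_derivative (\<lambda>y. f y \<bullet> b) (at y) u) has_derivative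
       (\<lambda>v. frechet_derivative (\<lambda>y. frechet_derivative f (at y) u) (at x) v \<bullet> b)) (at x)"
      by (rule has_derivative_transform_within_open[OF _ f(2,3)]) (simp add: d1)
  qed
  show "frechet_derivative (\<lambda>y. frechet_derivative f (at y) u) (at x) v \<bullet> b =
        frechet_derivative (\<lambda>y. frechet_derivative f (at y) v) (at x) u \<bullet> b"
    using symmetric_second_derivative_real[OF sm f(2,3), of u v] d2 by simp
qed


section \<open>Closed two-forms on open sets, their pull-backs and contractions\<close>

definition dform :: "('e::real_normed_vector \<Rightarrow> 'e \<Rightarrow> 'e \<Rightarrow> real) \<Rightarrow> 'e \<Rightarrow> 'e \<Rightarrow> 'e \<Rightarrow> 'e \<Rightarrow> real" where
  "dform w x h u v = frechet_derivative (\<lambda>x. w x u v) (at x) h"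

text \<open>Constant vector fields commute, so on them the exterior derivative is the cyclic sum of
  \<open>dform\<close>, without bracket terms.\<close>

locale closed_form_on =
  fixes S :: "'e::euclidean_space set" and w :: "'e \<Rightarrow> 'e \<Rightarrow> 'e \<Rightarrow> real"
  assumes open_S: "open S"
    and bilin: "\<And>x. x \<in> S \<Longrightarrow> bilinear (w x)"
    and anti: "\<And>x u v. x \<in> S \<Longrightarrow> w x u v = - w x v u"
    and smooth: "\<And>u v. smooth_on UNIV S (\<lambda>x. w x u v)"
    and closed: "\<And>x u v t. x \<in> S \<Longrightarrow> dform w x u v t + dform w x v t u + dform w x t u v = 0"
begin

lemma expand:
  assumes "x \<in> S"
  shows "w x u v = (\<Sum>i\<in>Basis. \<Sum>j\<in>Basis. (u \<bullet> i) * (v \<bullet> j) * w x i j)"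
proof -
  have "w x u v = w x (\<Sum>i\<in>Basis. (u \<bullet> i) *\<^sub>R i) (\<Sum>j\<in>Basis. (v \<bullet> j) *\<^sub>R j)"
    by (simp add: euclidean_representation)
  also have "\<dots> = (\<Sum>(i,j)\<in>Basis \<times> Basis. w x ((u \<bullet> i) *\<^sub>R i) ((v \<bullet> j) *\<^sub>R j))"
    by (rule bilinear_sum[OF bilin[OF assms]])
  also have "\<dots> = (\<Sum>i\<in>Basis. \<Sum>j\<in>Basis. (u \<bullet> i) * (v \<bullet> j) * w x i j)"
    by (simp add: sum.cartesian_product bilinear_lmul[OF bilin[OF assms]]
        bilinear_rmul[OF bilin[OF assms]] mult_ac)
  finally show ?thesis .
qed

lemma has_derivative_dform: "x \<in> S \<Longrightarrow> ((\<lambda>x. w x u v) has_derivative (\<lambda>h. dform w x h u v)) (at x)"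
  using smooth_has_derivative_at[OF smooth open_S] unfolding dform_def .

lemma dform_anti: assumes "x \<in> S" shows "dform w x h u v = - dform w x h v u"
proof -
  have "((\<lambda>x. - w x v u) has_derivative (\<lambda>h. - dform w x h v u)) (at x)"
    by (rule has_derivative_minus[OF has_derivative_dform[OF assms]])
  then have "((\<lambda>x. w x u v) has_derivative (\<lambda>h. - dform w x h v u)) (at x)"
    by (rule has_derivative_transform_within_open[OF _ open_S assms]) (rule anti[symmetric])
  then show ?thesis unfolding dform_def by (rule frechet_derivative_at_eq)
qed

lemma dform_expand:
  assumes "x \<in> S"
  shows "dform w x h u v = (\<Sum>i\<in>Basis. \<Sum>j\<in>Basis. (u \<bullet> i) * (v \<bullet> j) * dform w x h i j)"
proof -
  have "((\<lambda>x. \<Sum>i\<in>Basis. \<Sum>j\<in>Basis. (u \<bullet> i) * (v \<bullet> j) * w x i j) has_derivative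
      (\<lambda>h. \<Sum>i\<in>Basis. \<Sum>j\<in>Basis. (u \<bullet> i) * (v \<bullet> j) * dform w x h i j)) (at x)"
    by (intro has_derivative_sum has_derivative_mult_right has_derivative_dform[OF assms])
  then have "((\<lambda>x. w x u v) has_derivative
      (\<lambda>h. \<Sum>i\<in>Basis. \<Sum>j\<in>Basis. (u \<bullet> i) * (v \<bullet> j) * dform w x h i j)) (at x)"
    by (rule has_derivative_transform_within_open[OF _ open_S assms]) (simp only: expand[symmetric])
  then show ?thesis unfolding dform_def[of w x h u v] by (rule frechet_derivative_at_eq)
qed

text \<open>Base point and both arguments move at once; expansion in the basis reduces this to the
  product rule for scalar functions.\<close>

lemma has_derivative_form:
  fixes y :: "'d::real_normed_vector"
  assumes T: "open T" "y \<in> T" "\<And>z. z \<in> T \<Longrightarrow> a z \<in> S"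
    and a: "(a has_derivative a') (at y)"
    and b: "(b has_derivative b') (at y)"
    and c: "(c has_derivative c') (at y)"
  shows "((\<lambda>z. w (a z) (b z) (c z)) has_derivative
      (\<lambda>h. dform w (a y) (a' h) (b y) (c y) + w (a y) (b' h) (c y) + w (a y) (b y) (c' h))) (at y)"
proof -
  have ay: "a y \<in> S" using T by blast
  have wd: "((\<lambda>z. w (a z) i j) has_derivative (\<lambda>h. dform w (a y) (a' h) i j)) (at y)" for i j
    using has_derivative_compose[OF a has_derivative_dform[OF ay]] .
  have "((\<lambda>z. \<Sum>i\<in>Basis. \<Sum>j\<in>Basis. (b z \<bullet> i) * (c z \<bullet> j) * w (a z) i j) has_derivative
      (\<lambda>h. \<Sum>i\<in>Basis. \<Sum>j\<in>Basis. (b y \<bullet> i) * (c y \<bullet> j) * dform w (a y) (a' h) i j +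
         ((b y \<bullet> i) * (c' h \<bullet> j) + (b' h \<bullet> i) * (c y \<bullet> j)) * w (a y) i j)) (at y)"
    by (intro has_derivative_sum has_derivative_mult wd has_derivative_inner_left b c)
  then have "((\<lambda>z. w (a z) (b z) (c z)) has_derivative
      (\<lambda>h. \<Sum>i\<in>Basis. \<Sum>j\<in>Basis. (b y \<bullet> i) * (c y \<bullet> j) * dform w (a y) (a' h) i j +
         ((b y \<bullet> i) * (c' h \<bullet> j) + (b' h \<bullet> i) * (c y \<bullet> j)) * w (a y) i j)) (at y)"
    by (rule has_derivative_transform_within_open[OF _ T(1,2)]) (simp only: expand[OF T(3), symmetric])
  moreover have "(\<Sum>i\<in>Basis. \<Sum>j\<in>Basis. (b y \<bullet> i) * (c y \<bullet> j) * dform w (a y) (a' h) i j +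
         ((b y \<bullet> i) * (c' h \<bullet> j) + (b' h \<bullet> i) * (c y \<bullet> j)) * w (a y) i j) =
      dform w (a y) (a' h) (b y) (c y) + w (a y) (b' h) (c y) + w (a y) (b y) (c' h)" for h
    by (simp only: expand[OF ay, of "b' h" "c y"] expand[OF ay, of "b y" "c' h"]
        dform_expand[OF ay, of "a' h" "b y" "c y"]
        sum.distrib[symmetric]) (simp add: algebra_simps)
  ultimately show ?thesis by simp
qed

lemma smooth_form:
  fixes T :: "'d::euclidean_space set"
  assumes T: "open T" "a ` T \<subseteq> S" "smooth_on UNIV T a" "smooth_on UNIV T b" "smooth_on UNIV T c"
  shows "smooth_on UNIV T (\<lambda>z. w (a z) (b z) (c z))"
proof (rule smooth_on_transform)
  show "smooth_on UNIV T (\<lambda>z. \<Sum>i\<in>Basis. \<Sum>j\<in>Basis. (b z \<bullet> i) * (c z \<bullet> j) * w (a z) i j)"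
    by (intro smooth_on_sum smooth_on_bilinear[OF bounded_bilinear_mult]
        smooth_on_linear[OF bounded_linear_inner_left] T smooth_on_compose[OF _ _ _ T(2) _ T(3) smooth])
      (use T(1) in auto)
qed (use expand T(2) in auto)

definition pullback :: "('d::euclidean_space \<Rightarrow> 'e) \<Rightarrow> 'd \<Rightarrow> 'd \<Rightarrow> 'd \<Rightarrow> real" where
  "pullback \<rho> q u v = w (\<rho> q) (frechet_derivative \<rho> (at q) u) (frechet_derivative \<rho> (at q) v)"

text \<open>In the cyclic sum the second derivatives of \<rho> occur in pairs that cancel, because
  they are symmetric and w is antisymmetric. What remains is closedness of w on the image
  vectors.\<close>

lemma closed_form_on_pullback:
  fixes Q :: "'d::euclidean_space set"
  assumes Q: "open Q" "smooth_on UNIV Q \<rho>" "\<rho> ` Q \<subseteq> S"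
  shows "closed_form_on Q (pullback \<rho>)"
proof
  let ?D = "\<lambda>q u. frechet_derivative \<rho> (at q) u"
  show "open Q" by fact
  show "bilinear (pullback \<rho> q)" if q: "q \<in> Q" for q
  proof -
    have b: "bilinear (w (\<rho> q))" using bilin Q(3) q by blast
    note l = frechet_linear[OF Q(2,1) q]
    show ?thesis unfolding pullback_def bilinear_def
      by (intro conjI allI linearI)
        (simp_all add: linear_add[OF l] linear_scale[OF l] bilinear_ladd[OF b] bilinear_radd[OF b]
          bilinear_lmul[OF b] bilinear_rmul[OF b])
  qed
  show "pullback \<rho> q u v = - pullback \<rho> q v u" if "q \<in> Q" for q u v
    unfolding pullback_def using anti Q(3) that by blast
  show "smooth_on UNIV Q (\<lambda>q. pullback \<rho> q u v)" for u v
    unfolding pullback_def by (intro smooth_form Q smooth_frechet_at)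
  show "dform (pullback \<rho>) q u v t + dform (pullback \<rho>) q v t u + dform (pullback \<rho>) q t u v = 0"
    if q: "q \<in> Q" for q u v t
  proof -
    let ?D2 = "\<lambda>u h. frechet_derivative (\<lambda>q. ?D q u) (at q) h"
    have d: "dform (pullback \<rho>) q h u v =
        dform w (\<rho> q) (?D q h) (?D q u) (?D q v) + w (\<rho> q) (?D2 u h) (?D q v) + w (\<rho> q) (?D q u) (?D2 v h)"
      for h u v
      unfolding dform_def[of "pullback \<rho>"] pullback_def
      by (intro frechet_derivative_at_eq has_derivative_form[OF Q(1) q]
          smooth_has_derivative_at[OF _ Q(1) q] Q(2) smooth_frechet_at[OF Q(2,1)])
        (use Q(3) in blast)
    have \<rho>q: "\<rho> q \<in> S" using Q(3) q by blast
    have s: "?D2 u h = ?D2 h u" for u h using symmetric_second_derivative[OF Q(2,1) q] .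
    show ?thesis
      using closed[OF \<rho>q, of "?D q u" "?D q v" "?D q t"] s[of u v] s[of u t] s[of v t]
        anti[OF \<rho>q, of "?D q t" "?D2 u v"] anti[OF \<rho>q, of "?D q u" "?D2 v t"] anti[OF \<rho>q, of "?D q v" "?D2 u t"]
      unfolding d by simp
  qed
qed

text \<open>Closedness on two image vectors and r relates the two derivatives in question to the
  r-derivative of w, which vanishes by assumption. The field r is constant and contributes no
  derivative; second derivatives of \<psi> are symmetric.\<close>

lemma closed_contraction:
  fixes V :: "'d::euclidean_space set"
  assumes V: "open V" "smooth_on UNIV V \<psi>" "\<psi> ` V \<subseteq> S"
    and r: "\<And>y u v. y \<in> V \<Longrightarrow>
      dform w (\<psi> y) r (frechet_derivative \<psi> (at y) u) (frechet_derivative \<psi> (at y) v) = 0"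
  shows "smooth_on UNIV V (\<lambda>y. w (\<psi> y) (frechet_derivative \<psi> (at y) u) r)"
    and "y \<in> V \<Longrightarrow> frechet_derivative (\<lambda>y. w (\<psi> y) (frechet_derivative \<psi> (at y) u) r) (at y) v =
                   frechet_derivative (\<lambda>y. w (\<psi> y) (frechet_derivative \<psi> (at y) v) r) (at y) u"
proof -
  let ?D = "\<lambda>y u. frechet_derivative \<psi> (at y) u"
  show "smooth_on UNIV V (\<lambda>y. w (\<psi> y) (frechet_derivative \<psi> (at y) u) r)"
    by (intro smooth_form V smooth_frechet_at smooth_on_const)
  assume y: "y \<in> V"
  let ?D2 = "\<lambda>u h. frechet_derivative (\<lambda>q. ?D q u) (at y) h"
  have \<psi>y: "\<psi> y \<in> S" using V(3) y by blast
  have w0: "w (\<psi> y) u 0 = 0" for u using bilinear_rzero[OF bilin[OF \<psi>y]] .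
  have d: "frechet_derivative (\<lambda>y. w (\<psi> y) (?D y u) r) (at y) h =
      dform w (\<psi> y) (?D y h) (?D y u) r + w (\<psi> y) (?D2 u h) r + w (\<psi> y) (?D y u) 0" for u h
    by (intro frechet_derivative_at_eq has_derivative_form[OF V(1) y] has_derivative_const
        smooth_has_derivative_at[OF _ V(1) y] V(2) smooth_frechet_at[OF V(2,1)])
      (use V(3) in blast)
  show "frechet_derivative (\<lambda>y. w (\<psi> y) (frechet_derivative \<psi> (at y) u) r) (at y) v =
                   frechet_derivative (\<lambda>y. w (\<psi> y) (frechet_derivative \<psi> (at y) v) r) (at y) u"
    using closed[OF \<psi>y, of "?D y v" "?D y u" r] r[OF y, of v u] dform_anti[OF \<psi>y, of "?D y u" r "?D y v"]
      symmetric_second_derivative[OF V(2,1) y, of u v]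
    unfolding d w0 by simp
qed

end

text \<open>The derivative is two-sided, so difference quotients from the right determine it. F 0 =
  0 is not assumed: it follows by continuity.\<close>

lemma one_sided_zero_derivative:
  fixes F :: "real \<Rightarrow> real"
  assumes "(F has_real_derivative D) (at 0)" "\<forall>\<^sub>F t in at_right 0. F t = 0"
  shows "D = 0"
proof -
  have "isCont F 0" using assms(1) DERIV_isCont by blast
  then have "(F \<longlongrightarrow> F 0) (at_right 0)" unfolding isCont_def by (rule filterlim_mono) (auto simp: at_le)
  moreover have "(F \<longlongrightarrow> 0) (at_right 0)" using assms(2) by (rule tendsto_eventually)
  ultimately have F0: "F 0 = 0" using tendsto_unique[OF trivial_limit_at_right_real] by blast
  have "((\<lambda>t. (F (0 + t) - F 0) / t) \<longlongrightarrow> D) (at_right 0)"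
    using assms(1) unfolding DERIV_def by (rule filterlim_mono) (auto simp: at_le)
  moreover have "((\<lambda>t. (F (0 + t) - F 0) / t) \<longlongrightarrow> 0) (at_right 0)"
    by (rule tendsto_eventually) (use assms(2) F0 in \<open>auto elim: eventually_mono\<close>)
  ultimately show "D = 0" using tendsto_unique[OF trivial_limit_at_right_real] by blast
qed

text \<open>In coordinates \<open>q = \<kappa> x\<close> in which \<open>g\<close> is affine, \<open>\<omega>\<close> vanishes on pairs of vectors tangent to the
  fibres over the half \<open>P\<close>, so its one-sided derivative in the constant direction \<open>r\<close> over \<open>e\<close> vanishes
  on such pairs, and closedness of \<open>\<omega>\<close> makes the contraction with \<open>r\<close> closed along the fibre.\<close>

lemma (in closed_form_on) closed_along_fibre:
  fixes g :: "'e \<Rightarrow> 'f::euclidean_space" and \<phi> :: "'d::euclidean_space \<Rightarrow> 'e"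
  assumes g: "smooth_on UNIV S g"
    and iso: "\<And>x u v. x \<in> S \<Longrightarrow> x \<in> P \<Longrightarrow> frechet_derivative g (at x) u = 0 \<Longrightarrow>
        frechet_derivative g (at x) v = 0 \<Longrightarrow> w x u v = 0"
    and \<phi>: "smooth_on UNIV V \<phi>" "open V" "\<phi> ` V \<subseteq> S" "\<And>y. y \<in> V \<Longrightarrow> g (\<phi> y) = b"
    and y0: "y0 \<in> V" "surj (frechet_derivative g (at (\<phi> y0)))"
    and enter: "\<And>y c v. y \<in> V \<Longrightarrow> (c has_vector_derivative v) (at 0) \<Longrightarrow> c 0 = \<phi> y \<Longrightarrow>
        frechet_derivative g (at (\<phi> y)) v = e \<Longrightarrow> \<forall>\<^sub>F t in at_right 0. c t \<in> P"
  obtains V' W where "open V'" "y0 \<in> V'" "V' \<subseteq> V"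
    "\<And>y. y \<in> V' \<Longrightarrow> frechet_derivative g (at (\<phi> y)) (W y) = e"
    "\<And>u. smooth_on UNIV V' (\<lambda>y. w (\<phi> y) (frechet_derivative \<phi> (at y) u) (W y))"
    "\<And>y u v. y \<in> V' \<Longrightarrow>
       frechet_derivative (\<lambda>y. w (\<phi> y) (frechet_derivative \<phi> (at y) u) (W y)) (at y) v =
       frechet_derivative (\<lambda>y. w (\<phi> y) (frechet_derivative \<phi> (at y) v) (W y)) (at y) u"
proof -
  have x0: "\<phi> y0 \<in> S" using y0(1) \<phi>(3) by blast
  define A where "A = frechet_derivative g (at (\<phi> y0))"
  have linA: "linear A" unfolding A_def using frechet_linear[OF g open_S x0] .
  obtain R where R: "linear R" "A \<circ> R = id"
    using linear_surjective_right_inverse[OF linA] y0(2) unfolding A_def by blast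
  have AR: "A (R z) = z" for z using R(2) by (metis comp_apply id_apply)
  have blA: "bounded_linear A" and blR: "bounded_linear R" using linA R(1) linear_linear by blast+
  \<comment> \<open>R splits the space into ker A and the range of R. \<kappa> keeps the component
    in ker A and puts R (g x - b) in place of R (A x), so that A \<kappa> = g - b while the
    derivative of \<kappa> at the base point is the identity.\<close>
  define \<kappa> where "\<kappa> x = R (g x - b) + (x - R (A x))" for x
  have A\<kappa>: "A (\<kappa> x) = g x - b" for x
    unfolding \<kappa>_def by (simp add: linear_add[OF linA] linear_diff[OF linA] AR)
  have sm\<kappa>: "smooth_on UNIV S \<kappa>" unfolding \<kappa>_def
    by (intro smooth_on_add smooth_on_diff smooth_on_linear[OF blR] smooth_on_linear[OF blA] g
        smooth_on_const smooth_on_ident)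
  have "(\<kappa> has_derivative (\<lambda>u. R (A u - 0) + (u - R (A u)))) (at (\<phi> y0))" unfolding \<kappa>_def
    by (intro has_derivative_add has_derivative_diff has_derivative_ident has_derivative_const
        bounded_linear.has_derivative[OF blR] bounded_linear.has_derivative[OF blA])
      (unfold A_def, rule smooth_has_derivative_at[OF g open_S x0])
  then have d\<kappa>: "frechet_derivative \<kappa> (at (\<phi> y0)) u = u" for u
    by (simp add: frechet_derivative_at_eq)
  obtain U Q \<rho> where U: "open U" "\<phi> y0 \<in> U" "U \<subseteq> S" "open Q" "homeomorphism U Q \<kappa> \<rho>"
    "smooth_on UNIV Q \<rho>"
    using smooth_inverse_function_UNIV[OF sm\<kappa> open_S x0] d\<kappa> by metis
  have \<rho>Q: "\<rho> q \<in> U" "\<rho> q \<in> S" if "q \<in> Q" for q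
    using homeomorphism_image2[OF U(5)] U(3) that by blast+
  have g\<rho>: "g (\<rho> q) = b + A q" if "q \<in> Q" for q
    using A\<kappa>[of "\<rho> q"] homeomorphism_apply2[OF U(5) that] by simp
  have dg\<rho>: "frechet_derivative g (at (\<rho> q)) (frechet_derivative \<rho> (at q) u) = A u" if q: "q \<in> Q" for q u
  proof -
    have "((\<lambda>q. b + A q) has_derivative A) (at q)"
      using bounded_linear_imp_has_derivative[OF blA] by (auto intro!: derivative_eq_intros)
    then have "((\<lambda>q. g (\<rho> q)) has_derivative A) (at q)"
      by (rule has_derivative_transform_within_open[OF _ U(4) q]) (simp add: g\<rho>)
    moreover have "((\<lambda>q. g (\<rho> q)) has_derivative
       (\<lambda>u. frechet_derivative g (at (\<rho> q)) (frechet_derivative \<rho> (at q) u))) (at q)"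
      by (rule has_derivative_compose[OF smooth_has_derivative_at[OF U(6,4) q]
            smooth_has_derivative_at[OF g open_S \<rho>Q(2)[OF q]]])
    ultimately show ?thesis using has_derivative_unique by metis
  qed
  interpret pb: closed_form_on Q "pullback \<rho>"
    by (rule closed_form_on_pullback[OF U(4,6)]) (simp add: image_subset_iff \<rho>Q)
  define V' where "V' = V \<inter> \<phi> -` U"
  have V': "open V'" "y0 \<in> V'" "V' \<subseteq> V"
    using continuous_open_preimage[OF smooth_on_continuous[OF \<phi>(1)] \<phi>(2) U(1)] y0(1) U(2)
    unfolding V'_def by auto
  define \<psi> where "\<psi> y = \<kappa> (\<phi> y)" for y
  have \<psi>Q: "\<psi> ` V' \<subseteq> Q" using homeomorphism_image1[OF U(5)] unfolding \<psi>_def V'_def by blast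
  have sm\<psi>: "smooth_on UNIV V' \<psi>" unfolding \<psi>_def
    by (rule smooth_on_compose[OF _ _ _ _ _ smooth_on_mono[OF \<phi>(1) _ V'(3)] sm\<kappa>])
      (use V' \<phi>(3) in auto)
  have \<rho>\<psi>: "\<rho> (\<psi> y) = \<phi> y" if "y \<in> V'" for y
    using homeomorphism_apply1[OF U(5)] that unfolding \<psi>_def V'_def by blast
  have d\<psi>: "A (frechet_derivative \<psi> (at y) u) = 0" if y: "y \<in> V'" for y u
  proof -
    have "((\<lambda>y. A (\<psi> y)) has_derivative (\<lambda>u. A (frechet_derivative \<psi> (at y) u))) (at y)"
      by (rule bounded_linear.has_derivative[OF blA smooth_has_derivative_at[OF sm\<psi> V'(1) y]])
    moreover have "((\<lambda>y. A (\<psi> y)) has_derivative (\<lambda>_. 0)) (at y)"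
    proof (rule has_derivative_transform_within_open[OF _ V'(1) y])
      show "((\<lambda>_. 0) has_derivative (\<lambda>_. 0)) (at y)" by (rule has_derivative_const)
      fix z assume "z \<in> V'"
      then have "g (\<phi> z) = b" using \<phi>(4) V'(3) by blast
      then show "0 = A (\<psi> z)" using A\<kappa>[of "\<phi> z"] by (simp add: \<psi>_def)
    qed
    ultimately show ?thesis using has_derivative_unique by metis
  qed
  have d\<phi>: "frechet_derivative \<phi> (at y) u = frechet_derivative \<rho> (at (\<psi> y)) (frechet_derivative \<psi> (at y) u)"
    if y: "y \<in> V'" for y u
  proof (rule frechet_derivative_at_eq)
    have "\<psi> y \<in> Q" using \<psi>Q y by blast
    then have "((\<lambda>y. \<rho> (\<psi> y)) has_derivative
       (\<lambda>u. frechet_derivative \<rho> (at (\<psi> y)) (frechet_derivative \<psi> (at y) u))) (at y)"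
      by (intro has_derivative_compose[OF smooth_has_derivative_at[OF sm\<psi> V'(1) y]
            smooth_has_derivative_at[OF U(6,4)]])
    then show "(\<phi> has_derivative
       (\<lambda>u. frechet_derivative \<rho> (at (\<psi> y)) (frechet_derivative \<psi> (at y) u))) (at y)"
      by (rule has_derivative_transform_within_open[OF _ V'(1) y]) (rule \<rho>\<psi>)
  qed
  \<comment> \<open>In the new coordinates g is q \<mapsto> b + A q, and A r = e: moving along r
    changes g at the constant rate e. \<open>W\<close> is this constant field in the original
    coordinates.\<close>
  define r where "r = R e"
  define W where "W y = frechet_derivative \<rho> (at (\<psi> y)) r" for y
  have gW: "frechet_derivative g (at (\<phi> y)) (W y) = e" if y: "y \<in> V'" for y
    using dg\<rho>[of "\<psi> y" r] \<rho>\<psi>[OF y] \<psi>Q y AR unfolding W_def r_def by auto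
  have pb_eq: "pullback \<rho> (\<psi> y) (frechet_derivative \<psi> (at y) u) r =
      w (\<phi> y) (frechet_derivative \<phi> (at y) u) (W y)" if "y \<in> V'" for y u
    unfolding pullback_def W_def using d\<phi>[OF that] \<rho>\<psi>[OF that] by simp
  have r0: "dform (pullback \<rho>) (\<psi> y) r k l = 0" if y: "y \<in> V'" and kl: "A k = 0" "A l = 0" for y k l
  proof (rule one_sided_zero_derivative)
    have q: "\<psi> y \<in> Q" using \<psi>Q y by blast
    show "((\<lambda>t. pullback \<rho> (\<psi> y + t *\<^sub>R r) k l) has_real_derivative dform (pullback \<rho>) (\<psi> y) r k l) (at 0)"
      by (rule has_real_derivative_line) (use pb.has_derivative_dform[OF q] in simp)
    have "((\<lambda>t. \<rho> (\<psi> y + t *\<^sub>R r)) has_vector_derivative W y) (at 0)"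
      using has_vector_derivative_line[of UNIV Q "\<psi> y" r \<rho> "frechet_derivative \<rho> (at (\<psi> y))"]
        smooth_has_derivative_at[OF U(6,4) q] at_within_open[OF q U(4)] U(4) q
      unfolding W_def by simp
    from enter[OF _ this _ gW[OF y]] have P: "\<forall>\<^sub>F t in at_right 0. \<rho> (\<psi> y + t *\<^sub>R r) \<in> P"
      using y V'(3) \<rho>\<psi>[OF y] by auto
    have "((\<lambda>t. \<psi> y + t *\<^sub>R r) \<longlongrightarrow> \<psi> y + 0 *\<^sub>R r) (at_right 0)" by (intro tendsto_intros)
    then have "\<forall>\<^sub>F t in at_right 0. \<psi> y + t *\<^sub>R r \<in> Q"
      using U(4) q by (auto dest: topological_tendstoD)
    with P show "\<forall>\<^sub>F t in at_right 0. pullback \<rho> (\<psi> y + t *\<^sub>R r) k l = 0"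
    proof eventually_elim
      case (elim t)
      then show ?case unfolding pullback_def
        by (intro iso) (simp_all add: dg\<rho> \<rho>Q kl)
    qed
  qed
  have r0': "dform (pullback \<rho>) (\<psi> y) r (frechet_derivative \<psi> (at y) u) (frechet_derivative \<psi> (at y) v) = 0"
    if "y \<in> V'" for y u v using r0[OF that] d\<psi>[OF that] by blast
  have cc1: "smooth_on UNIV V' (\<lambda>y. pullback \<rho> (\<psi> y) (frechet_derivative \<psi> (at y) u) r)" for u
    by (rule pb.closed_contraction(1)[OF V'(1) sm\<psi> \<psi>Q r0'])
  have cc2: "frechet_derivative (\<lambda>y. pullback \<rho> (\<psi> y) (frechet_derivative \<psi> (at y) u) r) (at y) v =
      frechet_derivative (\<lambda>y. pullback \<rho> (\<psi> y) (frechet_derivative \<psi> (at y) v) r) (at y) u"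
    if "y \<in> V'" for y u v
    by (rule pb.closed_contraction(2)[OF V'(1) sm\<psi> \<psi>Q r0' that])
  have fd: "frechet_derivative (\<lambda>y. w (\<phi> y) (frechet_derivative \<phi> (at y) u) (W y)) (at y) v =
      frechet_derivative (\<lambda>y. pullback \<rho> (\<psi> y) (frechet_derivative \<psi> (at y) u) r) (at y) v"
    if y: "y \<in> V'" for y u v
  proof (rule frechet_derivative_at_eq)
    show "((\<lambda>y. w (\<phi> y) (frechet_derivative \<phi> (at y) u) (W y)) has_derivative
      frechet_derivative (\<lambda>y. pullback \<rho> (\<psi> y) (frechet_derivative \<psi> (at y) u) r) (at y)) (at y)"
      by (rule has_derivative_transform_within_open[OF smooth_has_derivative_at[OF cc1 V'(1) y] V'(1) y])
        (rule pb_eq)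
  qed
  show ?thesis
  proof (rule that[OF V' gW])
    show "smooth_on UNIV V' (\<lambda>y. w (\<phi> y) (frechet_derivative \<phi> (at y) u) (W y))" for u
      by (rule smooth_on_transform[OF cc1]) (rule pb_eq)
    show "frechet_derivative (\<lambda>y. w (\<phi> y) (frechet_derivative \<phi> (at y) u) (W y)) (at y) v =
       frechet_derivative (\<lambda>y. w (\<phi> y) (frechet_derivative \<phi> (at y) v) (W y)) (at y) u"
      if "y \<in> V'" for y u v
      unfolding fd[OF that] by (rule cc2[OF that])
  qed
qed


section \<open>Functionals, maps and forms on a subspace, extended by orthogonal projection\<close>

lemma linear_on_subspace_orth_proj:
  assumes "subspace E" "linear_on_subspace E l"
  shows "linear (\<lambda>x. l (orth_proj E x))"
proof (rule linearI)
  have l: "l (r *\<^sub>R u + s *\<^sub>R v) = r * l u + s * l v" if "u \<in> E" "v \<in> E" for u v r s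
    using assms(2) that unfolding linear_on_subspace_def by blast
  fix x y and c :: real
  show "l (orth_proj E (x + y)) = l (orth_proj E x) + l (orth_proj E y)"
    using l[of "orth_proj E x" "orth_proj E y" 1 1] orth_proj_in[OF assms(1)]
    by (simp add: linear_add[OF linear_orth_proj])
  show "l (orth_proj E (c *\<^sub>R x)) = c *\<^sub>R l (orth_proj E x)"
    using l[of "orth_proj E x" 0 c 0] orth_proj_in[OF assms(1)] subspace_0[OF assms(1)]
    by (simp add: linear_scale[OF linear_orth_proj])
qed

lemma openin_orth_proj_vimage:
  assumes "subspace E" "openin (top_of_set E) S"
  shows "open (orth_proj E -` S)"
proof -
  have "openin (top_of_set UNIV) (UNIV \<inter> orth_proj E -` S)"
    by (rule continuous_openin_preimage[OF linear_continuous_on[OF bounded_linear_orth_proj] _ assms(2)])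
      (simp add: orth_proj_in[OF assms(1)])
  then show ?thesis by simp
qed

lemma has_derivative_orth_proj:
  assumes "subspace E" "openin (top_of_set E) S" "(f has_derivative D) (at (orth_proj E x) within S)"
    "orth_proj E x \<in> S"
  shows "((\<lambda>x. f (orth_proj E x)) has_derivative (\<lambda>u. D (orth_proj E u))) (at x)"
proof -
  let ?T = "orth_proj E -` S"
  have dP: "(orth_proj E has_derivative orth_proj E) (at x within ?T)"
    using bounded_linear_imp_has_derivative[OF bounded_linear_orth_proj] .
  have "(f has_derivative D) (at (orth_proj E x) within orth_proj E ` ?T)"
    by (rule has_derivative_subset[OF assms(3)]) auto
  from has_derivative_in_compose[OF dP this]
  show ?thesis using at_within_open[OF _ openin_orth_proj_vimage[OF assms(1,2)], of x] assms(4) by simp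
qed

lemma smooth_on_orth_proj:
  assumes "subspace E" "openin (top_of_set E) S" "smooth_on E S f"
  shows "smooth_on UNIV (orth_proj E -` S) (\<lambda>x. f (orth_proj E x))"
  by (rule smooth_on_compose[OF _ _ assms(1) _ openin_imp_subset[OF assms(2)] _ assms(3)])
    (simp_all add: openin_orth_proj_vimage[OF assms(1,2)] image_subset_iff
      smooth_on_linear[OF bounded_linear_orth_proj smooth_on_ident])

lemma frechet_derivative_orth_proj:
  assumes "subspace E" "openin (top_of_set E) S" "smooth_on E S f" "orth_proj E x \<in> S"
  shows "frechet_derivative (\<lambda>x. f (orth_proj E x)) (at x) u =
    frechet_derivative f (at (orth_proj E x) within S) (orth_proj E u)"
  by (rule frechet_derivative_at_eq[OF has_derivative_orth_proj[OF assms(1,2)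
      smooth_on_has_derivative[OF assms(3,4)] assms(4)]])

locale closed_form_on_subspace =
  fixes E S :: "'e::euclidean_space set" and w :: "'e \<Rightarrow> 'e \<Rightarrow> 'e \<Rightarrow> real"
  assumes E: "subspace E" "openin (top_of_set E) S"
    and lin: "\<And>x v. x \<in> S \<Longrightarrow> v \<in> E \<Longrightarrow> linear_on_subspace E (\<lambda>u. w x u v)"
    and anti: "\<And>x u v. x \<in> S \<Longrightarrow> u \<in> E \<Longrightarrow> v \<in> E \<Longrightarrow> w x u v = - w x v u"
    and smooth: "\<And>u v. u \<in> E \<Longrightarrow> v \<in> E \<Longrightarrow> smooth_on E S (\<lambda>x. w x u v)"
    and closed: "\<And>x u v t. x \<in> S \<Longrightarrow> u \<in> E \<Longrightarrow> v \<in> E \<Longrightarrow> t \<in> E \<Longrightarrow>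
        frechet_derivative (\<lambda>x. w x v t) (at x within S) u
      + frechet_derivative (\<lambda>x. w x t u) (at x within S) v
      + frechet_derivative (\<lambda>x. w x u v) (at x within S) t = 0"
begin

text \<open>The extended form is the pull-back under the projection: it is constant across E and
  ignores vectors orthogonal to E. Its coefficient derivatives are those within S in projected
  directions, so closedness is inherited.\<close>

lemma extension:
  "closed_form_on (orth_proj E -` S) (\<lambda>x u v. w (orth_proj E x) (orth_proj E u) (orth_proj E v))"
proof
  let ?p = "orth_proj E"
  note pE = orth_proj_in[OF E(1)]
  show "open (?p -` S)" by (rule openin_orth_proj_vimage[OF E])
  fix x u v assume x: "x \<in> ?p -` S"
  show "w (?p x) (?p u) (?p v) = - w (?p x) (?p v) (?p u)"
    using anti[OF _ pE pE] x by blast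
  have 1: "linear (\<lambda>u. w (?p x) (?p u) (?p v))" for v
    by (rule linear_on_subspace_orth_proj[OF E(1) lin]) (use x pE in auto)
  have 2: "linear (\<lambda>v. w (?p x) (?p u) (?p v))" for u
  proof -
    have "(\<lambda>v. w (?p x) (?p u) (?p v)) = (\<lambda>v. - w (?p x) (?p v) (?p u))"
      using anti[OF _ pE pE] x by blast
    then show ?thesis using linear_compose_neg[OF 1] by simp
  qed
  show "bilinear (\<lambda>u v. w (?p x) (?p u) (?p v))" unfolding bilinear_def using 1 2 by blast
next
  fix u v
  show "smooth_on UNIV (orth_proj E -` S) (\<lambda>x. w (orth_proj E x) (orth_proj E u) (orth_proj E v))"
    by (rule smooth_on_orth_proj[OF E smooth]) (simp_all add: orth_proj_in[OF E(1)])
next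
  fix x u v t assume x: "x \<in> orth_proj E -` S"
  have d: "dform (\<lambda>x u v. w (orth_proj E x) (orth_proj E u) (orth_proj E v)) x h u v =
      frechet_derivative (\<lambda>x. w x (orth_proj E u) (orth_proj E v)) (at (orth_proj E x) within S) (orth_proj E h)"
    for h u v
    unfolding dform_def using x
    by (intro frechet_derivative_orth_proj[OF E smooth]) (simp_all add: orth_proj_in[OF E(1)])
  show "dform (\<lambda>x u v. w (orth_proj E x) (orth_proj E u) (orth_proj E v)) x u v t +
     dform (\<lambda>x u v. w (orth_proj E x) (orth_proj E u) (orth_proj E v)) x v t u +
     dform (\<lambda>x u v. w (orth_proj E x) (orth_proj E u) (orth_proj E v)) x t u v = 0"
    unfolding d using closed[of "orth_proj E x" "orth_proj E u" "orth_proj E v" "orth_proj E t"] x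
      orth_proj_in[OF E(1)] by simp
qed

text \<open>All data are extended by the projections onto E and E0, the version for open sets is
  applied, and the result is restricted to E0. A curve tested by the extended entering condition is
  first projected to E, where \<open>enter\<close> applies, since P is replaced by its preimage
  under the projection.\<close>

lemma closed_along_fibre:
  fixes g :: "'e \<Rightarrow> 'f::euclidean_space" and \<phi> :: "'d::euclidean_space \<Rightarrow> 'e"
  assumes g: "smooth_on E S g"
    and iso: "\<And>x u v. x \<in> S \<Longrightarrow> x \<in> P \<Longrightarrow> u \<in> E \<Longrightarrow> v \<in> E \<Longrightarrow>
        frechet_derivative g (at x within S) u = 0 \<Longrightarrow>
        frechet_derivative g (at x within S) v = 0 \<Longrightarrow> w x u v = 0"
    and E0: "subspace E0" "openin (top_of_set E0) V"
    and \<phi>: "smooth_on E0 V \<phi>" "\<phi> ` V \<subseteq> S" "\<And>y. y \<in> V \<Longrightarrow> g (\<phi> y) = b"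
    and y0: "y0 \<in> V" "frechet_derivative g (at (\<phi> y0) within S) ` E = UNIV"
    and enter: "\<And>y c v. y \<in> V \<Longrightarrow> (c has_vector_derivative v) (at 0) \<Longrightarrow> c 0 = \<phi> y \<Longrightarrow> range c \<subseteq> E \<Longrightarrow>
        v \<in> E \<Longrightarrow> frechet_derivative g (at (\<phi> y) within S) v = e \<Longrightarrow> \<forall>\<^sub>F t in at_right 0. c t \<in> P"
  obtains V' W where "openin (top_of_set E0) V'" "y0 \<in> V'" "V' \<subseteq> V"
    "\<And>y. y \<in> V' \<Longrightarrow> W y \<in> E"
    "\<And>y. y \<in> V' \<Longrightarrow> frechet_derivative g (at (\<phi> y) within S) (W y) = e"
    "\<And>u. u \<in> E0 \<Longrightarrow> smooth_on E0 V' (\<lambda>y. w (\<phi> y) (frechet_derivative \<phi> (at y within V) u) (W y))"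
    "\<And>y u v. y \<in> V' \<Longrightarrow> u \<in> E0 \<Longrightarrow> v \<in> E0 \<Longrightarrow>
       frechet_derivative (\<lambda>y. w (\<phi> y) (frechet_derivative \<phi> (at y within V) u) (W y)) (at y within V') v =
       frechet_derivative (\<lambda>y. w (\<phi> y) (frechet_derivative \<phi> (at y within V) v) (W y)) (at y within V') u"
proof -
  let ?p = "orth_proj E" and ?q = "orth_proj E0"
  let ?S = "?p -` S" and ?V = "?q -` V"
  let ?g = "\<lambda>x. g (?p x)" and ?\<phi> = "\<lambda>y. \<phi> (?q y)"
  let ?w = "\<lambda>x u v. w (?p x) (?p u) (?p v)"
  note pE = orth_proj_in[OF E(1)] and qE = orth_proj_in[OF E0(1)]
  have SE: "S \<subseteq> E" and VE: "V \<subseteq> E0" using openin_imp_subset E(2) E0(2) by blast+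
  have pS: "?p x = x" if "x \<in> E" for x using orth_proj_eq[OF E(1) that] .
  have qV: "?q y = y" if "y \<in> E0" for y using orth_proj_eq[OF E0(1) that] .
  have \<phi>E: "\<phi> y \<in> S" "?p (\<phi> y) = \<phi> y" if "y \<in> V" for y using \<phi>(2) SE that pS by blast+
  interpret ext: closed_form_on ?S ?w by (rule extension)
  have dg: "frechet_derivative ?g (at x) u = frechet_derivative g (at (?p x) within S) (?p u)"
    if "x \<in> ?S" for x u
    by (rule frechet_derivative_orth_proj[OF E g]) (use that in simp)
  have \<phi>S: "?\<phi> y \<in> ?S" "?p (?\<phi> y) = \<phi> (?q y)" if "y \<in> ?V" for y
    using that \<phi>E by simp_all
  have dphi: "frechet_derivative ?\<phi> (at y) u = frechet_derivative \<phi> (at (?q y) within V) (?q u)"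
    if "y \<in> ?V" for y u
    by (rule frechet_derivative_orth_proj[OF E0 \<phi>(1)]) (use that in simp)
  obtain V' W where V': "open V'" "y0 \<in> V'" "V' \<subseteq> ?V"
    and W: "\<And>y. y \<in> V' \<Longrightarrow> frechet_derivative ?g (at (?\<phi> y)) (W y) = e"
    and sm: "\<And>u. smooth_on UNIV V' (\<lambda>y. ?w (?\<phi> y) (frechet_derivative ?\<phi> (at y) u) (W y))"
    and sym: "\<And>y u v. y \<in> V' \<Longrightarrow>
       frechet_derivative (\<lambda>y. ?w (?\<phi> y) (frechet_derivative ?\<phi> (at y) u) (W y)) (at y) v =
       frechet_derivative (\<lambda>y. ?w (?\<phi> y) (frechet_derivative ?\<phi> (at y) v) (W y)) (at y) u"
  proof (rule ext.closed_along_fibre[where g = ?g and \<phi> = ?\<phi> and P = "?p -` P" and b = b and e = e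
        and V = ?V and ?y0.0 = y0])
    show "smooth_on UNIV ?S ?g" by (rule smooth_on_orth_proj[OF E g])
    show "?w x u v = 0" if "x \<in> ?S" "x \<in> ?p -` P"
      "frechet_derivative ?g (at x) u = 0" "frechet_derivative ?g (at x) v = 0" for x u v
      by (rule iso) (use that pE dg[OF that(1)] in simp_all)
    show "smooth_on UNIV ?V ?\<phi>" by (rule smooth_on_orth_proj[OF E0 \<phi>(1)])
    show "open ?V" by (rule openin_orth_proj_vimage[OF E0])
    show "?\<phi> ` ?V \<subseteq> ?S" using \<phi>S(1) by blast
    show "?g (?\<phi> y) = b" if "y \<in> ?V" for y using \<phi>S(2)[OF that] \<phi>(3) that by simp
    have y0V: "?q y0 = y0" using y0(1) VE qV by blast
    then show y0': "y0 \<in> ?V" using y0(1) by simp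
    show "surj (frechet_derivative ?g (at (?\<phi> y0)))"
    proof -
      have "\<exists>u. z = frechet_derivative ?g (at (?\<phi> y0)) u" for z
      proof -
        have "z \<in> frechet_derivative g (at (\<phi> y0) within S) ` E" using y0(2) by simp
        then obtain u where "u \<in> E" "z = frechet_derivative g (at (\<phi> y0) within S) u" by blast
        then show ?thesis using dg[OF \<phi>S(1)[OF y0']] \<phi>S(2)[OF y0'] y0V pS by metis
      qed
      then show ?thesis unfolding surj_def by blast
    qed
    show "\<forall>\<^sub>F t in at_right 0. c t \<in> ?p -` P"
      if "y \<in> ?V" "(c has_vector_derivative v) (at 0)" "c 0 = ?\<phi> y"
        "frechet_derivative ?g (at (?\<phi> y)) v = e" for y c v
    proof -
      have d: "((\<lambda>t. ?p (c t)) has_vector_derivative ?p v) (at 0)"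
        by (rule bounded_linear.has_vector_derivative[OF bounded_linear_orth_proj that(2)])
      have "\<forall>\<^sub>F t in at_right 0. ?p (c t) \<in> P"
        by (rule enter[OF _ d]) (use that dg[OF \<phi>S(1)[OF that(1)]] \<phi>S(2)[OF that(1)] pE in auto)
      then show ?thesis by simp
    qed
  qed blast
  define V1 where "V1 = E0 \<inter> V'"
  have V1: "openin (top_of_set E0) V1" "y0 \<in> V1" "V1 \<subseteq> V" "V1 \<subseteq> V'"
    using V' y0(1) VE qV unfolding V1_def by (auto simp: openin_open)
  have V1E: "V1 \<subseteq> E0" using V1(3) VE by blast
  have eq: "?w (?\<phi> y) (frechet_derivative ?\<phi> (at y) u) (W y) =
      w (\<phi> y) (frechet_derivative \<phi> (at y within V) u) (?p (W y))" if "y \<in> V1" "u \<in> E0" for y u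
  proof -
    have y: "y \<in> V" "y \<in> ?V" "?q y = y" using that(1) V1 V'(3) V1E qV by blast+
    have "frechet_derivative \<phi> (at y within V) u \<in> E"
      using has_derivative_in_subspace[OF E0 y(1) that(2) smooth_on_has_derivative[OF \<phi>(1) y(1)] E(1)] \<phi>(2) SE
      by blast
    then show ?thesis using dphi[OF y(2)] y(3) qV[OF that(2)] \<phi>E(2)[OF y(1)] pS by simp
  qed
  have fd: "frechet_derivative (\<lambda>y. w (\<phi> y) (frechet_derivative \<phi> (at y within V) u) (?p (W y))) (at y within V1) v
      = frechet_derivative (\<lambda>y. ?w (?\<phi> y) (frechet_derivative ?\<phi> (at y) u) (W y)) (at y) v"
    if y: "y \<in> V1" and uv: "u \<in> E0" "v \<in> E0" for y u v
  proof (rule frechet_derivative_on[OF E0(1) V1(1) y uv(2)])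
    have "((\<lambda>y. ?w (?\<phi> y) (frechet_derivative ?\<phi> (at y) u) (W y)) has_derivative
       frechet_derivative (\<lambda>y. ?w (?\<phi> y) (frechet_derivative ?\<phi> (at y) u) (W y)) (at y)) (at y within V1)"
      using smooth_has_derivative_at[OF sm V'(1)] y V1(4) has_derivative_at_withinI by blast
    then show "((\<lambda>y. w (\<phi> y) (frechet_derivative \<phi> (at y within V) u) (?p (W y))) has_derivative
       frechet_derivative (\<lambda>y. ?w (?\<phi> y) (frechet_derivative ?\<phi> (at y) u) (W y)) (at y)) (at y within V1)"
      by (rule has_derivative_transform[OF y, rotated]) (rule eq[OF _ uv(1), symmetric])
  qed
  show ?thesis
  proof (rule that[OF V1(1-3)])
    fix y assume y: "y \<in> V1"
    show "?p (W y) \<in> E" by (rule pE)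
    have "y \<in> V" "y \<in> ?V" "?q y = y" using y V1 V'(3) V1E qV by blast+
    then show "frechet_derivative g (at (\<phi> y) within S) (?p (W y)) = e"
      using W[of y] V1(4) y dg[OF \<phi>S(1), of y "W y"] \<phi>S(2)[of y] by auto
  next
    fix u assume u: "u \<in> E0"
    have "smooth_on E0 V1 (\<lambda>y. ?w (?\<phi> y) (frechet_derivative ?\<phi> (at y) u) (W y))"
      by (rule smooth_on_mono[OF sm _ V1(4)]) simp
    then show "smooth_on E0 V1 (\<lambda>y. w (\<phi> y) (frechet_derivative \<phi> (at y within V) u) (?p (W y)))"
      by (rule smooth_on_transform) (rule eq[OF _ u])
  next
    fix y u v assume yuv: "y \<in> V1" "u \<in> E0" "v \<in> E0"
    then have "y \<in> V'" using V1(4) by blast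
    then show "frechet_derivative (\<lambda>y. w (\<phi> y) (frechet_derivative \<phi> (at y within V) u) (?p (W y))) (at y within V1) v =
       frechet_derivative (\<lambda>y. w (\<phi> y) (frechet_derivative \<phi> (at y within V) v) (?p (W y))) (at y within V1) u"
      unfolding fd[OF yuv] fd[OF yuv(1,3,2)] by (rule sym)
  qed
qed

end


section \<open>Charts, differentials and submanifolds\<close>

lemma smooth_chartD:
  assumes "smooth_chart M c"
  shows "openin (top_of_set (pts M)) (fst c)" "openin (top_of_set (model M)) (snd c ` fst c)"
    "homeomorphism (fst c) (snd c ` fst c) (snd c) (coord_inv c)"
  using assms unfolding smooth_chart_def by simp_all

lemma coord_inv_snd: "smooth_chart M c \<Longrightarrow> x \<in> fst c \<Longrightarrow> coord_inv c (snd c x) = x"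
  by (rule homeomorphism_apply1[OF smooth_chartD(3)])

lemma smooth_chart_inj: "smooth_chart M c \<Longrightarrow> inj_on (snd c) (fst c)"
  by (rule inj_on_inverseI[of _ "coord_inv c"]) (rule coord_inv_snd)

lemma snd_coord_inv: "smooth_chart M c \<Longrightarrow> y \<in> snd c ` fst c \<Longrightarrow> snd c (coord_inv c y) = y"
  by (rule homeomorphism_apply2[OF smooth_chartD(3)])

lemma coord_inv_in: "smooth_chart M c \<Longrightarrow> y \<in> snd c ` fst c \<Longrightarrow> coord_inv c y \<in> fst c"
  by (auto simp: coord_inv_snd)

lemma chart_image_openin:
  assumes "smooth_chart M c" "openin (top_of_set (pts M)) U" "U \<subseteq> fst c"
  shows "openin (top_of_set (model M)) (snd c ` U)"
proof -
  note c = smooth_chartD[OF assms(1)]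
  have "openin (top_of_set (fst c)) U"
    by (rule openin_subset_trans[OF assms(2,3) openin_imp_subset[OF c(1)]])
  from homeomorphism_imp_open_map[OF c(3) this] show ?thesis
    by (rule openin_trans[OF _ c(2)])
qed

lemma chart_preimage_openin:
  assumes "smooth_chart M c" "openin (top_of_set (model M)) T" "T \<subseteq> snd c ` fst c"
  shows "openin (top_of_set (pts M)) {x \<in> fst c. snd c x \<in> T}"
proof -
  note c = smooth_chartD[OF assms(1)]
  have "openin (top_of_set (snd c ` fst c)) T"
    by (rule openin_subset_trans[OF assms(2,3) openin_imp_subset[OF c(2)]])
  then have "openin (top_of_set (fst c)) (fst c \<inter> snd c -` T)"
    using c(3) by (metis continuous_on_open homeomorphism_def)
  then have "openin (top_of_set (pts M)) (fst c \<inter> snd c -` T)" by (rule openin_trans[OF _ c(1)])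
  moreover have "fst c \<inter> snd c -` T = {x \<in> fst c. snd c x \<in> T}" by blast
  ultimately show ?thesis by simp
qed

lemma manifold_chart:
  assumes "smooth_manifold d M"
  shows "subspace (model M)" "dim (model M) = d" "c \<in> charts M \<Longrightarrow> smooth_chart M c"
    "pts M = (\<Union>c\<in>charts M. fst c)"
  using assms unfolding smooth_manifold_def by simp_all

lemma chart_at:
  assumes "smooth_manifold d M" "x \<in> pts M"
  shows "chart_at M x \<in> charts M" "x \<in> fst (chart_at M x)" "smooth_chart M (chart_at M x)"
proof -
  have "\<exists>c. c \<in> charts M \<and> x \<in> fst c" using assms manifold_chart(4) by blast
  from someI_ex[OF this] show "chart_at M x \<in> charts M" "x \<in> fst (chart_at M x)"
    unfolding chart_at_def by blast+
  then show "smooth_chart M (chart_at M x)" using manifold_chart(3)[OF assms(1)] by blast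
qed

lemma smooth_chart_pts: "smooth_chart M c \<Longrightarrow> x \<in> fst c \<Longrightarrow> x \<in> pts M"
  using openin_imp_subset[OF smooth_chartD(1)] by blast

text \<open>Smoothness of functions and maps is defined through the charts of the atlas. Composition
  with transition maps, near each point, transfers it to every compatible chart, in particular to
  slice charts.\<close>

lemma smooth_on_chart_local:
  fixes M :: "('m::{t2_space,second_countable_topology}, 'e::euclidean_space) mfd"
    and H :: "'m \<Rightarrow> 'b::real_normed_vector"
  assumes M: "smooth_manifold d M" and c: "smooth_chart M c"
    and U: "openin (top_of_set (pts M)) U" "U \<subseteq> fst c"
    and loc: "\<And>x. x \<in> U \<Longrightarrow> \<exists>c1\<in>charts M. \<exists>U1. x \<in> U1 \<and> U1 \<subseteq> U \<and> U1 \<subseteq> fst c1 \<and>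
        openin (top_of_set (pts M)) U1 \<and> smooth_on (model M) (snd c1 ` U1) (H \<circ> coord_inv c1)"
  shows "smooth_on (model M) (snd c ` U) (H \<circ> coord_inv c)"
proof (rule smooth_on_local[OF manifold_chart(1)[OF M] chart_image_openin[OF c U]])
  fix y assume "y \<in> snd c ` U"
  then obtain x where x: "x \<in> U" "y = snd c x" by blast
  obtain c1 U1 where c1: "c1 \<in> charts M" and U1: "x \<in> U1" "U1 \<subseteq> U" "U1 \<subseteq> fst c1"
    "openin (top_of_set (pts M)) U1" "smooth_on (model M) (snd c1 ` U1) (H \<circ> coord_inv c1)"
    using loc[OF x(1)] by blast
  have sc1: "smooth_chart M c1" using manifold_chart(3)[OF M] c1 by blast
  have U1c: "U1 \<subseteq> fst c" using U1(2) U(2) by blast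
  have tr: "smooth_on (model M) (snd c ` (fst c \<inter> fst c1)) (snd c1 \<circ> coord_inv c)"
    using c c1 unfolding smooth_chart_def smooth_transition_def by blast
  have sm: "smooth_on (model M) (snd c ` U1) (\<lambda>y. (H \<circ> coord_inv c1) ((snd c1 \<circ> coord_inv c) y))"
  proof (rule smooth_on_compose[OF manifold_chart(1)[OF M] chart_image_openin[OF c U1(4) U1c]
        manifold_chart(1)[OF M] _ openin_imp_subset[OF chart_image_openin[OF sc1 U1(4,3)]] _ U1(5)])
    show "(snd c1 \<circ> coord_inv c) ` snd c ` U1 \<subseteq> snd c1 ` U1"
      using coord_inv_snd[OF c] U1c by (auto simp: image_subset_iff subset_iff)
    show "smooth_on (model M) (snd c ` U1) (snd c1 \<circ> coord_inv c)"
      by (rule smooth_on_mono[OF tr]) (use U1c U1(3) in blast)+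
  qed
  have "smooth_on (model M) (snd c ` U1) (H \<circ> coord_inv c)"
  proof (rule smooth_on_transform[OF sm])
    fix z assume "z \<in> snd c ` U1"
    then obtain x' where x': "x' \<in> U1" "z = snd c x'" by blast
    then have "coord_inv c z = x'" "coord_inv c1 (snd c1 x') = x'"
      using coord_inv_snd[OF c] coord_inv_snd[OF sc1] U1c U1(3) by blast+
    then show "(H \<circ> coord_inv c1) ((snd c1 \<circ> coord_inv c) z) = (H \<circ> coord_inv c) z" by simp
  qed
  then show "\<exists>T. y \<in> T \<and> openin (top_of_set (model M)) T \<and> T \<subseteq> snd c ` U \<and>
      smooth_on (model M) T (H \<circ> coord_inv c)"
    using x U1(1,2) chart_image_openin[OF c U1(4) U1c] by (intro exI[of _ "snd c ` U1"]) blast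
qed

lemma smooth_fun_chart:
  fixes M :: "('m::{t2_space,second_countable_topology}, 'e::euclidean_space) mfd"
  assumes "smooth_manifold d M" "smooth_fun M h" "smooth_chart M c"
  shows "smooth_on (model M) (snd c ` fst c) (h \<circ> coord_inv c)"
proof (rule smooth_on_chart_local[OF assms(1,3) smooth_chartD(1)[OF assms(3)] order_refl])
  fix x assume x: "x \<in> fst c"
  let ?k = "chart_at M x"
  note k = chart_at[OF assms(1) smooth_chart_pts[OF assms(3) x]]
  have "smooth_on (model M) (snd ?k ` (fst c \<inter> fst ?k)) (h \<circ> coord_inv ?k)"
    by (rule smooth_on_mono[of _ "snd ?k ` fst ?k"]) (use assms(2) k(1) in \<open>auto simp: smooth_fun_def\<close>)
  then show "\<exists>c1\<in>charts M. \<exists>U1. x \<in> U1 \<and> U1 \<subseteq> fst c \<and> U1 \<subseteq> fst c1 \<and>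
        openin (top_of_set (pts M)) U1 \<and> smooth_on (model M) (snd c1 ` U1) (h \<circ> coord_inv c1)"
    using x k openin_Int[OF smooth_chartD(1)[OF assms(3)] smooth_chartD(1)[OF k(3)]]
    by (intro bexI[OF _ k(1)] exI[of _ "fst c \<inter> fst ?k"]) blast
qed

text \<open>\<open>smooth_chart\<close> compares a chart with charts of the atlas only; near each
  point an atlas chart mediates between two arbitrary smooth charts.\<close>

lemma smooth_transition_charts:
  fixes M :: "('m::{t2_space,second_countable_topology}, 'e::euclidean_space) mfd"
  assumes M: "smooth_manifold d M" and c: "smooth_chart M c" "smooth_chart M c'"
  shows "smooth_on (model M) (snd c ` (fst c \<inter> fst c')) (snd c' \<circ> coord_inv c)"
proof (rule smooth_on_chart_local[OF M c(1) openin_Int[OF smooth_chartD(1)[OF c(1)] smooth_chartD(1)[OF c(2)]]])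
  fix x assume x: "x \<in> fst c \<inter> fst c'"
  let ?k = "chart_at M x"
  have "x \<in> pts M" using smooth_chart_pts[OF c(1)] x by blast
  note k = chart_at[OF M this]
  have tr: "smooth_on (model M) (snd ?k ` (fst ?k \<inter> fst c')) (snd c' \<circ> coord_inv ?k)"
    using c(2) k(1) unfolding smooth_chart_def smooth_transition_def by blast
  have "smooth_on (model M) (snd ?k ` (fst c \<inter> fst c' \<inter> fst ?k)) (snd c' \<circ> coord_inv ?k)"
    by (rule smooth_on_mono[OF tr]) auto
  then show "\<exists>c1\<in>charts M. \<exists>U1. x \<in> U1 \<and> U1 \<subseteq> fst c \<inter> fst c' \<and> U1 \<subseteq> fst c1 \<and>
        openin (top_of_set (pts M)) U1 \<and> smooth_on (model M) (snd c1 ` U1) (snd c' \<circ> coord_inv c1)"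
    using x k(2) openin_Int[OF openin_Int[OF smooth_chartD(1)[OF c(1)] smooth_chartD(1)[OF c(2)]]
        smooth_chartD(1)[OF k(3)]]
    by (intro bexI[OF _ k(1)] exI[of _ "fst c \<inter> fst c' \<inter> fst ?k"]) blast
qed blast

lemma smooth_map_preimage_openin:
  assumes "smooth_map M N F" "openin (top_of_set (pts M)) U" "openin (top_of_set (pts N)) V"
  shows "openin (top_of_set (pts M)) (U \<inter> F -` V)"
proof -
  have F: "continuous_on (pts M) F" "F ` pts M \<subseteq> pts N"
    using assms(1) unfolding smooth_map_def by blast+
  then have "openin (top_of_set (pts M)) (pts M \<inter> F -` V)"
    using assms(3) by (intro continuous_openin_preimage) auto
  from openin_Int[OF assms(2) this] show ?thesis
    using openin_imp_subset[OF assms(2)] by (simp add: Int_assoc[symmetric] Int_absorb2)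
qed

lemma smooth_map_charts:
  fixes M :: "('m::{t2_space,second_countable_topology}, 'e::euclidean_space) mfd"
    and N :: "('m1::{t2_space,second_countable_topology}, 'e1::euclidean_space) mfd"
  assumes M: "smooth_manifold d M" and N: "smooth_manifold d' N" and F: "smooth_map M N F"
    and c: "smooth_chart M c" and k: "smooth_chart N k"
  shows "smooth_on (model M) (snd c ` (fst c \<inter> F -` fst k)) (snd k \<circ> F \<circ> coord_inv c)"
proof (rule smooth_on_chart_local[OF M c smooth_map_preimage_openin[OF F smooth_chartD(1)[OF c] smooth_chartD(1)[OF k]]])
  fix x assume x: "x \<in> fst c \<inter> F -` fst k"
  let ?c = "chart_at M x" and ?k = "chart_at N (F x)"
  have "x \<in> pts M" "F x \<in> pts N" using smooth_chart_pts[OF c] smooth_chart_pts[OF k] x by blast+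
  note c1 = chart_at[OF M this(1)] and k1 = chart_at[OF N this(2)]
  let ?U = "(fst c \<inter> fst ?c) \<inter> F -` (fst k \<inter> fst ?k)"
  have U: "openin (top_of_set (pts M)) ?U"
    by (intro smooth_map_preimage_openin[OF F] openin_Int smooth_chartD(1)[OF c] smooth_chartD(1)[OF k]
        smooth_chartD(1)[OF c1(3)] smooth_chartD(1)[OF k1(3)])
  have sF: "smooth_on (model M) (snd ?c ` (fst ?c \<inter> F -` fst ?k)) (snd ?k \<circ> F \<circ> coord_inv ?c)"
    using F c1(1) k1(1) unfolding smooth_map_def by blast
  have Uc: "openin (top_of_set (model M)) (snd ?c ` ?U)" by (rule chart_image_openin[OF c1(3) U]) blast
  let ?T = "snd ?k ` (fst ?k \<inter> fst k)"
  have kT: "openin (top_of_set (model N)) ?T"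
    by (rule chart_image_openin[OF k1(3) openin_Int[OF smooth_chartD(1)[OF k1(3)] smooth_chartD(1)[OF k]]]) blast
  have sm: "smooth_on (model M) (snd ?c ` ?U) (\<lambda>y. (snd k \<circ> coord_inv ?k) ((snd ?k \<circ> F \<circ> coord_inv ?c) y))"
  proof (rule smooth_on_compose[OF manifold_chart(1)[OF M] Uc manifold_chart(1)[OF N] _
        openin_imp_subset[OF kT] smooth_on_mono[OF sF order_refl] smooth_transition_charts[OF N k1(3) k]])
    show "snd ?c ` ?U \<subseteq> snd ?c ` (fst ?c \<inter> F -` fst ?k)" by blast
    show "(snd ?k \<circ> F \<circ> coord_inv ?c) ` snd ?c ` ?U \<subseteq> ?T"
      using coord_inv_snd[OF c1(3)] by (auto simp: image_subset_iff)
  qed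
  have "smooth_on (model M) (snd ?c ` ?U) (snd k \<circ> F \<circ> coord_inv ?c)"
  proof (rule smooth_on_transform[OF sm])
    fix y assume "y \<in> snd ?c ` ?U"
    then obtain z where z: "z \<in> ?U" "y = snd ?c z" by blast
    then have "coord_inv ?c y = z" "coord_inv ?k (snd ?k (F z)) = F z"
      using coord_inv_snd[OF c1(3)] coord_inv_snd[OF k1(3)] by blast+
    then show "(snd k \<circ> coord_inv ?k) ((snd ?k \<circ> F \<circ> coord_inv ?c) y) = (snd k \<circ> F \<circ> coord_inv ?c) y" by simp
  qed
  then show "\<exists>c1\<in>charts M. \<exists>U1. x \<in> U1 \<and> U1 \<subseteq> fst c \<inter> F -` fst k \<and> U1 \<subseteq> fst c1 \<and>
        openin (top_of_set (pts M)) U1 \<and> smooth_on (model M) (snd c1 ` U1) (snd k \<circ> F \<circ> coord_inv c1)"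
    using x c1(2) k1(2) U by (intro bexI[OF _ c1(1)] exI[of _ ?U]) blast
qed blast


subsection \<open>Derivatives in charts\<close>

text \<open>Taken within the whole model and not within a chart image: at a point of the chart the
  two filters agree, and the expression no longer depends on which neighbourhood is
  considered.\<close>

definition chart_deriv ::
    "('m, 'e::real_normed_vector) mfd \<Rightarrow> ('m, 'e) chart \<Rightarrow> ('m \<Rightarrow> 'b::real_normed_vector) \<Rightarrow> 'm \<Rightarrow> 'e \<Rightarrow> 'b" where
  "chart_deriv M c H x = frechet_derivative (H \<circ> coord_inv c) (at (snd c x) within model M)"

definition chart_diff ::
    "('m, 'e::real_normed_vector) mfd \<Rightarrow> ('m, 'e) chart \<Rightarrow> ('m \<Rightarrow> 'b::real_normed_vector) \<Rightarrow> 'm \<Rightarrow> bool" where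
  "chart_diff M c H x \<longleftrightarrow> H \<circ> coord_inv c differentiable (at (snd c x) within model M)"

lemma chart_diff_has_derivative:
  "chart_diff M c H x \<Longrightarrow>
    (H \<circ> coord_inv c has_derivative chart_deriv M c H x) (at (snd c x) within model M)"
  unfolding chart_diff_def chart_deriv_def by (simp only: frechet_derivative_works)

lemma chart_deriv_eq:
  assumes "subspace (model M)" "snd c x \<in> model M" "u \<in> model M"
    and "(H \<circ> coord_inv c has_derivative D) (at (snd c x) within model M)"
  shows "chart_diff M c H x" "chart_deriv M c H x u = D u"
proof -
  show "chart_diff M c H x" unfolding chart_diff_def by (rule differentiableI[OF assms(4)])
  show "chart_deriv M c H x u = D u" unfolding chart_deriv_def
    by (rule frechet_derivative_on[OF assms(1) openin_subtopology_self assms(2-4)])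
qed

lemma linear_chart_deriv: "chart_diff M c H x \<Longrightarrow> linear (chart_deriv M c H x)"
  by (rule has_derivative_linear[OF chart_diff_has_derivative])

lemma at_chart:
  assumes "smooth_chart M c" "openin (top_of_set (pts M)) U" "U \<subseteq> fst c" "x \<in> U"
  shows "at (snd c x) within snd c ` U = at (snd c x) within model M"
  using at_within_openin[OF chart_image_openin[OF assms(1-3)]] assms(4) by blast

lemma smooth_on_chart_diff:
  assumes "smooth_chart M c" "openin (top_of_set (pts M)) U" "U \<subseteq> fst c" "x \<in> U"
    and "smooth_on (model M) (snd c ` U) (H \<circ> coord_inv c)"
  shows "chart_diff M c H x"
proof -
  have "snd c x \<in> snd c ` U" using assms(4) by (rule imageI)
  from smooth_on_has_derivative[OF assms(5) this] show ?thesis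
    unfolding chart_diff_def at_chart[OF assms(1-4)] by (rule differentiableI)
qed

lemma chart_in_model: "smooth_chart M c \<Longrightarrow> x \<in> fst c \<Longrightarrow> snd c x \<in> model M"
  using openin_imp_subset[OF smooth_chartD(2)] by blast

lemma chart_chain:
  fixes M :: "('m::topological_space, 'e::euclidean_space) mfd"
    and N :: "('m1::topological_space, 'e1::euclidean_space) mfd"
    and H :: "'m1 \<Rightarrow> 'b::real_normed_vector"
  assumes M: "subspace (model M)" "smooth_chart M c"
    and N: "subspace (model N)" "smooth_chart N k"
    and U: "openin (top_of_set (pts M)) U" "U \<subseteq> fst c" "x \<in> U" "F ` U \<subseteq> fst k"
    and F: "chart_diff M c (snd k \<circ> F) x" and H: "chart_diff N k H (F x)"
  shows "chart_diff M c (H \<circ> F) x"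
    and "u \<in> model M \<Longrightarrow> chart_deriv M c (snd k \<circ> F) x u \<in> model N"
    and "u \<in> model M \<Longrightarrow>
      chart_deriv M c (H \<circ> F) x u = chart_deriv N k H (F x) (chart_deriv M c (snd k \<circ> F) x u)"
proof -
  let ?T = "snd c ` U" and ?f = "snd k \<circ> F \<circ> coord_inv c"
  let ?D = "chart_deriv M c (snd k \<circ> F) x" and ?D' = "chart_deriv N k H (F x)"
  have T: "openin (top_of_set (model M)) ?T" by (rule chart_image_openin[OF M(2) U(1,2)])
  have xT: "snd c x \<in> ?T" using U(3) by blast
  have xc: "x \<in> fst c" using U by blast
  note atT = at_chart[OF M(2) U(1-3)]
  have f: "(?f has_derivative ?D) (at (snd c x) within ?T)"
    using chart_diff_has_derivative[OF F] unfolding atT .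
  have inv: "coord_inv c (snd c z) = z" if "z \<in> U" for z using coord_inv_snd[OF M(2)] U(2) that by blast
  have fT: "?f ` ?T \<subseteq> model N"
    using U(4) chart_in_model[OF N(2)] inv by (auto simp: image_subset_iff)
  have fx: "?f (snd c x) = snd k (F x)" using inv[OF U(3)] by simp
  have "(H \<circ> coord_inv k has_derivative ?D') (at (?f (snd c x)) within ?f ` ?T)"
    unfolding fx by (rule has_derivative_subset[OF chart_diff_has_derivative[OF H] fT])
  from has_derivative_in_compose[OF f this]
  have "((\<lambda>y. (H \<circ> coord_inv k) (?f y)) has_derivative (\<lambda>u. ?D' (?D u))) (at (snd c x) within ?T)" .
  then have "(H \<circ> F \<circ> coord_inv c has_derivative (\<lambda>u. ?D' (?D u))) (at (snd c x) within ?T)"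
  proof (rule has_derivative_transform[OF xT, rotated])
    fix y assume "y \<in> ?T"
    then obtain z where z: "z \<in> U" "y = snd c z" by blast
    then have "F z \<in> fst k" using U(4) by blast
    then show "(H \<circ> F \<circ> coord_inv c) y = (H \<circ> coord_inv k) (?f y)"
      using z inv coord_inv_snd[OF N(2)] by simp
  qed
  then have d: "(H \<circ> F \<circ> coord_inv c has_derivative (\<lambda>u. ?D' (?D u))) (at (snd c x) within model M)"
    unfolding atT .
  note cM = chart_in_model[OF M(2) xc]
  show "chart_diff M c (H \<circ> F) x" using chart_deriv_eq(1)[OF M(1) cM subspace_0[OF M(1)] d] .
  show "?D u \<in> model N" if "u \<in> model M"
    by (rule has_derivative_in_subspace[OF M(1) T xT that f N(1) fT])
  show "chart_deriv M c (H \<circ> F) x u = ?D' (?D u)" if "u \<in> model M"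
    using chart_deriv_eq(2)[OF M(1) cM that d] .
qed


section \<open>Chain rules and differentials computed in arbitrary charts\<close>

lemma transition_diff:
  fixes M :: "('m::{t2_space,second_countable_topology}, 'e::euclidean_space) mfd"
  assumes M: "smooth_manifold d M" and c: "smooth_chart M c" "smooth_chart M k" and x: "x \<in> fst c" "x \<in> fst k"
  shows "chart_diff M c (snd k) x"
  by (rule smooth_on_chart_diff[OF c(1) openin_Int[OF smooth_chartD(1)[OF c(1)] smooth_chartD(1)[OF c(2)]]
        _ _ smooth_transition_charts[OF M c]]) (use x in auto)

lemma smooth_map_diff:
  fixes M :: "('m::{t2_space,second_countable_topology}, 'e::euclidean_space) mfd"
    and N :: "('m1::{t2_space,second_countable_topology}, 'e1::euclidean_space) mfd"
  assumes M: "smooth_manifold d M" and N: "smooth_manifold d' N" and F: "smooth_map M N F"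
    and c: "smooth_chart M c" and k: "smooth_chart N k" and x: "x \<in> fst c" "F x \<in> fst k"
  shows "chart_diff M c (snd k \<circ> F) x"
  by (rule smooth_on_chart_diff[OF c smooth_map_preimage_openin[OF F smooth_chartD(1)[OF c] smooth_chartD(1)[OF k]]
        _ _ smooth_map_charts[OF M N F c k]]) (use x in auto)

lemma smooth_fun_diff:
  fixes M :: "('m::{t2_space,second_countable_topology}, 'e::euclidean_space) mfd"
  assumes "smooth_manifold d M" "smooth_fun M h" "smooth_chart M c" "x \<in> fst c"
  shows "chart_diff M c h x"
  by (rule smooth_on_chart_diff[OF assms(3) smooth_chartD(1)[OF assms(3)] order_refl assms(4)
        smooth_fun_chart[OF assms(1-3)]])

lemma chart_change:
  fixes M :: "('m::{t2_space,second_countable_topology}, 'e::euclidean_space) mfd"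
    and H :: "'m \<Rightarrow> 'b::real_normed_vector"
  assumes M: "smooth_manifold d M" and c: "smooth_chart M c" "smooth_chart M k"
    and x: "x \<in> fst c" "x \<in> fst k" and H: "chart_diff M k H x"
  shows "chart_diff M c H x"
    and "u \<in> model M \<Longrightarrow> chart_deriv M c (snd k) x u \<in> model M"
    and "u \<in> model M \<Longrightarrow> chart_deriv M c H x u = chart_deriv M k H x (chart_deriv M c (snd k) x u)"
proof -
  have U: "openin (top_of_set (pts M)) (fst c \<inter> fst k)"
    by (intro openin_Int smooth_chartD(1) c)
  have t: "chart_diff M c (snd k \<circ> id) x" using transition_diff[OF M c x] by simp
  have H': "chart_diff M k H (id x)" using H by simp
  have s: "x \<in> fst c \<inter> fst k" "id ` (fst c \<inter> fst k) \<subseteq> fst k" using x by auto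
  note ch = chart_chain[where F = id, OF manifold_chart(1)[OF M] c(1) manifold_chart(1)[OF M] c(2) U Int_lower1 s t H']
  show "chart_diff M c H x" using ch(1) by simp
  show "chart_deriv M c (snd k) x u \<in> model M" if "u \<in> model M" using ch(2)[OF that] by simp
  show "chart_deriv M c H x u = chart_deriv M k H x (chart_deriv M c (snd k) x u)" if "u \<in> model M"
    using ch(3)[OF that] by simp
qed

lemma map_chain:
  fixes M :: "('m::{t2_space,second_countable_topology}, 'e::euclidean_space) mfd"
    and N :: "('m1::{t2_space,second_countable_topology}, 'e1::euclidean_space) mfd"
    and H :: "'m1 \<Rightarrow> 'b::real_normed_vector"
  assumes M: "smooth_manifold d M" and N: "smooth_manifold d' N" and F: "smooth_map M N F"
    and c: "smooth_chart M c" and k: "smooth_chart N k" and x: "x \<in> fst c" "F x \<in> fst k"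
    and H: "chart_diff N k H (F x)"
  shows "chart_diff M c (H \<circ> F) x"
    and "u \<in> model M \<Longrightarrow> chart_deriv M c (snd k \<circ> F) x u \<in> model N"
    and "u \<in> model M \<Longrightarrow>
      chart_deriv M c (H \<circ> F) x u = chart_deriv N k H (F x) (chart_deriv M c (snd k \<circ> F) x u)"
proof -
  have s: "x \<in> fst c \<inter> F -` fst k" "F ` (fst c \<inter> F -` fst k) \<subseteq> fst k" using x by auto
  note ch = chart_chain[OF manifold_chart(1)[OF M] c manifold_chart(1)[OF N] k
      smooth_map_preimage_openin[OF F smooth_chartD(1)[OF c] smooth_chartD(1)[OF k]] Int_lower1 s
      smooth_map_diff[OF M N F c k x] H]
  show "chart_diff M c (H \<circ> F) x" by (rule ch(1))
  show "chart_deriv M c (snd k \<circ> F) x u \<in> model N" if "u \<in> model M" by (rule ch(2)[OF that])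
  show "chart_deriv M c (H \<circ> F) x u = chart_deriv N k H (F x) (chart_deriv M c (snd k \<circ> F) x u)"
    if "u \<in> model M" by (rule ch(3)[OF that])
qed

lemma chart_deriv_cong:
  assumes c: "smooth_chart M c" "subspace (model M)" and U: "openin (top_of_set (pts M)) U" "x \<in> U" "x \<in> fst c"
    and eq: "\<And>z. z \<in> U \<Longrightarrow> z \<in> fst c \<Longrightarrow> H z = H' z" and H: "chart_diff M c H x" and u: "u \<in> model M"
  shows "chart_diff M c H' x" "chart_deriv M c H x u = chart_deriv M c H' x u"
proof -
  let ?U = "fst c \<inter> U"
  have oU: "openin (top_of_set (pts M)) ?U" by (intro openin_Int smooth_chartD(1) c U)
  have xU: "x \<in> ?U" using U by blast
  note at = at_chart[OF c(1) oU Int_lower1 xU]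
  have "(H' \<circ> coord_inv c has_derivative chart_deriv M c H x) (at (snd c x) within model M)"
    unfolding at[symmetric]
  proof (rule has_derivative_transform)
    show "snd c x \<in> snd c ` ?U" using xU by (rule imageI)
    show "(H \<circ> coord_inv c has_derivative chart_deriv M c H x) (at (snd c x) within snd c ` ?U)"
      unfolding at by (rule chart_diff_has_derivative[OF H])
    fix y assume "y \<in> snd c ` ?U"
    then obtain z where z: "z \<in> ?U" "y = snd c z" by blast
    then have "coord_inv c y = z" using coord_inv_snd[OF c(1)] by blast
    then show "(H' \<circ> coord_inv c) y = (H \<circ> coord_inv c) y" using z eq[of z] by simp
  qed
  note d = chart_deriv_eq[OF c(2) chart_in_model[OF c(1) U(3)] u this]
  show "chart_diff M c H' x" by (rule d(1))
  show "chart_deriv M c H x u = chart_deriv M c H' x u" using d(2) by simp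
qed

lemma chart_deriv_self:
  assumes c: "smooth_chart M c" "subspace (model M)" "x \<in> fst c" "u \<in> model M"
  shows "chart_deriv M c (snd c) x u = u"
proof -
  have xc: "snd c x \<in> snd c ` fst c" using c(3) by (rule imageI)
  have "((snd c \<circ> coord_inv c) has_derivative (\<lambda>u. u)) (at (snd c x) within snd c ` fst c)"
    by (rule has_derivative_transform[OF xc _ has_derivative_ident]) (simp add: snd_coord_inv[OF c(1)])
  then have d: "((snd c \<circ> coord_inv c) has_derivative (\<lambda>u. u)) (at (snd c x) within model M)"
    unfolding at_chart[OF c(1) smooth_chartD(1)[OF c(1)] order_refl c(3)] .
  show ?thesis by (rule chart_deriv_eq(2)[OF c(2) chart_in_model[OF c(1,3)] c(4) d])
qed

lemma dfun_eq:
  assumes "smooth_manifold d M" "x \<in> pts M"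
  shows "dfun M h x = chart_deriv M (chart_at M x) h x"
  unfolding dfun_def Let_def chart_deriv_def
    at_chart[OF chart_at(3)[OF assms] smooth_chartD(1)[OF chart_at(3)[OF assms]] order_refl chart_at(2)[OF assms]] ..

lemma dmap_eq:
  assumes "smooth_manifold d M" "smooth_manifold d' N" "smooth_map M N F" "x \<in> pts M"
  shows "dmap M N F x = chart_deriv M (chart_at M x) (snd (chart_at N (F x)) \<circ> F) x"
proof -
  have Fx: "F x \<in> pts N" using assms(3,4) unfolding smooth_map_def by blast
  note c = chart_at[OF assms(1,4)] and k = chart_at[OF assms(2) Fx]
  have x: "x \<in> fst (chart_at M x) \<inter> F -` fst (chart_at N (F x))" using c(2) k(2) by blast
  show ?thesis
    unfolding dmap_def Let_def chart_deriv_def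
      at_chart[OF c(3) smooth_map_preimage_openin[OF assms(3) smooth_chartD(1)[OF c(3)] smooth_chartD(1)[OF k(3)]]
          Int_lower1 x] ..
qed

lemma coord_vec_eq:
  assumes "smooth_manifold d M" "smooth_chart M c" "x \<in> fst c"
  shows "coord_vec M c x = chart_deriv M c (snd (chart_at M x)) x"
proof -
  note k = chart_at[OF assms(1) smooth_chart_pts[OF assms(2,3)]]
  have x: "x \<in> fst c \<inter> fst (chart_at M x)" using assms(3) k(2) by blast
  show ?thesis
    unfolding coord_vec_def Let_def chart_deriv_def
      at_chart[OF assms(2) openin_Int[OF smooth_chartD(1)[OF assms(2)] smooth_chartD(1)[OF k(3)]]
          Int_lower1 x] ..
qed

context
  fixes M :: "('m::{t2_space,second_countable_topology}, 'e::euclidean_space) mfd" and d :: nat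
  assumes M: "smooth_manifold d M"
begin

lemma linear_coord_vec: "smooth_chart M c \<Longrightarrow> x \<in> fst c \<Longrightarrow> linear (coord_vec M c x)"
  unfolding coord_vec_eq[OF M]
  by (intro linear_chart_deriv transition_diff[OF M]) (assumption | rule chart_at[OF M] smooth_chart_pts)+

lemma linear_dfun: "smooth_fun M h \<Longrightarrow> x \<in> pts M \<Longrightarrow> linear (dfun M h x)"
  unfolding dfun_eq[OF M] by (intro linear_chart_deriv smooth_fun_diff[OF M] chart_at[OF M])

lemma coord_vec_in: "smooth_chart M c \<Longrightarrow> x \<in> fst c \<Longrightarrow> u \<in> model M \<Longrightarrow> coord_vec M c x u \<in> model M"
  unfolding coord_vec_eq[OF M]
  by (rule chart_change(2)[OF M _ _ _ _ transition_diff[OF M]])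
    (assumption | rule chart_at[OF M] smooth_chart_pts)+

lemma chart_deriv_coord_vec:
  assumes "smooth_chart M c" "x \<in> fst c" "u \<in> model M" "chart_diff M (chart_at M x) H x"
  shows "chart_deriv M (chart_at M x) H x (coord_vec M c x u) = chart_deriv M c H x u"
  unfolding coord_vec_eq[OF M assms(1,2)]
  by (rule chart_change(3)[OF M assms(1) _ assms(2) _ assms(4,3), symmetric])
    (rule chart_at[OF M smooth_chart_pts[OF assms(1,2)]])+

lemma dfun_coord_vec:
  assumes "smooth_fun M h" "smooth_chart M c" "x \<in> fst c" "u \<in> model M"
  shows "dfun M h x (coord_vec M c x u) = chart_deriv M c h x u"
proof -
  have x: "x \<in> pts M" by (rule smooth_chart_pts[OF assms(2,3)])
  show ?thesis
    unfolding dfun_eq[OF M x]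
    by (rule chart_deriv_coord_vec[OF assms(2-4) smooth_fun_diff[OF M assms(1) chart_at(3,2)[OF M x]]])
qed

lemma coord_vec_change:
  assumes "smooth_chart M c" "smooth_chart M k" "x \<in> fst c" "x \<in> fst k" "u \<in> model M"
  shows "coord_vec M k x (chart_deriv M c (snd k) x u) = coord_vec M c x u"
  unfolding coord_vec_eq[OF M assms(1,3)] coord_vec_eq[OF M assms(2,4)]
  by (rule chart_change(3)[OF M assms(1-4) transition_diff[OF M assms(2) _ assms(4)] assms(5), symmetric])
    (rule chart_at[OF M smooth_chart_pts[OF assms(1,3)]])+

lemma coord_vec_surj:
  assumes "smooth_chart M c" "x \<in> fst c" "v \<in> model M"
  obtains u where "u \<in> model M" "coord_vec M c x u = v"
proof -
  let ?k = "chart_at M x"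
  note k = chart_at[OF M smooth_chart_pts[OF assms(1,2)]]
  have "coord_vec M c x (chart_deriv M ?k (snd c) x v) = coord_vec M ?k x v"
    by (rule coord_vec_change[OF k(3) assms(1) k(2) assms(2,3)])
  also have "\<dots> = v" unfolding coord_vec_eq[OF M k(3,2)]
    by (rule chart_deriv_self[OF k(3) manifold_chart(1)[OF M] k(2) assms(3)])
  finally show ?thesis
    using that chart_change(2)[OF M k(3) assms(1) k(2) assms(2) transition_diff[OF M assms(1,1,2,2)] assms(3)]
    by blast
qed

lemma coord_vec_eq_0:
  assumes "smooth_chart M c" "x \<in> fst c" "u \<in> model M" "coord_vec M c x u = 0"
  shows "u = 0"
proof -
  let ?k = "chart_at M x"
  note k = chart_at[OF M smooth_chart_pts[OF assms(1,2)]]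
  have td: "chart_diff M ?k (snd c) x" by (rule transition_diff[OF M k(3) assms(1) k(2) assms(2)])
  have "chart_deriv M ?k (snd c) x (coord_vec M c x u) = chart_deriv M c (snd c) x u"
    by (rule chart_deriv_coord_vec[OF assms(1-3) td])
  also have "\<dots> = u" by (rule chart_deriv_self[OF assms(1) manifold_chart(1)[OF M] assms(2,3)])
  finally show ?thesis using assms(4) linear_0[OF linear_chart_deriv[OF td]] by simp
qed

context
  fixes N :: "('m1::{t2_space,second_countable_topology}, 'e1::euclidean_space) mfd" and d' :: nat
    and F :: "'m \<Rightarrow> 'm1"
  assumes N: "smooth_manifold d' N" and F: "smooth_map M N F"
begin

lemma smooth_map_pts: "x \<in> pts M \<Longrightarrow> F x \<in> pts N"
  using F unfolding smooth_map_def by blast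

lemma linear_dmap: "x \<in> pts M \<Longrightarrow> linear (dmap M N F x)"
  unfolding dmap_eq[OF M N F]
  by (intro linear_chart_deriv smooth_map_diff[OF M N F] chart_at[OF M] chart_at[OF N] smooth_map_pts)

lemma dmap_in: "x \<in> pts M \<Longrightarrow> u \<in> model M \<Longrightarrow> dmap M N F x u \<in> model N"
  unfolding dmap_eq[OF M N F]
  by (rule map_chain(2)[OF M N F _ _ _ _ transition_diff[OF N]])
    (assumption | rule chart_at[OF M] chart_at[OF N] smooth_map_pts)+

text \<open>Removes the preferred charts from \<open>dmap\<close>, so that differentials can be
  computed in charts adapted to the situation, such as slice charts.\<close>

lemma dmap_coord_vec:
  assumes c: "smooth_chart M c" and k: "smooth_chart N k" and x: "x \<in> fst c" "F x \<in> fst k" and u: "u \<in> model M"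
  shows "dmap M N F x (coord_vec M c x u) = coord_vec N k (F x) (chart_deriv M c (snd k \<circ> F) x u)"
proof -
  have xM: "x \<in> pts M" by (rule smooth_chart_pts[OF c x(1)])
  note c0 = chart_at[OF M xM] and k0 = chart_at[OF N smooth_map_pts[OF xM]]
  have "dmap M N F x (coord_vec M c x u) = chart_deriv M c (snd (chart_at N (F x)) \<circ> F) x u"
    unfolding dmap_eq[OF M N F xM]
    by (rule chart_deriv_coord_vec[OF c x(1) u smooth_map_diff[OF M N F c0(3) k0(3) c0(2) k0(2)]])
  also have "\<dots> = coord_vec N k (F x) (chart_deriv M c (snd k \<circ> F) x u)"
    unfolding coord_vec_eq[OF N k x(2)]
    by (rule map_chain(3)[OF M N F c k x transition_diff[OF N k k0(3) x(2) k0(2)] u])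
  finally show ?thesis .
qed

lemma dfun_dmap:
  assumes h: "smooth_fun N h" and x: "x \<in> pts M" and u: "u \<in> model M"
  shows "dfun N h (F x) (dmap M N F x u) = dfun M (h \<circ> F) x u"
proof -
  note c0 = chart_at[OF M x] and k0 = chart_at[OF N smooth_map_pts[OF x]]
  show ?thesis
    unfolding dfun_eq[OF M x] dfun_eq[OF N smooth_map_pts[OF x]] dmap_eq[OF M N F x]
    by (rule map_chain(3)[OF M N F c0(3) k0(3) c0(2) k0(2) smooth_fun_diff[OF N h k0(3,2)] u, symmetric])
qed

end

lemma dfun_const_on:
  assumes x: "x \<in> pts M" "u \<in> model M" and eq: "\<And>z. z \<in> pts M \<Longrightarrow> h z = b"
  shows "dfun M h x u = 0"
proof -
  note c0 = chart_at[OF M x(1)]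
  have d: "((\<lambda>_. b) \<circ> coord_inv (chart_at M x) has_derivative (\<lambda>_. 0)) (at (snd (chart_at M x) x) within model M)"
    unfolding o_def by (rule has_derivative_const)
  note D = chart_deriv_eq[OF manifold_chart(1)[OF M] chart_in_model[OF c0(3,2)] x(2) d]
  have "chart_deriv M (chart_at M x) (\<lambda>_. b) x u = chart_deriv M (chart_at M x) h x u"
    by (rule chart_deriv_cong(2)[OF c0(3) manifold_chart(1)[OF M] openin_subtopology_self x(1) c0(2) _ D(1) x(2)])
      (simp add: eq)
  then show ?thesis unfolding dfun_eq[OF M x(1)] using D(2) by simp
qed

text \<open>In coordinates the curve stays in the model, hence so does its velocity; without this
  the derivative of H within the model would say nothing about v.\<close>

lemma curve_chain:
  fixes H :: "'m \<Rightarrow> 'b::real_normed_vector"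
  assumes c: "smooth_chart M c" and O': "open T" "t \<in> T" "\<And>s. s \<in> T \<Longrightarrow> \<gamma> s \<in> fst c"
    and v: "((\<lambda>s. snd c (\<gamma> s)) has_vector_derivative v) (at t)" and H: "chart_diff M c H (\<gamma> t)"
  shows "v \<in> model M" "((\<lambda>s. H (\<gamma> s)) has_vector_derivative chart_deriv M c H (\<gamma> t) v) (at t)"
proof -
  have atT: "at t within T = at t" by (rule at_within_open[OF O'(2,1)])
  have d: "((\<lambda>s. snd c (\<gamma> s)) has_derivative (\<lambda>s. s *\<^sub>R v)) (at t within T)"
    using v unfolding atT has_vector_derivative_def .
  have im: "(\<lambda>s. snd c (\<gamma> s)) ` T \<subseteq> model M" using chart_in_model[OF c O'(3)] by blast
  have "1 *\<^sub>R v \<in> model M"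
    by (rule has_derivative_in_subspace[OF subspace_UNIV _ O'(2) UNIV_I d manifold_chart(1)[OF M] im])
      (simp add: O'(1))
  then show "v \<in> model M" by simp
  have "(H \<circ> coord_inv c has_derivative chart_deriv M c H (\<gamma> t)) (at (snd c (\<gamma> t)) within (\<lambda>s. snd c (\<gamma> s)) ` T)"
    by (rule has_derivative_subset[OF chart_diff_has_derivative[OF H] im])
  from has_derivative_in_compose[OF d this]
  have "((\<lambda>s. (H \<circ> coord_inv c) (snd c (\<gamma> s))) has_derivative (\<lambda>s. chart_deriv M c H (\<gamma> t) (s *\<^sub>R v))) (at t within T)" .
  then have "((\<lambda>s. H (\<gamma> s)) has_derivative (\<lambda>s. chart_deriv M c H (\<gamma> t) (s *\<^sub>R v))) (at t within T)"
    by (rule has_derivative_transform[OF O'(2), rotated]) (simp add: coord_inv_snd[OF c O'(3)])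
  then show "((\<lambda>s. H (\<gamma> s)) has_vector_derivative chart_deriv M c H (\<gamma> t) v) (at t)"
    unfolding atT has_vector_derivative_def linear_scale[OF linear_chart_deriv[OF H]] .
qed

end


subsection \<open>Submanifolds\<close>

lemma submfd_simps [simp]: "pts (submfd M E0 S) = S" "model (submfd M E0 S) = E0"
  by (simp_all add: submfd_def)

lemma charts_submfd_iff:
  "c' \<in> charts (submfd M E0 S) \<longleftrightarrow> (\<exists>c. slice_chart M E0 S c \<and> c' = (fst c \<inter> S, snd c))"
  unfolding submfd_def by (simp only: mfd.simps mem_Collect_eq) blast

context
  fixes M :: "('m::{t2_space,second_countable_topology}, 'e::euclidean_space) mfd" and d :: nat
    and E0 :: "'e set" and S :: "'m set"
  assumes M: "smooth_manifold d M" and S: "embedded_submanifold M E0 S"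
begin

lemma submanifold_model: "subspace E0" "E0 \<subseteq> model M" "S \<subseteq> pts M"
  using S unfolding embedded_submanifold_def by simp_all

lemma slice_chart_smooth: "slice_chart M E0 S c \<Longrightarrow> smooth_chart M c"
  unfolding slice_chart_def by simp

lemma slice_image: "slice_chart M E0 S c \<Longrightarrow> snd c ` (fst c \<inter> S) = snd c ` fst c \<inter> E0"
  unfolding slice_chart_def by simp

text \<open>\<open>coord_inv\<close> is an \<open>inv_into\<close> and depends on the domain of the
  chart. Injectivity on the larger domain makes both inverses agree over the submanifold.\<close>

lemma coord_inv_slice:
  assumes "slice_chart M E0 S c" "y \<in> snd c ` (fst c \<inter> S)"
  shows "coord_inv (fst c \<inter> S, snd c) y = coord_inv c y"
proof -
  obtain x where x: "x \<in> fst c \<inter> S" "y = snd c x" using assms(2) by blast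
  have i: "inj_on (snd c) (fst c)" by (rule smooth_chart_inj[OF slice_chart_smooth[OF assms(1)]])
  have "coord_inv (fst c \<inter> S, snd c) y = x"
    unfolding coord_inv_def x(2) using x(1) inv_into_f_f[OF inj_on_subset[OF i Int_lower1]] by simp
  moreover have "coord_inv c y = x"
    unfolding coord_inv_def x(2) using x(1) inv_into_f_f[OF i] by simp
  ultimately show ?thesis by simp
qed

lemma slice_transition:
  assumes c: "slice_chart M E0 S c" and k: "smooth_chart M k" and T: "T \<subseteq> snd c ` (fst c \<inter> S \<inter> fst k)"
  shows "smooth_on E0 T (snd k \<circ> coord_inv (fst c \<inter> S, snd c))"
proof -
  have "smooth_on E0 T (snd k \<circ> coord_inv c)"
    by (rule smooth_on_mono[OF smooth_transition_charts[OF M slice_chart_smooth[OF c] k] submanifold_model(2)])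
      (use T in blast)
  then show ?thesis
    by (rule smooth_on_transform) (use T coord_inv_slice[OF c] in auto)
qed

lemma smooth_chart_submfd:
  assumes c: "slice_chart M E0 S c"
  shows "smooth_chart (submfd M E0 S) (fst c \<inter> S, snd c)"
proof -
  let ?c = "(fst c \<inter> S, snd c)"
  note sc = slice_chart_smooth[OF c]
  note D = smooth_chartD[OF sc]
  have 1: "openin (top_of_set S) (fst c \<inter> S)"
  proof -
    obtain O' where "open O'" "fst c = pts M \<inter> O'" using D(1) by (auto simp: openin_open)
    then show ?thesis using submanifold_model(3) by (auto simp: openin_open)
  qed
  have 2: "openin (top_of_set E0) (snd c ` (fst c \<inter> S))"
  proof -
    obtain O' where "open O'" "snd c ` fst c = model M \<inter> O'" using D(2) by (auto simp: openin_open)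
    then show ?thesis using submanifold_model(2) unfolding slice_image[OF c] by (auto simp: openin_open)
  qed
  have 3: "homeomorphism (fst c \<inter> S) (snd c ` (fst c \<inter> S)) (snd c) (coord_inv ?c)"
    unfolding homeomorphism_def
  proof (intro conjI ballI)
    show "continuous_on (fst c \<inter> S) (snd c)"
      by (rule continuous_on_subset[OF homeomorphism_cont1[OF D(3)] Int_lower1])
    have "continuous_on (snd c ` (fst c \<inter> S)) (coord_inv c)"
      by (rule continuous_on_subset[OF homeomorphism_cont2[OF D(3)]]) blast
    then show "continuous_on (snd c ` (fst c \<inter> S)) (coord_inv ?c)"
      by (rule continuous_on_eq) (simp add: coord_inv_slice[OF c])
    have inv: "coord_inv ?c (snd c x) = x" if "x \<in> fst c \<inter> S" for x
      using coord_inv_slice[OF c] coord_inv_snd[OF sc] that by (metis IntD1 imageI)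
    then show "coord_inv ?c (snd c x) = x" if "x \<in> fst c \<inter> S" for x using that .
    show "coord_inv ?c ` snd c ` (fst c \<inter> S) = fst c \<inter> S"
      unfolding image_image using inv by simp
    show "snd c (coord_inv ?c y) = y" if "y \<in> snd c ` (fst c \<inter> S)" for y
      using that inv by auto
  qed simp
  have 4: "smooth_transition E0 ?c c' \<and> smooth_transition E0 c' ?c" if c': "c' \<in> charts (submfd M E0 S)" for c'
  proof -
    obtain k where k: "slice_chart M E0 S k" "c' = (fst k \<inter> S, snd k)"
      using c' unfolding charts_submfd_iff by blast
    show ?thesis unfolding smooth_transition_def k(2) fst_conv snd_conv
      by (intro conjI slice_transition[OF c slice_chart_smooth[OF k(1)]] slice_transition[OF k(1) sc]) blast+
  qed
  show ?thesis unfolding smooth_chart_def submfd_simps fst_conv snd_conv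
    using 1 2 3 4 by blast
qed

lemma charts_submfd: "c' \<in> charts (submfd M E0 S) \<Longrightarrow> smooth_chart (submfd M E0 S) c'"
  using smooth_chart_submfd unfolding charts_submfd_iff by blast

lemma smooth_manifold_submfd: "smooth_manifold (dim E0) (submfd M E0 S)"
proof -
  have "S = (\<Union>c\<in>charts (submfd M E0 S). fst c)"
  proof (intro equalityI subsetI)
    fix x assume x: "x \<in> S"
    then obtain c where c: "slice_chart M E0 S c" "x \<in> fst c"
      using S unfolding embedded_submanifold_def by blast
    then have "(fst c \<inter> S, snd c) \<in> charts (submfd M E0 S)" unfolding charts_submfd_iff by blast
    then show "x \<in> (\<Union>c\<in>charts (submfd M E0 S). fst c)" by (rule UN_I) (simp add: c(2) x)
  next
    fix x assume "x \<in> (\<Union>c\<in>charts (submfd M E0 S). fst c)"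
    then obtain c' where "c' \<in> charts (submfd M E0 S)" "x \<in> fst c'" by blast
    then show "x \<in> S" unfolding charts_submfd_iff by fastforce
  qed
  then show ?thesis unfolding smooth_manifold_def submfd_simps
    using submanifold_model(1) charts_submfd by simp
qed

lemma smooth_map_inclusion: "smooth_map (submfd M E0 S) M id"
  unfolding smooth_map_def submfd_simps
proof (intro conjI ballI)
  show "id ` S \<subseteq> pts M" using submanifold_model(3) by simp
  show "continuous_on S id" by (simp add: continuous_on_id')
  fix c' k assume c': "c' \<in> charts (submfd M E0 S)" and k: "k \<in> charts M"
  obtain c where c: "slice_chart M E0 S c" "c' = (fst c \<inter> S, snd c)"
    using c' unfolding charts_submfd_iff by blast
  show "smooth_on E0 (snd c' ` (fst c' \<inter> id -` fst k)) (snd k \<circ> id \<circ> coord_inv c')"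
    unfolding o_id c(2) fst_conv snd_conv
    by (rule slice_transition[OF c(1) manifold_chart(3)[OF M k]]) simp
qed

text \<open>In a slice chart the inclusion is the identity in coordinates, so a coordinate vector
  goes to the ambient vector with the same coordinates.\<close>

lemma dmap_inclusion:
  assumes c: "slice_chart M E0 S c" and x: "x \<in> fst c" "x \<in> S" and u: "u \<in> E0"
  shows "dmap (submfd M E0 S) M id x (coord_vec (submfd M E0 S) (fst c \<inter> S, snd c) x u) = coord_vec M c x u"
proof -
  let ?c = "(fst c \<inter> S, snd c)"
  have "dmap (submfd M E0 S) M id x (coord_vec (submfd M E0 S) ?c x u) =
      coord_vec M c (id x) (chart_deriv (submfd M E0 S) ?c (snd c \<circ> id) x u)"
    by (rule dmap_coord_vec[OF smooth_manifold_submfd M smooth_map_inclusion smooth_chart_submfd[OF c] slice_chart_smooth[OF c]])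
      (use x u in auto)
  moreover have "chart_deriv (submfd M E0 S) ?c (snd ?c) x u = u"
    by (rule chart_deriv_self[OF smooth_chart_submfd[OF c]]) (use x u submanifold_model in auto)
  ultimately show ?thesis by simp
qed

lemma slice_chart_at:
  assumes "x \<in> S" obtains c where "slice_chart M E0 S c" "x \<in> fst c"
  using S assms unfolding embedded_submanifold_def by blast

lemma dmap_inclusion_eq_0:
  assumes x: "x \<in> S" and u: "u \<in> E0" "dmap (submfd M E0 S) M id x u = 0"
  shows "u = 0"
proof -
  obtain c where c: "slice_chart M E0 S c" "x \<in> fst c" using slice_chart_at[OF x] .
  let ?c = "(fst c \<inter> S, snd c)"
  have sc: "smooth_chart (submfd M E0 S) ?c" "x \<in> fst ?c" using smooth_chart_submfd[OF c(1)] c(2) x by auto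
  obtain v where v: "v \<in> E0" "coord_vec (submfd M E0 S) ?c x v = u"
    using coord_vec_surj[OF smooth_manifold_submfd sc, of u] u(1) by auto
  have "coord_vec M c x v = 0" using dmap_inclusion[OF c x v(1)] v(2) u(2) by simp
  then have "v = 0"
    using coord_vec_eq_0[OF M slice_chart_smooth[OF c(1)] c(2), of v] v(1) submanifold_model(2) by blast
  then show ?thesis using v(2) linear_0[OF linear_coord_vec[OF smooth_manifold_submfd sc]] by simp
qed

end


subsection \<open>Submersions\<close>

text \<open>A right inverse R of A on its image is injective there, and R (A E) is a complement of
  the kernel in E.\<close>

lemma rank_nullity_on:
  fixes A :: "'e::euclidean_space \<Rightarrow> 'f::euclidean_space"
  assumes E: "subspace E" and A: "linear A"
  shows "dim {y \<in> E. A y = 0} + dim (A ` E) = dim E"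
proof -
  obtain R where R: "R ` UNIV \<subseteq> E" "linear R" "\<And>v. v \<in> A ` E \<Longrightarrow> A (R v) = v"
    using linear_exists_right_inverse_on[OF A E] by blast
  let ?K = "{y \<in> E. A y = 0}" and ?H = "R ` A ` E"
  have K: "subspace ?K"
    using E by (auto simp: subspace_def linear_0[OF A] linear_add[OF A] linear_scale[OF A])
  have AE: "subspace (A ` E)" by (rule linear_subspace_image[OF A E])
  have H: "subspace ?H" by (rule linear_subspace_image[OF R(2) AE])
  have inj: "inj_on R (A ` E)" by (rule inj_on_inverseI[of _ A]) (rule R(3))
  have sp: "span (A ` E) = A ` E" using AE by (rule span_eq_iff[THEN iffD2])
  have dH: "dim ?H = dim (A ` E)"
    by (rule dim_image_eq[OF R(2)]) (simp only: sp inj)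
  have "?K \<inter> ?H = {0}"
  proof (intro equalityI subsetI)
    fix y assume y: "y \<in> ?K \<inter> ?H"
    then obtain v where "v \<in> A ` E" "y = R v" by blast
    moreover from this have "v = 0" using y R(3)[of v] by simp
    ultimately show "y \<in> {0}" using linear_0[OF R(2)] by simp
  qed (use subspace_0[OF K] subspace_0[OF H] in simp)
  moreover have "{x + y |x y. x \<in> ?K \<and> y \<in> ?H} = E"
  proof (intro equalityI subsetI)
    fix z assume "z \<in> {x + y |x y. x \<in> ?K \<and> y \<in> ?H}"
    then show "z \<in> E" using R(1) subspace_add[OF E] by blast
  next
    fix z assume z: "z \<in> E"
    then have Az: "A z \<in> A ` E" by (rule imageI)
    have "z - R (A z) \<in> ?K"
      using z R(1) subspace_diff[OF E] R(3)[OF Az] by (auto simp: linear_diff[OF A])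
    moreover have "R (A z) \<in> ?H" using Az by (rule imageI)
    moreover have "z = (z - R (A z)) + R (A z)" by simp
    ultimately show "z \<in> {x + y |x y. x \<in> ?K \<and> y \<in> ?H}" by blast
  qed
  ultimately show ?thesis using dim_sums_Int[OF K H] dH by simp
qed

text \<open>Bases of K and of E0 are extended to bases of E and matched. This moves the kernel of a
  derivative, which varies with the point, onto the fixed model E0 of a submanifold.\<close>

lemma subspace_iso_within:
  fixes E :: "'e::euclidean_space set"
  assumes E: "subspace E" "subspace K" "subspace E0" "K \<subseteq> E" "E0 \<subseteq> E" and d: "dim K = dim E0"
  obtains T T' where "linear T" "linear T'" "\<And>y. y \<in> E \<Longrightarrow> T y \<in> E" "\<And>y. y \<in> E \<Longrightarrow> T' y \<in> E"
    "\<And>y. y \<in> E \<Longrightarrow> T' (T y) = y" "\<And>y. y \<in> E \<Longrightarrow> T (T' y) = y" "\<And>y. y \<in> E \<Longrightarrow> T y \<in> E0 \<longleftrightarrow> y \<in> K"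
proof -
  have basis: "\<exists>B0 B. B0 \<subseteq> B \<and> independent B \<and> span B = E \<and> span B0 = L \<and> card B0 = dim L \<and> card B = dim E \<and> finite B"
    if L: "subspace L" "L \<subseteq> E" for L
  proof -
    obtain B0 where B0: "B0 \<subseteq> L" "independent B0" "L \<subseteq> span B0" "card B0 = dim L"
      using basis_exists[of L] by blast
    obtain B where B: "B0 \<subseteq> B" "B \<subseteq> E" "independent B" "E \<subseteq> span B"
      using maximal_independent_subset_extend[of B0 E] B0 L(2) by blast
    have "span B = E" by (rule span_subspace[OF B(2,4) E(1)])
    moreover have "span B0 = L" by (rule span_subspace[OF B0(1,3) L(1)])
    moreover have "card B = dim E" by (rule basis_card_eq_dim[OF B(2,4,3)])
    ultimately show ?thesis using B(1,3) B0(4) independent_imp_finite[OF B(3)] by blast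
  qed
  obtain B0 B where B: "B0 \<subseteq> B" "independent B" "span B = E" "span B0 = K" "card B0 = dim K" "card B = dim E" "finite B"
    using basis[OF E(2,4)] by blast
  obtain C0 C where C: "C0 \<subseteq> C" "independent C" "span C = E" "span C0 = E0" "card C0 = dim E0" "card C = dim E" "finite C"
    using basis[OF E(3,5)] by blast
  have fin: "finite B0" "finite C0" using B(1,7) C(1,7) finite_subset by blast+
  obtain f1 where f1: "bij_betw f1 B0 C0"
    using finite_same_card_bij[OF fin] B(5) C(5) d by auto
  have "card (B - B0) = card (C - C0)"
    using card_Diff_subset[OF fin(1) B(1)] card_Diff_subset[OF fin(2) C(1)] B(5,6) C(5,6) d by simp
  then obtain f2 where f2: "bij_betw f2 (B - B0) (C - C0)"
    using finite_same_card_bij[OF finite_Diff[OF B(7)] finite_Diff[OF C(7)]] by blast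
  define h where "h x = (if x \<in> B0 then f1 x else f2 x)" for x
  have h1: "bij_betw h B0 C0" using f1 by (rule bij_betw_cong[THEN iffD1, rotated]) (simp add: h_def)
  have h2: "bij_betw h (B - B0) (C - C0)" using f2 by (rule bij_betw_cong[THEN iffD1, rotated]) (simp add: h_def)
  have "bij_betw h (B0 \<union> (B - B0)) (C0 \<union> (C - C0))" by (rule bij_betw_combine[OF h1 h2]) blast
  moreover have "B0 \<union> (B - B0) = B" "C0 \<union> (C - C0) = C" using B(1) C(1) by blast+
  ultimately have h: "bij_betw h B C" by simp
  obtain T where T: "linear T" "\<forall>x\<in>B. T x = h x" using linear_independent_extend[OF B(2)] by blast
  obtain T' where T': "linear T'" "\<forall>x\<in>C. T' x = inv_into B h x" using linear_independent_extend[OF C(2)] by blast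
  have TB: "T ` B = C" using T(2) bij_betw_imp_surj_on[OF h] by (metis image_cong)
  have TB0: "T ` B0 = C0" using T(2) B(1) bij_betw_imp_surj_on[OF h1] by (metis image_cong subsetD)
  have T'C: "T' ` C = B"
    using T'(2) bij_betw_imp_surj_on[OF bij_betw_inv_into[OF h]] by (metis image_cong)
  have TE: "T ` E = E" using linear_span_image[OF T(1), of B] B(3) C(3) TB by simp
  have TK: "T ` K = E0" using linear_span_image[OF T(1), of B0] B(4) C(4) TB0 by simp
  have T'E: "T' ` E = E" using linear_span_image[OF T'(1), of C] B(3) C(3) T'C by simp
  have T'T: "T' (T y) = y" if "y \<in> E" for y
  proof -
    have "(T' \<circ> T) x = id x" if "x \<in> B" for x
      using that T(2) T'(2) bij_betw_apply[OF h that] bij_betw_inv_into_left[OF h that] by simp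
    then have "(T' \<circ> T) y = id y"
      using linear_eq_on_span[OF linear_compose[OF T(1) T'(1)] linear_id, of B y] that B(3) by blast
    then show ?thesis by simp
  qed
  have TT': "T (T' y) = y" if "y \<in> E" for y
  proof -
    have "y \<in> T ` E" unfolding TE by (rule that)
    then obtain x where x: "x \<in> E" "y = T x" by (elim imageE)
    show ?thesis unfolding x(2) T'T[OF x(1)] ..
  qed
  show ?thesis
  proof (rule that[OF T(1) T'(1) _ _ T'T TT'])
    show "T y \<in> E" if "y \<in> E" for y using imageI[OF that, of T] unfolding TE .
    show "T' y \<in> E" if "y \<in> E" for y using imageI[OF that, of T'] unfolding T'E .
    show "T y \<in> E0 \<longleftrightarrow> y \<in> K" if "y \<in> E" for y
    proof
      assume "T y \<in> E0"
      then obtain x where "x \<in> K" "T y = T x" using TK by blast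
      then show "y \<in> K" using T'T[OF that] T'T[of x] E(4) by (metis subsetD)
    qed (use TK in blast)
  qed
qed

text \<open>In charts F is restricted to the affine slice \<open>j\<close> spanned by a right
  inverse R of its differential at x0. There the derivative of F is the identity on the model of N,
  so the restriction has a local inverse; the section is \<open>j\<close> after that
  inverse.\<close>

lemma submersion_section:
  fixes M :: "('m::{t2_space,second_countable_topology}, 'e::euclidean_space) mfd"
    and N :: "('m1::{t2_space,second_countable_topology}, 'e1::euclidean_space) mfd"
  assumes M: "smooth_manifold d M" and N: "smooth_manifold d' N" and F: "smooth_map M N F"
    and x0: "x0 \<in> pts M" "dmap M N F x0 ` model M = model N"
    and c: "smooth_chart N c" "F x0 \<in> fst c" and k: "smooth_chart M k" "x0 \<in> fst k"
  obtains V s where "openin (top_of_set (model N)) V" "snd c (F x0) \<in> V" "V \<subseteq> snd c ` fst c"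
    "smooth_on (model N) V s" "s ` V \<subseteq> snd k ` fst k" "s (snd c (F x0)) = snd k x0"
    "\<And>y. y \<in> V \<Longrightarrow> F (coord_inv k (s y)) = coord_inv c y"
proof -
  note EM = manifold_chart(1)[OF M] and EN = manifold_chart(1)[OF N]
  let ?U = "fst k \<inter> F -` fst c"
  let ?S = "snd k ` ?U" and ?f = "snd c \<circ> F \<circ> coord_inv k" and ?w0 = "snd c (F x0)"
  have U: "openin (top_of_set (pts M)) ?U"
    by (rule smooth_map_preimage_openin[OF F smooth_chartD(1)[OF k(1)] smooth_chartD(1)[OF c(1)]])
  have S: "openin (top_of_set (model M)) ?S" by (rule chart_image_openin[OF k(1) U Int_lower1])
  have smf: "smooth_on (model M) ?S ?f" by (rule smooth_map_charts[OF M N F k(1) c(1)])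
  have fS: "?f y \<in> snd c ` fst c" if "y \<in> ?S" for y using that coord_inv_snd[OF k(1)] by auto
  define A where "A = chart_deriv M k (snd c \<circ> F) x0"
  have cd: "chart_diff M k (snd c \<circ> F) x0" by (rule smooth_map_diff[OF M N F k(1) c(1) k(2) c(2)])
  have linA: "linear A" unfolding A_def by (rule linear_chart_deriv[OF cd])
  have A_in: "A u \<in> model N" if "u \<in> model M" for u
    unfolding A_def by (rule map_chain(2)[OF M N F k(1) c(1) k(2) c(2) transition_diff[OF N c(1,1,2,2)] that])
  have A_surj: "w \<in> A ` model M" if w: "w \<in> model N" for w
  proof -
    have "coord_vec N c (F x0) w \<in> dmap M N F x0 ` model M"
      using coord_vec_in[OF N c w] x0(2) by simp
    then obtain u' where u': "u' \<in> model M" "coord_vec N c (F x0) w = dmap M N F x0 u'" by blast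
    obtain u where u: "u \<in> model M" "coord_vec M k x0 u = u'" using coord_vec_surj[OF M k u'(1)] .
    have "coord_vec N c (F x0) w = coord_vec N c (F x0) (A u)"
      using u'(2) dmap_coord_vec[OF M N F k(1) c(1) k(2) c(2) u(1)] u(2) unfolding A_def by simp
    then have "coord_vec N c (F x0) (w - A u) = 0"
      by (simp add: linear_diff[OF linear_coord_vec[OF N c]])
    then have "w - A u = 0"
      by (rule coord_vec_eq_0[OF N c subspace_diff[OF EN w A_in[OF u(1)]]])
    then show ?thesis using u(1) by (intro image_eqI[of _ _ u]) auto
  qed
  obtain R where R: "R ` UNIV \<subseteq> model M" "linear R" "\<And>v. v \<in> A ` model M \<Longrightarrow> A (R v) = v"
    using linear_exists_right_inverse_on[OF linA EM] by blast
  have blR: "bounded_linear R" using R(2) linear_linear by blast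
  define j where "j w = snd k x0 + R (w - ?w0)" for w
  have smj: "smooth_on (model N) T j" for T unfolding j_def
    by (intro smooth_on_add smooth_on_const smooth_on_linear[OF blR] smooth_on_diff smooth_on_ident)
  have j_in: "j w \<in> model M" for w unfolding j_def
    by (rule subspace_add[OF EM chart_in_model[OF k]]) (use R(1) in blast)
  have j0: "j ?w0 = snd k x0" unfolding j_def by (simp add: linear_0[OF R(2)])
  define T where "T = model N \<inter> j -` ?S"
  have T: "openin (top_of_set (model N)) T" unfolding T_def
    by (rule continuous_openin_preimage[OF smooth_on_continuous[OF smj] _ S]) (simp add: j_in)
  have w0T: "?w0 \<in> T"
    unfolding T_def using chart_in_model[OF c] j0 k(2) c(2) by (auto intro!: imageI)
  have jT: "j ` T \<subseteq> ?S" unfolding T_def by blast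
  have smh: "smooth_on (model N) T (\<lambda>w. ?f (j w))"
    by (rule smooth_on_compose[OF EN T EM jT openin_imp_subset[OF S] smj smf])
  have him: "(\<lambda>w. ?f (j w)) ` T \<subseteq> model N"
    using jT fS openin_imp_subset[OF smooth_chartD(2)[OF c(1)]] by blast
  have dh: "((\<lambda>w. ?f (j w)) has_derivative (\<lambda>u. A (R u))) (at ?w0 within T)"
  proof -
    have "(j has_derivative (\<lambda>u. 0 + R (u - 0))) (at ?w0 within T)" unfolding j_def
      by (intro has_derivative_add has_derivative_const bounded_linear.has_derivative[OF blR]
          has_derivative_diff has_derivative_ident)
    then have d1: "(j has_derivative R) (at ?w0 within T)" by simp
    have d2: "(?f has_derivative A) (at (j ?w0) within j ` T)"
      unfolding j0 A_def
      by (rule has_derivative_subset[OF chart_diff_has_derivative[OF cd]]) (use j_in in blast)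
    show ?thesis by (rule has_derivative_in_compose[OF d1 d2])
  qed
  have inj: "u = 0" if "u \<in> model N" "A (R u) = 0" for u using R(3)[OF A_surj[OF that(1)]] that(2) by simp
  obtain U V g where g: "openin (top_of_set (model N)) U" "?w0 \<in> U" "U \<subseteq> T" "openin (top_of_set (model N)) V"
    "homeomorphism U V (\<lambda>w. ?f (j w)) g" "smooth_on (model N) V g"
    using smooth_inverse_function[OF EN T smh him w0T dh inj] by blast
  have hw0: "?f (j ?w0) = ?w0" using j0 coord_inv_snd[OF k] by simp
  have gT: "g y \<in> T" if "y \<in> V" for y using homeomorphism_image2[OF g(5)] g(3) that by blast
  have hg: "?f (j (g y)) = y" if "y \<in> V" for y using homeomorphism_apply2[OF g(5) that] .
  have w0V: "?w0 \<in> V" using homeomorphism_image1[OF g(5)] g(2) hw0 by (metis imageI)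
  have gw0: "g ?w0 = ?w0" using homeomorphism_apply1[OF g(5,2)] hw0 by simp
  show ?thesis
  proof (rule that[OF g(4) w0V])
    show "V \<subseteq> snd c ` fst c"
    proof
      fix y assume y: "y \<in> V"
      have "?f (j (g y)) \<in> snd c ` fst c" using gT[OF y] jT by (intro fS) blast
      then show "y \<in> snd c ` fst c" using hg[OF y] by simp
    qed
    show "smooth_on (model N) V (\<lambda>y. j (g y))" unfolding j_def
      by (intro smooth_on_add smooth_on_const smooth_on_linear[OF blR] smooth_on_diff g(6))
    show "(\<lambda>y. j (g y)) ` V \<subseteq> snd k ` fst k" using gT jT by blast
    show "j (g ?w0) = snd k x0" using gw0 j0 by simp
    fix y assume y: "y \<in> V"
    have "j (g y) \<in> ?S" using gT[OF y] jT by blast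
    then obtain x where x: "x \<in> ?U" "j (g y) = snd k x" by blast
    have kx: "coord_inv k (snd k x) = x" using coord_inv_snd[OF k(1)] x(1) by blast
    have "snd c (F x) = y" using hg[OF y] x(2) kx by simp
    then have "coord_inv c y = F x" using coord_inv_snd[OF c(1), of "F x"] x(1) by auto
    then show "F (coord_inv k (j (g y))) = coord_inv c y" using x(2) kx by simp
  qed
qed

text \<open>Turns the local diffeomorphisms given by the inverse function theorem into charts
  compatible with the atlas.\<close>

lemma smooth_chart_compose:
  fixes M :: "('m::{t2_space,second_countable_topology}, 'e::euclidean_space) mfd"
  assumes M: "smooth_manifold d M" and c: "smooth_chart M c"
    and T: "T \<subseteq> snd c ` fst c" "openin (top_of_set (model M)) T" "openin (top_of_set (model M)) T'"
    and G: "homeomorphism T T' G g" "smooth_on (model M) T G" "smooth_on (model M) T' g"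
  shows "smooth_chart M ({x \<in> fst c. snd c x \<in> T}, G \<circ> snd c)"
proof -
  let ?U = "{x \<in> fst c. snd c x \<in> T}"
  let ?c = "(?U, G \<circ> snd c)"
  note EM = manifold_chart(1)[OF M]
  have cU: "snd c ` ?U = T" using T(1) by blast
  have U: "openin (top_of_set (pts M)) ?U" by (rule chart_preimage_openin[OF c T(2,1)])
  have cT: "coord_inv c y \<in> ?U" "snd c (coord_inv c y) = y" if "y \<in> T" for y
    using that T(1) coord_inv_in[OF c] snd_coord_inv[OF c] by auto
  have hU: "homeomorphism ?U T (snd c) (coord_inv c)"
    by (rule homeomorphism_of_subsets[OF smooth_chartD(3)[OF c] _ T(1) cU]) blast
  have h0: "homeomorphism ?U T' (G \<circ> snd c) (coord_inv c \<circ> g)"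
    by (rule homeomorphism_compose[OF hU G(1)])
  have inv: "coord_inv ?c y = coord_inv c (g y)" if "y \<in> T'" for y
  proof -
    have i: "inj_on (G \<circ> snd c) ?U" by (rule inj_on_inverseI[of _ "coord_inv c \<circ> g"]) (rule homeomorphism_apply1[OF h0])
    have x: "(coord_inv c \<circ> g) y \<in> ?U" "(G \<circ> snd c) ((coord_inv c \<circ> g) y) = y"
      using homeomorphism_image2[OF h0] homeomorphism_apply2[OF h0 that] that by blast+
    have "inv_into ?U (G \<circ> snd c) y = (coord_inv c \<circ> g) y"
      using inv_into_f_f[OF i x(1)] unfolding x(2) .
    then show ?thesis by (simp add: coord_inv_def[of ?c])
  qed
  have im: "(G \<circ> snd c) ` ?U = T'" by (rule homeomorphism_image1[OF h0])
  have h: "homeomorphism ?U T' (G \<circ> snd c) (coord_inv ?c)"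
    by (rule homeomorphism_cong[OF h0]) (simp_all add: inv)
  have tr: "smooth_transition (model M) ?c k \<and> smooth_transition (model M) k ?c" if k: "k \<in> charts M" for k
  proof
    have sk: "smooth_chart M k" by (rule manifold_chart(3)[OF M k])
    have oV: "openin (top_of_set (pts M)) (?U \<inter> fst k)" by (rule openin_Int[OF U smooth_chartD(1)[OF sk]])
    let ?V = "?U \<inter> fst k"
    have V1: "openin (top_of_set (model M)) (snd c ` ?V)" by (rule chart_image_openin[OF c oV]) blast
    have "snd c ` ?V \<subseteq> T" by blast
    then have "openin (top_of_set T) (snd c ` ?V)"
      by (rule openin_subset_trans[OF V1 _ openin_imp_subset[OF T(2)]])
    from homeomorphism_imp_open_map[OF G(1) this]
    have V2: "openin (top_of_set (model M)) (G ` snd c ` ?V)" by (rule openin_trans[OF _ T(3)])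
    have V2T: "G ` snd c ` ?V \<subseteq> T'" using homeomorphism_image1[OF G(1)] by blast
    have gV: "g ` G ` snd c ` ?V \<subseteq> snd c ` (fst c \<inter> fst k)"
      using homeomorphism_apply1[OF G(1)] by auto
    have "smooth_on (model M) (G ` snd c ` ?V) (\<lambda>y. (snd k \<circ> coord_inv c) (g y))"
      by (rule smooth_on_compose[OF EM V2 EM gV _ smooth_on_mono[OF G(3) order_refl V2T]
            smooth_transition_charts[OF M c sk]])
        (use chart_in_model[OF c] in blast)
    then have "smooth_on (model M) (G ` snd c ` ?V) (snd k \<circ> coord_inv ?c)"
    proof (rule smooth_on_transform)
      fix y assume "y \<in> G ` snd c ` ?V"
      then have "y \<in> T'" using V2T by blast
      then show "(snd k \<circ> coord_inv c) (g y) = (snd k \<circ> coord_inv ?c) y" using inv by simp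
    qed
    then show "smooth_transition (model M) ?c k"
      unfolding smooth_transition_def fst_conv snd_conv image_comp[symmetric] .
    have V3: "openin (top_of_set (model M)) (snd k ` (fst k \<inter> ?U))"
      by (rule chart_image_openin[OF sk openin_Int[OF smooth_chartD(1)[OF sk] U] Int_lower1])
    have "smooth_on (model M) (snd k ` (fst k \<inter> ?U)) (\<lambda>y. G ((snd c \<circ> coord_inv k) y))"
    proof (rule smooth_on_compose[OF EM V3 EM _ openin_imp_subset[OF T(2)] _ G(2)])
      show "(snd c \<circ> coord_inv k) ` snd k ` (fst k \<inter> ?U) \<subseteq> T"
        using coord_inv_snd[OF sk] by auto
      show "smooth_on (model M) (snd k ` (fst k \<inter> ?U)) (snd c \<circ> coord_inv k)"
        by (rule smooth_on_mono[OF smooth_transition_charts[OF M sk c] order_refl]) blast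
    qed
    then show "smooth_transition (model M) k ?c"
      unfolding smooth_transition_def fst_conv snd_conv by (simp add: o_def)
  qed
  show ?thesis
    unfolding smooth_chart_def fst_conv snd_conv im using U T(3) h tr by blast
qed

text \<open>The regular value theorem for a map into the affine space b + H. In the application H is
  the hyperplane b_1 = 0, which contains all values of \<open>fbar\<close>, so that its differential
  is onto H and not onto R^n. Any E0 of the dimension of the kernel can serve as model.\<close>

lemma level_set_submanifold:
  fixes N :: "('m::{t2_space,second_countable_topology}, 'e::euclidean_space) mfd"
    and h :: "'m \<Rightarrow> 'f::euclidean_space"
  assumes N: "smooth_manifold d N" and h: "smooth_fun N h"
    and H: "subspace H" "\<And>z. z \<in> pts N \<Longrightarrow> h z - b \<in> H"
      "\<And>z. z \<in> pts N \<Longrightarrow> h z = b \<Longrightarrow> dfun N h z ` model N = H"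
    and E0: "subspace E0" "E0 \<subseteq> model N" "dim E0 + dim H = dim (model N)"
  shows "embedded_submanifold N E0 {z \<in> pts N. h z = b}"
proof -
  let ?F = "{z \<in> pts N. h z = b}"
  note EN = manifold_chart(1)[OF N]
  have "\<exists>c1. slice_chart N E0 ?F c1 \<and> z0 \<in> fst c1" if z0: "z0 \<in> ?F" for z0
  proof -
    have zN: "z0 \<in> pts N" using z0 by simp
    define c where "c = chart_at N z0"
    have c: "smooth_chart N c" "z0 \<in> fst c" unfolding c_def using chart_at[OF N zN] by blast+
    let ?S = "snd c ` fst c"
    define G where "G = h \<circ> coord_inv c"
    have S: "openin (top_of_set (model N)) ?S" by (rule smooth_chartD(2)[OF c(1)])
    have smG: "smooth_on (model N) ?S G" unfolding G_def by (rule smooth_fun_chart[OF N h c(1)])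
    define A where "A = chart_deriv N c h z0"
    have A_dfun: "A = dfun N h z0" unfolding A_def c_def by (rule dfun_eq[OF N zN, symmetric])
    have cd: "chart_diff N c h z0" by (rule smooth_fun_diff[OF N h c])
    have linA: "linear A" unfolding A_def by (rule linear_chart_deriv[OF cd])
    have AE: "A ` model N = H" unfolding A_dfun using H(3) z0 by blast
    have dG: "(G has_derivative A) (at (snd c z0) within ?S)"
      using chart_diff_has_derivative[OF cd]
      unfolding G_def A_def at_chart[OF c(1) smooth_chartD(1)[OF c(1)] order_refl c(2)] .
    obtain R where R: "R ` UNIV \<subseteq> model N" "linear R" "\<And>v. v \<in> A ` model N \<Longrightarrow> A (R v) = v"
      using linear_exists_right_inverse_on[OF linA EN] by blast
    have RE: "R v \<in> model N" for v using R(1) by blast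
    have blA: "bounded_linear A" and blR: "bounded_linear R" using linA R(2) linear_linear by blast+
    \<comment> \<open>A \<kappa> = G - b, and the derivative of \<kappa> at z0 is the identity. In
      the coordinates \<kappa> the level set is thus given by the linear equation A = 0; the map T
      below carries this kernel to E0.\<close>
    define \<kappa> where "\<kappa> y = R (G y - b) + (y - R (A y))" for y
    have sm\<kappa>: "smooth_on (model N) ?S \<kappa>" unfolding \<kappa>_def
      by (intro smooth_on_add smooth_on_diff smooth_on_linear[OF blR] smooth_on_linear[OF blA] smG
          smooth_on_const smooth_on_ident)
    have SE: "?S \<subseteq> model N" using chart_in_model[OF c(1)] by blast
    have \<kappa>E: "\<kappa> y \<in> model N" if "y \<in> ?S" for y unfolding \<kappa>_def
      by (intro subspace_add[OF EN] subspace_diff[OF EN] RE) (use that SE in blast)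
    have Gb: "G y - b \<in> H" if "y \<in> ?S" for y
      unfolding G_def o_def by (rule H(2)[OF smooth_chart_pts[OF c(1) coord_inv_in[OF c(1) that]]])
    have A\<kappa>: "A (\<kappa> y) = G y - b" if y: "y \<in> ?S" for y
    proof -
      have "A (R (G y - b)) = G y - b" by (rule R(3)) (use AE Gb[OF y] in simp)
      moreover have "A (R (A y)) = A y" by (rule R(3)) (use y SE in blast)
      ultimately show ?thesis unfolding \<kappa>_def by (simp add: linear_add[OF linA] linear_diff[OF linA])
    qed
    have "(\<kappa> has_derivative (\<lambda>u. R (A u - 0) + (u - R (A u)))) (at (snd c z0) within ?S)" unfolding \<kappa>_def
      by (intro has_derivative_add has_derivative_diff has_derivative_ident has_derivative_const
        bounded_linear.has_derivative[OF blR] bounded_linear.has_derivative[OF blA] dG)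
    then have d\<kappa>: "(\<kappa> has_derivative (\<lambda>u. u)) (at (snd c z0) within ?S)" by simp
    have \<kappa>im: "\<kappa> ` ?S \<subseteq> model N" using \<kappa>E by blast
    have z0S: "snd c z0 \<in> ?S" using c(2) by (rule imageI)
    obtain U V g where g: "openin (top_of_set (model N)) U" "snd c z0 \<in> U" "U \<subseteq> ?S"
      "openin (top_of_set (model N)) V" "homeomorphism U V \<kappa> g" "smooth_on (model N) V g"
      using smooth_inverse_function[OF EN S sm\<kappa> \<kappa>im z0S d\<kappa>] by blast
    let ?K = "{y \<in> model N. A y = 0}"
    have K: "subspace ?K"
      using EN by (auto simp: subspace_def linear_0[OF linA] linear_add[OF linA] linear_scale[OF linA])
    have dK: "dim ?K = dim E0" using rank_nullity_on[OF EN linA] AE E0(3) by simp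
    obtain T T' where T: "linear T" "linear T'" "\<And>y. y \<in> model N \<Longrightarrow> T y \<in> model N"
      "\<And>y. y \<in> model N \<Longrightarrow> T' y \<in> model N"
      "\<And>y. y \<in> model N \<Longrightarrow> T' (T y) = y" "\<And>y. y \<in> model N \<Longrightarrow> T (T' y) = y"
      "\<And>y. y \<in> model N \<Longrightarrow> T y \<in> E0 \<longleftrightarrow> y \<in> ?K"
      using subspace_iso_within[OF EN K E0(1) _ E0(2) dK] by blast
    have blT: "bounded_linear T" "bounded_linear T'" using T(1,2) linear_linear by blast+
    have VE: "V \<subseteq> model N" by (rule openin_imp_subset[OF g(4)])
    have hT: "homeomorphism V (T ` V) T T'" unfolding homeomorphism_def
    proof (intro conjI ballI)
      show "continuous_on V T" "continuous_on (T ` V) T'"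
        using blT linear_continuous_on by blast+
      show "T' ` T ` V = V" unfolding image_image using T(5) VE by (metis (no_types, lifting) image_cong image_ident subsetD)
    qed (use T(5) VE in auto)
    have TV: "T ` V = model N \<inter> T' -` V"
    proof (intro equalityI subsetI)
      fix y assume "y \<in> model N \<inter> T' -` V"
      then show "y \<in> T ` V" using T(6) by (intro image_eqI[of _ _ "T' y"]) auto
    next
      fix y assume "y \<in> T ` V"
      then show "y \<in> model N \<inter> T' -` V" using T(3,5) VE by auto
    qed
    have oTV: "openin (top_of_set (model N)) (T ` V)" unfolding TV
      by (rule continuous_openin_preimage[OF linear_continuous_on[OF blT(2)] _ g(4)]) (use T(4) in blast)
    let ?G = "T \<circ> \<kappa>"
    define c1 where "c1 = ({x \<in> fst c. snd c x \<in> U}, ?G \<circ> snd c)"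
    have s1: "smooth_chart N c1" unfolding c1_def
    proof (rule smooth_chart_compose[OF N c(1) g(3,1) oTV homeomorphism_compose[OF g(5) hT]])
      show "smooth_on (model N) U (T \<circ> \<kappa>)" unfolding o_def
        by (rule smooth_on_linear[OF blT(1) smooth_on_mono[OF sm\<kappa> order_refl g(3)]])
      show "smooth_on (model N) (T ` V) (g \<circ> T')" unfolding o_def
        by (rule smooth_on_compose[OF EN oTV EN _ VE smooth_on_linear[OF blT(2) smooth_on_ident] g(6)])
          (use TV in blast)
    qed
    have iff: "snd c1 x \<in> E0 \<longleftrightarrow> x \<in> ?F" if x: "x \<in> fst c1" for x
    proof -
      have xc: "x \<in> fst c" "snd c x \<in> ?S" using x unfolding c1_def by auto
      have "snd c1 x \<in> E0 \<longleftrightarrow> \<kappa> (snd c x) \<in> ?K"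
        unfolding c1_def snd_conv o_def by (rule T(7)[OF \<kappa>E[OF xc(2)]])
      also have "\<dots> \<longleftrightarrow> G (snd c x) - b = 0" using \<kappa>E[OF xc(2)] A\<kappa>[OF xc(2)] by simp
      also have "\<dots> \<longleftrightarrow> x \<in> ?F"
        unfolding G_def using coord_inv_snd[OF c(1) xc(1)] smooth_chart_pts[OF c(1) xc(1)] by simp
      finally show ?thesis .
    qed
    have "slice_chart N E0 ?F c1" unfolding slice_chart_def using s1 iff by blast
    moreover have "z0 \<in> fst c1" unfolding c1_def using c(2) g(2) by simp
    ultimately show ?thesis by blast
  qed
  then show ?thesis unfolding embedded_submanifold_def using E0 by auto
qed


section \<open>Symplectic linear algebra\<close>

lemma inner_onb_sum:
  assumes E: "subspace E" and b: "b \<in> onb E"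
  shows "(\<Sum>e\<in>onb E. c e *\<^sub>R e) \<bullet> b = c b"
proof -
  note B = onb[OF E]
  have "(\<Sum>e\<in>onb E. c e *\<^sub>R e) \<bullet> b = (\<Sum>e\<in>onb E. if e = b then c b else 0)"
    unfolding inner_sum_left
  proof (intro sum.cong refl)
    fix e assume e: "e \<in> onb E"
    show "(c e *\<^sub>R e) \<bullet> b = (if e = b then c b else 0)"
      using B(2,3)[unfolded pairwise_def orthogonal_def] e b by (auto simp: norm_eq_1)
  qed
  also have "\<dots> = c b" using b B(6) by simp
  finally show ?thesis .
qed

lemma linear_on_subspace_expand:
  assumes E: "subspace E" and l: "linear_on_subspace E l" and u: "u \<in> E"
  shows "l u = (\<Sum>b\<in>onb E. (u \<bullet> b) * l b)"
proof -
  have lin: "linear (\<lambda>x. l (orth_proj E x))" by (rule linear_on_subspace_orth_proj[OF E l])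
  have b: "l (orth_proj E b) = l b" if "b \<in> onb E" for b
    using orth_proj_eq[OF E, of b] onb(1)[OF E] that by auto
  have "l u = l (orth_proj E (\<Sum>b\<in>onb E. (u \<bullet> b) *\<^sub>R b))"
    using onb_expand[OF E u] orth_proj_eq[OF E u] by simp
  also have "\<dots> = (\<Sum>b\<in>onb E. (u \<bullet> b) * l b)"
    using b by (simp add: linear_sum[OF lin] linear_scale[OF lin])
  finally show ?thesis .
qed

lemma linear_on_subspaceD:
  assumes "linear_on_subspace E l" "subspace E" "u \<in> E" "v \<in> E"
  shows "l (u + v) = l u + l v" "l (r *\<^sub>R u) = r * l u" "l (u - v) = l u - l v" "l 0 = 0"
proof -
  have l: "l (r *\<^sub>R u + s *\<^sub>R v) = r * l u + s * l v" for r s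
    using assms unfolding linear_on_subspace_def by blast
  show "l (u + v) = l u + l v" "l (r *\<^sub>R u) = r * l u" "l (u - v) = l u - l v" "l 0 = 0"
    using l[of 1 1] l[of r 0] l[of 1 "-1"] l[of 0 0] by simp_all
qed

lemma linear_imp_linear_on_subspace: "linear l \<Longrightarrow> linear_on_subspace E l"
  unfolding linear_on_subspace_def by (simp add: linear_add linear_scale)

lemma linear_scaleR_of:
  fixes f :: "'a::real_vector \<Rightarrow> real"
  assumes "linear f" shows "linear (\<lambda>x. f x *\<^sub>R b)"
  by (rule linearI) (simp_all add: linear_add[OF assms] linear_scale[OF assms] scaleR_left_distrib)

locale symplectic_subspace =
  fixes E :: "'e::euclidean_space set" and om :: "'e \<Rightarrow> 'e \<Rightarrow> real"
  assumes E: "subspace E"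
    and lin: "\<And>v. v \<in> E \<Longrightarrow> linear_on_subspace E (\<lambda>u. om u v)"
    and anti: "\<And>u v. u \<in> E \<Longrightarrow> v \<in> E \<Longrightarrow> om u v = - om v u"
    and nondeg: "\<And>u. u \<in> E \<Longrightarrow> (\<And>v. v \<in> E \<Longrightarrow> om u v = 0) \<Longrightarrow> u = 0"
begin

lemma lin2: "v \<in> E \<Longrightarrow> linear_on_subspace E (\<lambda>u. om v u)"
  unfolding linear_on_subspace_def
proof (intro ballI allI)
  fix u w r s assume v: "v \<in> E" and uw: "u \<in> E" "w \<in> E"
  have "om (r *\<^sub>R u + s *\<^sub>R w) v = r * om u v + s * om w v"
    using lin[OF v] uw unfolding linear_on_subspace_def by blast
  then show "om v (r *\<^sub>R u + s *\<^sub>R w) = r * om v u + s * om v w"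
    using anti[OF v uw(1)] anti[OF v uw(2)] anti[OF v subspace_add[OF E subspace_scale[OF E uw(1)] subspace_scale[OF E uw(2)]], of r s]
    by simp
qed

lemma dual_unique:
  assumes "v \<in> E" "v' \<in> E" "\<And>u. u \<in> E \<Longrightarrow> om v u = om v' u"
  shows "v = v'"
proof -
  have "v - v' = 0"
  proof (rule nondeg[OF subspace_diff[OF E assms(1,2)]])
    show "om (v - v') u = 0" if "u \<in> E" for u
      using linear_on_subspaceD(3)[OF lin[OF that] E assms(1,2)] assms(3)[OF that] by simp
  qed
  then show ?thesis by simp
qed

text \<open>\<open>J v\<close> is the vector of coordinates of om(v, .) in the orthonormal basis.
  Nondegeneracy makes J injective on E, hence onto by dimension, and v is the preimage of the
  coordinates of l.\<close>

lemma dual_exists: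
  assumes l: "linear_on_subspace E l"
  shows "\<exists>v\<in>E. \<forall>u\<in>E. om v u = l u"
proof -
  have BE: "b \<in> E" if "b \<in> onb E" for b using onb(1)[OF E] that by blast
  define J where "J v = (\<Sum>b\<in>onb E. om (orth_proj E v) b *\<^sub>R b)" for v
  have "linear J" unfolding J_def
    by (intro linear_compose_sum ballI linear_scaleR_of linear_on_subspace_orth_proj[OF E lin[OF BE]])
  have J_in: "J v \<in> E" for v unfolding J_def
    by (rule subspace_sum[OF E], rule subspace_scale[OF E], rule BE)
  have Jb: "J v \<bullet> b = om v b" if "v \<in> E" "b \<in> onb E" for v b
    unfolding J_def using inner_onb_sum[OF E that(2)] orth_proj_eq[OF E that(1)] by simp
  have inj: "v = 0" if v: "v \<in> E" "J v = 0" for v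
  proof (rule nondeg[OF v(1)])
    fix u assume u: "u \<in> E"
    show "om v u = 0"
      unfolding linear_on_subspace_expand[OF E lin2[OF v(1)] u]
      using Jb[OF v(1)] v(2) by (intro sum.neutral ballI) simp
  qed
  have inj_J: "inj_on J E"
  proof (rule inj_onI)
    fix x y assume xy: "x \<in> E" "y \<in> E" "J x = J y"
    then have "J (x - y) = 0" using linear_diff[OF \<open>linear J\<close>] by simp
    then show "x = y" using inj[OF subspace_diff[OF E xy(1,2)]] by simp
  qed
  have sp: "span E = E" using E by (rule span_eq_iff[THEN iffD2])
  have "dim (J ` E) = dim E" by (rule dim_image_eq[OF \<open>linear J\<close>]) (simp only: sp inj_J)
  then have JE: "J ` E = E"
    using subspace_dim_equal[OF linear_subspace_image[OF \<open>linear J\<close> E] E] J_in by auto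
  have "(\<Sum>b\<in>onb E. l b *\<^sub>R b) \<in> E" by (rule subspace_sum[OF E], rule subspace_scale[OF E], rule BE)
  then have "(\<Sum>b\<in>onb E. l b *\<^sub>R b) \<in> J ` E" unfolding JE .
  then obtain v where v: "v \<in> E" "(\<Sum>b\<in>onb E. l b *\<^sub>R b) = J v" by (elim imageE)
  have vb: "om v b = l b" if "b \<in> onb E" for b
    using Jb[OF v(1) that] inner_onb_sum[OF E that, of l] v(2) by simp
  have "om v u = l u" if "u \<in> E" for u
    unfolding linear_on_subspace_expand[OF E lin2[OF v(1)] that] linear_on_subspace_expand[OF E l that]
    using vb by simp
  then show ?thesis using v(1) by blast
qed

text \<open>A Lagrangian subspace, given as the kernel of \<open>A\<close>, is isomorphic to the dual of the quotient.\<close>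

lemma lagrangian_kernel:
  fixes A :: "'e \<Rightarrow> 'f::euclidean_space"
  assumes A: "linear A" "A ` E = UNIV" and d: "dim E = 2 * DIM('f)"
    and iso: "\<And>u v. u \<in> E \<Longrightarrow> v \<in> E \<Longrightarrow> A u = 0 \<Longrightarrow> A v = 0 \<Longrightarrow> om u v = 0"
  shows "v \<in> E \<Longrightarrow> A v = 0 \<Longrightarrow> \<exists>c. \<forall>u\<in>E. om v u = c \<bullet> A u"
    and "\<exists>v\<in>E. A v = 0 \<and> (\<forall>u\<in>E. om v u = c \<bullet> A u)"
proof -
  obtain R where R: "R ` UNIV \<subseteq> E" "linear R" "\<And>z. A (R z) = z"
    using linear_exists_right_inverse_on[OF A(1) E] A(2) by blast
  have RE: "R z \<in> E" for z using R(1) by blast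
  let ?K = "{y \<in> E. A y = 0}"
  have K: "subspace ?K"
    using E by (auto simp: subspace_def linear_0[OF A(1)] linear_add[OF A(1)] linear_scale[OF A(1)])
  define L where "L v = (\<Sum>b\<in>Basis. om (orth_proj E v) (R b) *\<^sub>R b)" for v
  have linL: "linear L" unfolding L_def
    by (intro linear_compose_sum ballI linear_scaleR_of linear_on_subspace_orth_proj[OF E lin[OF RE]])
  \<comment> \<open>For v in the kernel om(v, .) factors through A: the vector u - R (A u) also lies
    in the kernel, so isotropy kills it. \<open>L v\<close> represents the induced functional. L is
    injective by nondegeneracy, and the kernel has exactly the dimension of the target.\<close>
  have L: "om v u = L v \<bullet> A u" if v: "v \<in> ?K" and u: "u \<in> E" for v u
  proof -
    have vE: "v \<in> E" using v by simp
    have "A v = 0" using v by simp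
    moreover have "A (u - R (A u)) = 0" by (simp add: linear_diff[OF A(1)] R(3))
    ultimately have "om v (u - R (A u)) = 0" by (rule iso[OF vE subspace_diff[OF E u RE]])
    then have "om v u = om v (R (A u))" using linear_on_subspaceD(3)[OF lin2[OF vE] E u RE] by simp
    moreover have "om v (R z) = L v \<bullet> z" for z
    proof -
      have lv: "linear (\<lambda>x. om v (orth_proj E x))" by (rule linear_on_subspace_orth_proj[OF E lin2[OF vE]])
      have "om v (R z) = om v (orth_proj E (R (\<Sum>b\<in>Basis. (z \<bullet> b) *\<^sub>R b)))"
        using orth_proj_eq[OF E RE] by (simp add: euclidean_representation)
      also have "\<dots> = (\<Sum>b\<in>Basis. (z \<bullet> b) * om v (R b))"
        using orth_proj_eq[OF E RE]
        by (simp add: linear_sum[OF R(2)] linear_scale[OF R(2)] linear_sum[OF lv] linear_scale[OF lv])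
      also have "\<dots> = L v \<bullet> z"
        unfolding L_def orth_proj_eq[OF E vE] inner_sum_left
        by (intro sum.cong refl) (simp add: inner_commute mult.commute)
      finally show ?thesis .
    qed
    ultimately show ?thesis by simp
  qed
  show "\<exists>c. \<forall>u\<in>E. om v u = c \<bullet> A u" if "v \<in> E" "A v = 0"
    using L[of v] that by blast
  have inj: "v = 0" if v: "v \<in> ?K" "L v = 0" for v
    by (rule nondeg) (use v L[OF v(1)] in auto)
  have inj_L: "inj_on L ?K"
  proof (rule inj_onI)
    fix x y assume xy: "x \<in> ?K" "y \<in> ?K" "L x = L y"
    then have "L (x - y) = 0" using linear_diff[OF linL] by simp
    then show "x = y" using inj[OF subspace_diff[OF K xy(1,2)]] by simp
  qed
  have sp: "span ?K = ?K" using K by (rule span_eq_iff[THEN iffD2])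
  have "dim (L ` ?K) = dim ?K" by (rule dim_image_eq[OF linL]) (simp only: sp inj_L)
  moreover have "dim ?K = DIM('f)" using rank_nullity_on[OF E A(1)] A(2) d by simp
  ultimately have "L ` ?K = UNIV"
    using subspace_dim_equal[OF linear_subspace_image[OF linL K] subspace_UNIV] by simp
  then have "c \<in> L ` ?K" by simp
  then obtain v where "v \<in> ?K" "c = L v" by (elim imageE)
  then show "\<exists>v\<in>E. A v = 0 \<and> (\<forall>u\<in>E. om v u = c \<bullet> A u)" using L by blast
qed

end


section \<open>Symplectic manifolds and circle actions\<close>

lemma smooth_fun_linear:
  "bounded_linear L \<Longrightarrow> smooth_fun M h \<Longrightarrow> smooth_fun M (\<lambda>y. L (h y))"
  unfolding smooth_fun_def o_def by (rule ballI, rule smooth_on_linear, assumption, erule bspec)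

lemma dfun_linear:
  fixes M :: "('m::{t2_space,second_countable_topology}, 'e::euclidean_space) mfd"
  assumes M: "smooth_manifold d M" and L: "bounded_linear L" and h: "smooth_fun M h"
    and x: "x \<in> pts M" and u: "u \<in> model M"
  shows "dfun M (\<lambda>y. L (h y)) x u = L (dfun M h x u)"
proof -
  note c = chart_at[OF M x]
  have "((\<lambda>y. L (h y)) \<circ> coord_inv (chart_at M x) has_derivative (\<lambda>u. L (chart_deriv M (chart_at M x) h x u)))
      (at (snd (chart_at M x) x) within model M)"
    using bounded_linear.has_derivative[OF L chart_diff_has_derivative[OF smooth_fun_diff[OF M h c(3,2)]]]
    unfolding o_def .
  from chart_deriv_eq(2)[OF manifold_chart(1)[OF M] chart_in_model[OF c(3,2)] u this]
  show ?thesis unfolding dfun_eq[OF M x] .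
qed

context
  fixes X :: "('a::{t2_space,second_countable_topology}, 'e::euclidean_space) mfd" and \<omega> and d :: nat
  assumes X: "symplectic_manifold d X \<omega>"
begin

lemma symplectic_mfd: "smooth_manifold d X"
  using X unfolding symplectic_manifold_def by simp

lemma symplectic_subspace_at: assumes "x \<in> pts X" shows "symplectic_subspace (model X) (\<omega> x)"
proof
  show "subspace (model X)" by (rule manifold_chart(1)[OF symplectic_mfd])
  have t: "two_form X \<omega>" using X unfolding symplectic_manifold_def closed_two_form_def by simp
  show "linear_on_subspace (model X) (\<lambda>u. \<omega> x u v)" if "v \<in> model X" for v
    using t assms that unfolding two_form_def by simp
  show "\<omega> x u v = - \<omega> x v u" if "u \<in> model X" "v \<in> model X" for u v
    using t assms that unfolding two_form_def by blast
  show "u = 0" if "u \<in> model X" "\<And>v. v \<in> model X \<Longrightarrow> \<omega> x u v = 0" for u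
    using X assms that unfolding symplectic_manifold_def by blast
qed

lemma closed_form_on_chart:
  assumes c: "c \<in> charts X"
  shows "closed_form_on_subspace (model X) (snd c ` fst c) (\<lambda>y u v. coeff2 X \<omega> c u v y)"
proof
  note XM = symplectic_mfd
  have sc: "smooth_chart X c" by (rule manifold_chart(3)[OF XM c])
  show "subspace (model X)" by (rule manifold_chart(1)[OF XM])
  show "openin (top_of_set (model X)) (snd c ` fst c)" by (rule smooth_chartD(2)[OF sc])
  have cl: "closed_two_form X \<omega>" using X unfolding symplectic_manifold_def by simp
  then have t: "two_form X \<omega>" unfolding closed_two_form_def by simp
  show "smooth_on (model X) (snd c ` fst c) (\<lambda>y. coeff2 X \<omega> c u v y)" if "u \<in> model X" "v \<in> model X" for u v
    using t c that unfolding two_form_def by simp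
  show "frechet_derivative (\<lambda>y. coeff2 X \<omega> c v w y) (at y within snd c ` fst c) u
      + frechet_derivative (\<lambda>y. coeff2 X \<omega> c w u y) (at y within snd c ` fst c) v
      + frechet_derivative (\<lambda>y. coeff2 X \<omega> c u v y) (at y within snd c ` fst c) w = 0"
    if "y \<in> snd c ` fst c" "u \<in> model X" "v \<in> model X" "w \<in> model X" for y u v w
    using cl c that unfolding closed_two_form_def by blast
  fix y v assume y: "y \<in> snd c ` fst c" and v: "v \<in> model X"
  let ?x = "coord_inv c y"
  have xc: "?x \<in> fst c" by (rule coord_inv_in[OF sc y])
  interpret symplectic_subspace "model X" "\<omega> ?x"
    by (rule symplectic_subspace_at[OF smooth_chart_pts[OF sc xc]])
  note cv = coord_vec_in[OF XM sc xc] and lcv = linear_coord_vec[OF XM sc xc]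
  show "linear_on_subspace (model X) (\<lambda>u. coeff2 X \<omega> c u v y)"
    unfolding linear_on_subspace_def coeff2_def Let_def
  proof (intro ballI allI)
    fix u w r s assume uw: "u \<in> model X" "w \<in> model X"
    show "\<omega> ?x (coord_vec X c ?x (r *\<^sub>R u + s *\<^sub>R w)) (coord_vec X c ?x v) =
      r * \<omega> ?x (coord_vec X c ?x u) (coord_vec X c ?x v) + s * \<omega> ?x (coord_vec X c ?x w) (coord_vec X c ?x v)"
      using lin[OF cv[OF v]] cv[OF uw(1)] cv[OF uw(2)]
      unfolding linear_on_subspace_def linear_add[OF lcv] linear_scale[OF lcv] by blast
  qed
  show "coeff2 X \<omega> c u v y = - coeff2 X \<omega> c v u y" if "u \<in> model X" for u
    unfolding coeff2_def Let_def by (rule anti[OF cv[OF that] cv[OF v]])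
qed

lemma ham_vf:
  assumes h: "smooth_fun X h" and x: "x \<in> pts X"
  shows "ham_vf X \<omega> h x \<in> model X" "u \<in> model X \<Longrightarrow> \<omega> x (ham_vf X \<omega> h x) u = dfun X h x u"
    "v \<in> model X \<Longrightarrow> (\<And>u. u \<in> model X \<Longrightarrow> \<omega> x v u = dfun X h x u) \<Longrightarrow> ham_vf X \<omega> h x = v"
proof -
  interpret symplectic_subspace "model X" "\<omega> x" by (rule symplectic_subspace_at[OF x])
  let ?Q = "\<lambda>v. v \<in> model X \<and> (\<forall>u\<in>model X. \<omega> x v u = dfun X h x u)"
  have ex: "\<exists>v. ?Q v"
    using dual_exists[OF linear_imp_linear_on_subspace[OF linear_dfun[OF symplectic_mfd h x]]] by blast
  have uq: "v = v'" if "?Q v" "?Q v'" for v v' by (rule dual_unique) (use that in simp_all)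
  have "\<exists>!v. ?Q v" using ex uq by (rule ex_ex1I)
  then have "?Q (ham_vf X \<omega> h x)" unfolding ham_vf_def by (rule theI')
  then show "ham_vf X \<omega> h x \<in> model X" "u \<in> model X \<Longrightarrow> \<omega> x (ham_vf X \<omega> h x) u = dfun X h x u" for u
    by simp_all
  show "ham_vf X \<omega> h x = v" if "v \<in> model X" "\<And>u. u \<in> model X \<Longrightarrow> \<omega> x v u = dfun X h x u"
    by (rule uq[OF \<open>?Q (ham_vf X \<omega> h x)\<close>]) (use that in simp)
qed

text \<open>The tangent spaces of a Lagrangian level set fill the kernel of the differential, by dimension.\<close>

lemma lagrangian_fibre_isotropic:
  fixes g :: "'a \<Rightarrow> real^'n"
  assumes d: "d = 2 * CARD('n)" and g: "smooth_fun X g" and L: "lagrangian_submanifold CARD('n) X \<omega> L"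
    and x: "x \<in> L" and b: "\<And>z. z \<in> L \<Longrightarrow> g z = b" and surj: "dfun X g x ` model X = UNIV"
    and uv: "u \<in> model X" "v \<in> model X" "dfun X g x u = 0" "dfun X g x v = 0"
  shows "\<omega> x u v = 0"
proof -
  note XM = symplectic_mfd
  obtain E0 where E0: "embedded_submanifold X E0 L" "dim E0 = CARD('n)"
    "\<And>u v. u \<in> E0 \<Longrightarrow> v \<in> E0 \<Longrightarrow>
       \<omega> x (dmap (submfd X E0 L) X id x u) (dmap (submfd X E0 L) X id x v) = 0"
    using L x unfolding lagrangian_submanifold_def by blast
  let ?S = "submfd X E0 L"
  let ?J = "dmap ?S X id x"
  note S = submanifold_model[OF XM E0(1)]
  note SM = smooth_manifold_submfd[OF XM E0(1)] and inc = smooth_map_inclusion[OF XM E0(1)]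
  have xX: "x \<in> pts X" using x S(3) by blast
  have xS: "x \<in> pts ?S" using x by simp
  have linJ: "linear ?J" by (rule linear_dmap[OF SM XM inc xS])
  have ling: "linear (dfun X g x)" by (rule linear_dfun[OF XM g xX])
  let ?K = "{u \<in> model X. dfun X g x u = 0}"
  have K: "subspace ?K"
    using manifold_chart(1)[OF XM] by (auto simp: subspace_def linear_0[OF ling] linear_add[OF ling] linear_scale[OF ling])
  have JK: "?J ` E0 \<subseteq> ?K"
  proof
    fix w assume "w \<in> ?J ` E0"
    then obtain w0 where w0: "w0 \<in> E0" "w = ?J w0" by blast
    have "dfun X g (id x) (?J w0) = dfun ?S (g \<circ> id) x w0"
      by (rule dfun_dmap[OF SM XM inc g xS]) (use w0 in simp)
    also have "\<dots> = 0"
      by (rule dfun_const_on[OF SM xS, of _ _ b]) (use w0 b in auto)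
    finally show "w \<in> ?K" using w0 dmap_in[OF SM XM inc xS, of w0] by simp
  qed
  have inj: "inj_on ?J E0"
  proof (rule inj_onI)
    fix y z assume yz: "y \<in> E0" "z \<in> E0" "?J y = ?J z"
    then have "?J (y - z) = 0" using linear_diff[OF linJ] by simp
    then have "y - z = 0" by (rule dmap_inclusion_eq_0[OF XM E0(1) x subspace_diff[OF S(1) yz(1,2)]])
    then show "y = z" by simp
  qed
  have sp: "span E0 = E0" using S(1) by (rule span_eq_iff[THEN iffD2])
  have "dim (?J ` E0) = dim E0" by (rule dim_image_eq[OF linJ]) (simp only: sp inj)
  moreover have "dim ?K = CARD('n)"
    using rank_nullity_on[OF manifold_chart(1)[OF XM] ling] surj manifold_chart(2)[OF XM] d by simp
  ultimately have "?J ` E0 = ?K"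
    using subspace_dim_equal[OF linear_subspace_image[OF linJ S(1)] K JK] E0(2) by simp
  then have "u \<in> ?J ` E0" "v \<in> ?J ` E0" using uv by simp_all
  then show ?thesis using E0(3) by blast
qed

section \<open>Hamiltonian circle actions\<close>

context
  fixes \<theta> :: "real \<Rightarrow> 'a \<Rightarrow> 'a" and \<mu> :: "'a \<Rightarrow> real"
  assumes ham: "hamiltonian_circle_action X \<omega> \<theta> \<mu>"
begin

lemma action_moment_smooth: "smooth_fun X \<mu>"
  using ham unfolding hamiltonian_circle_action_def by (elim conjE)

lemma action_smooth_map: "smooth_map (line_times X) X (\<lambda>(t, x). \<theta> t x)"
  using ham unfolding hamiltonian_circle_action_def smooth_circle_action_def by (elim conjE)

lemma action_laws: "\<forall>x\<in>pts X. \<theta> 0 x = x \<and> \<theta> 1 x = x \<and> (\<forall>s t. \<theta> (s + t) x = \<theta> s (\<theta> t x))"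
  using ham unfolding hamiltonian_circle_action_def smooth_circle_action_def by (elim conjE)

lemma action_zero: "x \<in> pts X \<Longrightarrow> \<theta> 0 x = x"
  using action_laws by blast

lemma action_add: "x \<in> pts X \<Longrightarrow> \<theta> (s + t) x = \<theta> s (\<theta> t x)"
  using action_laws by blast

lemma action_pts: assumes "x \<in> pts X" shows "\<theta> t x \<in> pts X"
proof -
  have "(\<lambda>(t, x). \<theta> t x) ` (UNIV \<times> pts X) \<subseteq> pts X"
    using action_smooth_map unfolding smooth_map_def line_times_def by simp
  then have "(\<lambda>(t, x). \<theta> t x) (t, x) \<in> pts X" by (rule subsetD) (rule imageI, simp add: assms)
  then show ?thesis by simp
qed

lemma action_continuous: "continuous_on (UNIV \<times> pts X) (\<lambda>(t, x). \<theta> t x)"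
  using action_smooth_map unfolding smooth_map_def line_times_def by simp

lemma action_orbit_continuous:
  assumes "x \<in> pts X" shows "continuous_on UNIV (\<lambda>t. \<theta> t x)"
proof -
  have "continuous_on UNIV (\<lambda>t. (t, x))"
    by (intro continuous_on_Pair continuous_on_id continuous_on_const)
  from continuous_on_compose2[OF action_continuous this] show ?thesis
    using assms by (simp add: image_subset_iff)
qed

lemma action_orbit_open:
  assumes x: "x \<in> pts X" and U: "openin (top_of_set (pts X)) U"
  shows "open {s. \<theta> s x \<in> U}"
proof -
  obtain O' where O': "open O'" "U = pts X \<inter> O'" using U by (auto simp: openin_open)
  have "open ((\<lambda>s. \<theta> s x) -` O')"
    using continuous_on_open_vimage[OF open_UNIV] action_orbit_continuous[OF x] O'(1) by auto
  moreover have "(\<lambda>s. \<theta> s x) -` O' = {s. \<theta> s x \<in> U}" using O'(2) action_pts[OF x] by auto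
  ultimately show ?thesis by simp
qed

lemma action_velocity_chart_at:
  assumes "x \<in> pts X"
  shows "((\<lambda>s. snd (chart_at X (\<theta> t x)) (\<theta> s x)) has_vector_derivative ham_vf X \<omega> \<mu> (\<theta> t x)) (at t)"
proof -
  have "\<forall>x\<in>pts X. \<forall>t. ((\<lambda>s. snd (chart_at X (\<theta> t x)) (\<theta> s x)) has_vector_derivative
      ham_vf X \<omega> \<mu> (\<theta> t x)) (at t)"
    using ham unfolding hamiltonian_circle_action_def by (elim conjE)
  from this[rule_format, OF assms] show ?thesis .
qed

lemma action_velocity:
  fixes H :: "'a \<Rightarrow> 'b::real_normed_vector"
  assumes x: "x \<in> pts X" and H: "chart_diff X (chart_at X (\<theta> t x)) H (\<theta> t x)"
  shows "((\<lambda>s. H (\<theta> s x)) has_vector_derivative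
    chart_deriv X (chart_at X (\<theta> t x)) H (\<theta> t x) (ham_vf X \<omega> \<mu> (\<theta> t x))) (at t)"
proof -
  note c = chart_at[OF symplectic_mfd action_pts[OF x, of t]]
  show ?thesis
    by (rule curve_chain(2)[OF symplectic_mfd c(3) action_orbit_open[OF x smooth_chartD(1)[OF c(3)]] _ _
          action_velocity_chart_at[OF x] H]) (use c(2) in simp_all)
qed

lemma action_velocity_chart:
  assumes x: "x \<in> pts X" and c: "smooth_chart X c" "\<theta> t x \<in> fst c"
  obtains v where "v \<in> model X" "coord_vec X c (\<theta> t x) v = ham_vf X \<omega> \<mu> (\<theta> t x)"
    "((\<lambda>s. snd c (\<theta> s x)) has_vector_derivative v) (at t)"
proof -
  let ?y = "\<theta> t x"
  let ?k = "chart_at X ?y"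
  note k = chart_at[OF symplectic_mfd action_pts[OF x, of t]]
  have td: "chart_diff X ?k (snd c) ?y" by (rule transition_diff[OF symplectic_mfd k(3) c(1) k(2) c(2)])
  have h: "ham_vf X \<omega> \<mu> ?y \<in> model X" by (rule ham_vf(1)[OF action_moment_smooth action_pts[OF x]])
  have "coord_vec X c ?y (chart_deriv X ?k (snd c) ?y (ham_vf X \<omega> \<mu> ?y)) = coord_vec X ?k ?y (ham_vf X \<omega> \<mu> ?y)"
    by (rule coord_vec_change[OF symplectic_mfd k(3) c(1) k(2) c(2) h])
  also have "\<dots> = ham_vf X \<omega> \<mu> ?y"
    unfolding coord_vec_eq[OF symplectic_mfd k(3,2)]
    by (rule chart_deriv_self[OF k(3) manifold_chart(1)[OF symplectic_mfd] k(2) h])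
  finally show ?thesis
    using that action_velocity[OF x td]
      chart_change(2)[OF symplectic_mfd k(3) c(1) k(2) c(2) transition_diff[OF symplectic_mfd c(1,1,2,2)] h] by blast
qed

text \<open>The derivative along an orbit is d\<mu>(\<eta>) = \<omega>(\<eta>, \<eta>) = 0 for the
  Hamiltonian field \<eta> of \<mu>.\<close>

lemma moment_invariant:
  assumes x: "x \<in> pts X"
  shows "\<mu> (\<theta> t x) = \<mu> x"
proof -
  have "((\<lambda>s. \<mu> (\<theta> s x)) has_real_derivative 0) (at t)" for t
  proof -
    let ?y = "\<theta> t x"
    have y: "?y \<in> pts X" by (rule action_pts[OF x])
    note k = chart_at[OF symplectic_mfd y]
    interpret symplectic_subspace "model X" "\<omega> ?y" by (rule symplectic_subspace_at[OF y])
    note hv = ham_vf[OF action_moment_smooth y]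
    have "dfun X \<mu> ?y (ham_vf X \<omega> \<mu> ?y) = 0"
      using hv(2)[OF hv(1)] anti[OF hv(1) hv(1)] by simp
    then show ?thesis
      using action_velocity[OF x smooth_fun_diff[OF symplectic_mfd action_moment_smooth k(3,2)]]
      unfolding dfun_eq[OF symplectic_mfd y] has_real_derivative_iff_has_vector_derivative by simp
  qed
  then have "\<mu> (\<theta> t x) = \<mu> (\<theta> 0 x)" using DERIV_isconst_all by blast
  then show ?thesis using action_zero[OF x] by simp
qed

text \<open>Smoothness is given for the action as a map on the product with the line; for fixed t
  one restricts to the slice {t} in a product chart.\<close>

lemma action_diff:
  assumes x: "x \<in> pts X"
  shows "chart_diff X (chart_at X x) (snd (chart_at X (\<theta> t x)) \<circ> \<theta> t) x"
proof -
  let ?c = "chart_at X x" and ?k = "chart_at X (\<theta> t x)" and ?F = "\<lambda>(t, x). \<theta> t x"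
  note c = chart_at[OF symplectic_mfd x] and k = chart_at[OF symplectic_mfd action_pts[OF x, of t]]
  note EX = manifold_chart(1)[OF symplectic_mfd]
  let ?c' = "((UNIV :: real set) \<times> fst ?c, \<lambda>(t :: real, x). (t, snd ?c x))"
  have c': "?c' \<in> charts (line_times X)" unfolding line_times_def using c(1) by auto
  have mo: "model (line_times X) = UNIV \<times> model X" unfolding line_times_def by simp
  let ?T = "snd ?c' ` (fst ?c' \<inter> ?F -` fst ?k)"
  have sm: "smooth_on (UNIV \<times> model X) ?T (snd ?k \<circ> ?F \<circ> coord_inv ?c')"
    using action_smooth_map c' k(1) mo unfolding smooth_map_def by metis
  have TE: "?T \<subseteq> UNIV \<times> model X" using chart_in_model[OF c(3)] by auto
  define U where "U = {z \<in> fst ?c. \<theta> t z \<in> fst ?k}"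
  have U: "openin (top_of_set (pts X)) U"
  proof -
    have "continuous_on (pts X) (\<lambda>z. ?F (t, z))"
      by (rule continuous_on_compose2[OF action_continuous]) (auto intro!: continuous_intros)
    then have ct: "continuous_on (pts X) (\<theta> t)" by simp
    have "openin (top_of_set (pts X)) (pts X \<inter> \<theta> t -` fst ?k)"
      by (rule continuous_openin_preimage[OF ct _ smooth_chartD(1)[OF k(3)]]) (simp add: action_pts)
    from openin_Int[OF smooth_chartD(1)[OF c(3)] this]
    have "openin (top_of_set (pts X)) (fst ?c \<inter> (pts X \<inter> \<theta> t -` fst ?k))" .
    moreover have "fst ?c \<inter> (pts X \<inter> \<theta> t -` fst ?k) = U"
      unfolding U_def using smooth_chart_pts[OF c(3)] by blast
    ultimately show ?thesis by simp
  qed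
  have Uc: "U \<subseteq> fst ?c" unfolding U_def by blast
  have xU: "x \<in> U" unfolding U_def using c(2) k(2) by simp
  have im: "(\<lambda>w. (t, w)) ` snd ?c ` U \<subseteq> ?T"
  proof
    fix q assume "q \<in> (\<lambda>w. (t, w)) ` snd ?c ` U"
    then obtain z where z: "z \<in> U" "q = (t, snd ?c z)" by blast
    then show "q \<in> ?T" unfolding U_def by (intro image_eqI[of _ _ "(t, z)"]) auto
  qed
  have blp: "bounded_linear (\<lambda>w :: 'e. (0 :: real, w))"
    by (intro bounded_linear_Pair bounded_linear_zero bounded_linear_ident)
  have smp: "smooth_on (model X) (snd ?c ` U) (\<lambda>w. (t, w))"
    using smooth_on_add[OF smooth_on_const[of "model X" "snd ?c ` U" "(t, 0)"] smooth_on_linear[OF blp smooth_on_ident]] by simp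
  have "smooth_on (model X) (snd ?c ` U) (\<lambda>w. (snd ?k \<circ> ?F \<circ> coord_inv ?c') (t, w))"
    by (rule smooth_on_compose[OF EX chart_image_openin[OF c(3) U Uc] subspace_Times[OF subspace_UNIV EX] im TE smp sm])
  then have "smooth_on (model X) (snd ?c ` U) (snd ?k \<circ> \<theta> t \<circ> coord_inv ?c)"
  proof (rule smooth_on_transform)
    fix w assume "w \<in> snd ?c ` U"
    then obtain z where z: "z \<in> U" "w = snd ?c z" by blast
    have zc: "z \<in> fst ?c" using z Uc by blast
    have i: "inj_on (snd ?c') (fst ?c')"
      using smooth_chart_inj[OF c(3)] unfolding inj_on_def by auto
    have "coord_inv ?c' (t, w) = inv_into (fst ?c') (snd ?c') (snd ?c' (t, z))"
      unfolding coord_inv_def using z(2) by simp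
    also have "\<dots> = (t, z)" by (rule inv_into_f_f[OF i]) (use zc in simp)
    finally show "(snd ?k \<circ> ?F \<circ> coord_inv ?c') (t, w) = (snd ?k \<circ> \<theta> t \<circ> coord_inv ?c) w"
      using coord_inv_snd[OF c(3) zc] z(2) by simp
  qed
  then show ?thesis by (rule smooth_on_chart_diff[OF c(3) U Uc xU])
qed

text \<open>A zero of the generating field is a fixed point: its orbit has zero velocity throughout.\<close>

lemma free_action_velocity:
  assumes free: "free_circle_action X \<theta>" and x: "x \<in> pts X"
  shows "ham_vf X \<omega> \<mu> x \<noteq> 0"
proof
  assume x0: "ham_vf X \<omega> \<mu> x = 0"
  \<comment> \<open>\<open>\<theta> t\<close> carries the orbit near time 0 to the orbit near time
    t, so the velocity at t is the image of the velocity at 0, which vanishes.\<close>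
  have h0: "ham_vf X \<omega> \<mu> (\<theta> t x) = 0" for t
  proof -
    let ?c = "chart_at X x" and ?k = "chart_at X (\<theta> t x)"
    note c = chart_at[OF symplectic_mfd x]
    have v0: "((\<lambda>s. snd ?c (\<theta> s x)) has_vector_derivative 0) (at 0)"
      using action_velocity_chart_at[OF x, of 0] x0 unfolding action_zero[OF x] by simp
    have H: "chart_diff X ?c (snd ?k \<circ> \<theta> t) (\<theta> 0 x)" unfolding action_zero[OF x] by (rule action_diff[OF x])
    have "((\<lambda>s. (snd ?k \<circ> \<theta> t) (\<theta> s x)) has_vector_derivative chart_deriv X ?c (snd ?k \<circ> \<theta> t) (\<theta> 0 x) 0) (at 0)"
      by (rule curve_chain(2)[OF symplectic_mfd c(3) action_orbit_open[OF x smooth_chartD(1)[OF c(3)]] _ _ v0 H])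
        (use c(2) action_zero[OF x] in simp_all)
    then have 1: "((\<lambda>s. snd ?k (\<theta> (t + s) x)) has_vector_derivative 0) (at 0)"
      using linear_0[OF linear_chart_deriv[OF H]] by (simp add: action_add[OF x])
    have sh: "((\<lambda>s. t + s) has_vector_derivative 1) (at 0)"
      by (auto intro!: derivative_eq_intros)
    have "((\<lambda>s. snd ?k (\<theta> s x)) has_vector_derivative ham_vf X \<omega> \<mu> (\<theta> t x)) (at (t + 0))"
      using action_velocity_chart_at[OF x] by simp
    from vector_diff_chain_at[OF sh this]
    have "((\<lambda>s. snd ?k (\<theta> (t + s) x)) has_vector_derivative ham_vf X \<omega> \<mu> (\<theta> t x)) (at 0)"
      by (simp add: o_def)
    then show ?thesis using vector_derivative_unique_at[OF 1] by simp
  qed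
  \<comment> \<open>The times fixing x form a clopen set: near such a time the orbit stays in one
    chart and has velocity zero there. By connectedness every time fixes x, and 1/2 is one that is
    not an integer.\<close>
  let ?Q = "{t. \<theta> t x = x}"
  have "closed ?Q"
    by (rule closed_Collect_eq[OF action_orbit_continuous[OF x] continuous_on_const])
  moreover have "open ?Q"
    unfolding open_dist
  proof
    fix t assume t: "t \<in> ?Q"
    let ?c = "chart_at X x"
    note c = chart_at[OF symplectic_mfd x]
    have op: "open {s. \<theta> s x \<in> fst ?c}" by (rule action_orbit_open[OF x smooth_chartD(1)[OF c(3)]])
    have "t \<in> {s. \<theta> s x \<in> fst ?c}" using t c(2) by simp
    then obtain e where e: "0 < e" "\<And>s. dist s t < e \<Longrightarrow> \<theta> s x \<in> fst ?c"
      using op unfolding open_dist by blast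
    have "\<theta> s x = x" if s: "dist s t < e" for s
    proof -
      have cv: "convex (ball t e)" by (rule convex_ball)
      have d0: "((\<lambda>s. snd ?c (\<theta> s x)) has_derivative (\<lambda>h. 0)) (at r within ball t e)" if r: "r \<in> ball t e" for r
      proof -
        have rc: "\<theta> r x \<in> fst ?c" using e(2) r by (simp add: dist_commute)
        obtain v where v: "v \<in> model X" "coord_vec X ?c (\<theta> r x) v = ham_vf X \<omega> \<mu> (\<theta> r x)"
          "((\<lambda>s. snd ?c (\<theta> s x)) has_vector_derivative v) (at r)"
          using action_velocity_chart[OF x c(3) rc] .
        have "v = 0" by (rule coord_vec_eq_0[OF symplectic_mfd c(3) rc v(1)]) (use v(2) h0 in simp)
        then show ?thesis using v(3) has_derivative_at_withinI by (auto simp: has_vector_derivative_def)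
      qed
      obtain w where w: "\<And>r. r \<in> ball t e \<Longrightarrow> snd ?c (\<theta> r x) = w"
        using has_derivative_zero_constant[OF cv d0] by blast
      have "snd ?c (\<theta> s x) = snd ?c (\<theta> t x)"
        using w[of s] w[of t] s e(1) by (simp add: dist_commute)
      then have "\<theta> s x = \<theta> t x"
        by (rule inj_onD[OF smooth_chart_inj[OF c(3)]]) (use e s in simp_all)
      then show ?thesis using t by simp
    qed
    then show "\<exists>e>0. \<forall>y. dist y t < e \<longrightarrow> y \<in> ?Q" using e(1) by blast
  qed
  ultimately have "?Q = {} \<or> ?Q = UNIV" using clopen[of ?Q] by simp
  moreover have "0 \<in> ?Q" using action_zero[OF x] by simp
  ultimately have "1/2 \<in> ?Q" by (metis UNIV_I empty_iff)
  then have "\<theta> (1/2) x = x" by simp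
  then have "(1/2 :: real) \<in> \<int>" using free x unfolding free_circle_action_def by blast
  then obtain n where "(1/2 :: real) = of_int n" by (elim Ints_cases)
  then have "(1 :: real) = of_int (2 * n)" by simp
  then have "1 = 2 * n" by linarith
  then show False by presburger
qed

text \<open>The generating field is tangent to the orbits, which a quotient map contracts.\<close>

lemma action_pushes_to_zero:
  fixes B :: "('c::{t2_space,second_countable_topology}, 'd::euclidean_space) mfd"
  assumes S: "embedded_submanifold X E1 S" and inv: "\<And>t. \<theta> t x \<in> S"
    and B: "smooth_manifold d' B" and p: "smooth_map (submfd X E1 S) B p"
    and orb: "\<And>t. p (\<theta> t x) = p x" and xX: "x \<in> pts X"
  shows "pushes_to X (submfd X E1 S) B p x (ham_vf X \<omega> \<mu> x) 0"
proof -
  let ?Z = "submfd X E1 S"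
  note SM = smooth_manifold_submfd[OF symplectic_mfd S]
  have xS: "x \<in> S" using inv[of 0] action_zero[OF xX] by simp
  \<comment> \<open>The orbit lies in S, so in a slice chart its coordinates in X and in the
    submanifold coincide, and its velocity is a tangent vector of both.\<close>
  obtain c where c: "slice_chart X E1 S c" "x \<in> fst c" using slice_chart_at[OF symplectic_mfd S xS] .
  let ?c = "(fst c \<inter> S, snd c)"
  have sc: "smooth_chart X c" by (rule slice_chart_smooth[OF symplectic_mfd S c(1)])
  have sc': "smooth_chart ?Z ?c" by (rule smooth_chart_submfd[OF symplectic_mfd S c(1)])
  have cx: "\<theta> 0 x \<in> fst c" using c(2) action_zero[OF xX] by simp
  obtain v where v: "v \<in> model X" "coord_vec X c (\<theta> 0 x) v = ham_vf X \<omega> \<mu> (\<theta> 0 x)"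
    "((\<lambda>s. snd c (\<theta> s x)) has_vector_derivative v) (at 0)"
    using action_velocity_chart[OF xX sc cx] .
  have v': "((\<lambda>s. snd ?c (\<theta> s x)) has_vector_derivative v) (at 0)" using v(3) by simp
  have op: "open {s. \<theta> s x \<in> fst c}" by (rule action_orbit_open[OF xX smooth_chartD(1)[OF sc]])
  let ?k = "chart_at B (p x)"
  have px: "p x \<in> pts B" by (rule smooth_map_pts[OF SM B p]) (use xS in simp)
  note k = chart_at[OF B px]
  have x0: "0 \<in> {s. \<theta> s x \<in> fst c}" using cx by simp
  have in_c: "\<theta> s x \<in> fst ?c" if "s \<in> {s. \<theta> s x \<in> fst c}" for s using that inv by simp
  have H: "chart_diff ?Z ?c (snd ?k \<circ> p) (\<theta> 0 x)"
    unfolding action_zero[OF xX] by (rule smooth_map_diff[OF SM B p sc' k(3)]) (use c(2) xS k(2) in simp_all)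
  note cc = curve_chain[OF SM sc' op x0 in_c v' H]
  have vE: "v \<in> E1" using cc(1) by simp
  have D0: "((\<lambda>s. (snd ?k \<circ> p) (\<theta> s x)) has_vector_derivative 0) (at 0)"
    unfolding comp_apply orb by (rule has_vector_derivative_const)
  have z: "chart_deriv ?Z ?c (snd ?k \<circ> p) x v = 0"
    using vector_derivative_unique_at[OF cc(2) D0] unfolding action_zero[OF xX] .
  let ?u = "coord_vec ?Z ?c x v"
  have "dmap ?Z X id x ?u = ham_vf X \<omega> \<mu> x"
    using dmap_inclusion[OF symplectic_mfd S c xS vE] v(2) unfolding action_zero[OF xX] by simp
  moreover have "dmap ?Z B p x ?u = coord_vec B ?k (p x) (chart_deriv ?Z ?c (snd ?k \<circ> p) x v)"
    by (rule dmap_coord_vec[OF SM B p sc' k(3)]) (use c(2) xS k(2) vE in simp_all)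
  moreover have "?u \<in> model ?Z"
    by (rule coord_vec_in[OF SM sc']) (use c(2) xS vE in simp_all)
  ultimately show ?thesis
    unfolding pushes_to_def z using linear_0[OF linear_coord_vec[OF B k(3,2)]] by auto
qed

end

end


section \<open>The seam of a stitched Lagrangian fibration\<close>

lemma frechet_derivative_chart:
  assumes "smooth_chart M k" "y \<in> snd k ` fst k"
  shows "frechet_derivative (h \<circ> coord_inv k) (at y within snd k ` fst k) = chart_deriv M k h (coord_inv k y)"
  using at_chart[OF assms(1) smooth_chartD(1)[OF assms(1)] order_refl coord_inv_in[OF assms]]
  unfolding chart_deriv_def snd_coord_inv[OF assms] by simp

locale stitched_seam =
  fixes X :: "('a::{t2_space,second_countable_topology}, 'e::euclidean_space) mfd"
    and \<omega> :: "'a \<Rightarrow> 'e \<Rightarrow> 'e \<Rightarrow> real"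
    and \<theta> :: "real \<Rightarrow> 'a \<Rightarrow> 'a"
    and one :: "'n::finite"
    and f fp fm :: "'a \<Rightarrow> real^'n"
    and E1 :: "'e set"
    and Zbar :: "('c::{t2_space,second_countable_topology}, 'd::euclidean_space) mfd"
    and p :: "'a \<Rightarrow> 'c"
    and fbar :: "'c \<Rightarrow> real^'n"
    and a :: "'n \<Rightarrow> 'a \<Rightarrow> real"
    and etabar :: "'n \<Rightarrow> 'c \<Rightarrow> 'd"
    and ell :: "'c \<Rightarrow> 'd \<Rightarrow> real"
  assumes stitched: "stitched_lagrangian_fibration X \<omega> \<theta> one f fp fm"
    and seam_mfd: "embedded_submanifold X E1 (seam X one f)" "dim E1 = 2 * CARD('n) - 1"
    and quotient: "orbit_quotient (submfd X E1 (seam X one f)) \<theta> Zbar p"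
    and fbar: "\<And>x. x \<in> seam X one f \<Longrightarrow> fbar (p x) = f x"
    and a_eq: "\<And>j x. j \<noteq> one \<Longrightarrow> x \<in> seam X one f \<Longrightarrow>
        ham_vf X \<omega> (\<lambda>y. fp y $ j) x - ham_vf X \<omega> (\<lambda>y. fm y $ j) x
          = a j x *\<^sub>R ham_vf X \<omega> (\<lambda>y. f y $ one) x"
    and etabar_plus: "\<And>j x. j \<noteq> one \<Longrightarrow> x \<in> seam X one f \<Longrightarrow>
        pushes_to X (submfd X E1 (seam X one f)) Zbar p x (ham_vf X \<omega> (\<lambda>y. fp y $ j) x) (etabar j (p x))"
    and ell_section: "\<And>z. z \<in> pts Zbar \<Longrightarrow> linear_on_subspace (ker_dfun Zbar fbar z) (ell z)"
    and ell_def: "\<And>j x. j \<noteq> one \<Longrightarrow> x \<in> seam X one f \<Longrightarrow> ell (p x) (etabar j (p x)) = a j x"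
begin

abbreviation "S \<equiv> seam X one f"
abbreviation "Z \<equiv> submfd X E1 S"
abbreviation "\<mu> \<equiv> \<lambda>x. f x $ one"
text \<open>With \<sigma> = 1 and \<sigma> = -1 these are the two sides of the seam, which lets one
  argument treat both.\<close>

abbreviation "half \<sigma> \<equiv> {x \<in> pts X. 0 \<le> \<sigma> * f x $ one}"

lemma symplectic: "symplectic_manifold (2 * CARD('n)) X \<omega>"
  and ham: "hamiltonian_circle_action X \<omega> \<theta> \<mu>"
  and free: "free_circle_action X \<theta>"
  using stitched unfolding stitched_lagrangian_fibration_def by blast+

lemma f_invariant: "x \<in> pts X \<Longrightarrow> f (\<theta> t x) = f x"
proof (rule vec_eq_iff[THEN iffD2], rule allI)
  fix j assume x: "x \<in> pts X"
  have "\<forall>x\<in>pts X. \<forall>t. \<forall>j. j \<noteq> one \<longrightarrow> f (\<theta> t x) $ j = f x $ j"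
    using stitched unfolding stitched_lagrangian_fibration_def by (elim conjE)
  then show "f (\<theta> t x) $ j = f x $ j"
    using moment_invariant[OF symplectic ham x, of t] x by (cases "j = one") simp_all
qed

lemma half_plus: "lagrangian_half X \<omega> (half 1) f fp"
  using stitched unfolding stitched_lagrangian_fibration_def by simp

lemma half_minus: "lagrangian_half X \<omega> (half (-1)) f fm"
  using stitched unfolding stitched_lagrangian_fibration_def by simp

lemmas XM = symplectic_mfd[OF symplectic]
lemmas EX = manifold_chart(1)[OF XM]
lemmas ZM = smooth_manifold_submfd[OF XM seam_mfd(1)]
lemmas inc = smooth_map_inclusion[OF XM seam_mfd(1)]
lemmas E1X = submanifold_model[OF XM seam_mfd(1)]

lemma quotient_mfd: "smooth_manifold (dim E1 - 1) Zbar"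
  and quotient_map: "smooth_map Z Zbar p"
  and quotient_onto: "p ` S = pts Zbar"
  and quotient_surj: "x \<in> S \<Longrightarrow> dmap Z Zbar p x ` E1 = model Zbar"
  and quotient_orbit: "x \<in> S \<Longrightarrow> y \<in> S \<Longrightarrow> p x = p y \<longleftrightarrow> (\<exists>t. y = \<theta> t x)"
  using quotient unfolding orbit_quotient_def submfd_simps by simp_all

lemmas BM = quotient_mfd
lemmas EB = manifold_chart(1)[OF BM]

lemma seamD: "x \<in> S \<Longrightarrow> x \<in> pts X" "x \<in> S \<Longrightarrow> f x $ one = 0"
  unfolding seam_def by simp_all

section \<open>Differentials and Hamiltonian fields along the seam\<close>

lemma moment_smooth: "smooth_fun X \<mu>" by (rule action_moment_smooth[OF symplectic ham])

lemma lagrangian_halfD: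
  assumes "lagrangian_half X \<omega> P f g"
  shows "smooth_fun X g" "x \<in> P \<Longrightarrow> g x = f x" "x \<in> P \<Longrightarrow> dfun X g x ` model X = UNIV"
    "x \<in> P \<Longrightarrow> lagrangian_submanifold CARD('n) X \<omega> {z \<in> P. f z = f x}"
  using assms unfolding lagrangian_half_def by simp_all

lemma dfun_component:
  fixes g :: "'a \<Rightarrow> real^'n"
  assumes "smooth_fun X g" "x \<in> pts X" "u \<in> model X"
  shows "dfun X (\<lambda>y. g y $ j) x u = dfun X g x u $ j"
  by (rule dfun_linear[OF XM bounded_linear_vec_nth assms])

lemma smooth_component: "smooth_fun X g \<Longrightarrow> smooth_fun X (\<lambda>y. g y $ j)"
  for g :: "'a \<Rightarrow> real^'n"
  by (rule smooth_fun_linear[OF bounded_linear_vec_nth])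

text \<open>If d\<mu> vanished at x, the generating field would vanish there, which freeness of the
  action excludes.\<close>

lemma moment_regular:
  assumes x: "x \<in> pts X"
  obtains u where "u \<in> model X" "dfun X \<mu> x u \<noteq> 0"
proof -
  interpret symplectic_subspace "model X" "\<omega> x" by (rule symplectic_subspace_at[OF symplectic x])
  have "\<exists>u\<in>model X. dfun X \<mu> x u \<noteq> 0"
  proof (rule ccontr)
    assume "\<not> (\<exists>u\<in>model X. dfun X \<mu> x u \<noteq> 0)"
    then have d: "\<forall>u\<in>model X. dfun X \<mu> x u = 0" by blast
    have "ham_vf X \<omega> \<mu> x = 0"
    proof (rule ham_vf(3)[OF symplectic moment_smooth x subspace_0[OF EX]])
      fix u assume u: "u \<in> model X"
      show "\<omega> x 0 u = dfun X \<mu> x u" using linear_on_subspaceD(4)[OF lin[OF u] EX u u] d u by simp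
    qed
    then show False using free_action_velocity[OF symplectic ham free x] by simp
  qed
  then show ?thesis using that by blast
qed

text \<open>\<mu> vanishes on the seam and \<sigma> \<mu> has positive derivative along the curve,
  so it is positive immediately afterwards; the chart image is relatively open and is not left at
  once. This supplies the entering condition of \<open>closed_along_fibre\<close>.\<close>

lemma curve_enters_half:
  assumes k: "smooth_chart X k" "x \<in> fst k" and x: "x \<in> S"
    and c: "(c has_vector_derivative v) (at 0)" "c 0 = snd k x" "range c \<subseteq> model X"
    and pos: "0 < \<sigma> * chart_deriv X k \<mu> x v"
  shows "\<forall>\<^sub>F t in at_right 0. c t \<in> snd k ` (fst k \<inter> half \<sigma>)"
proof -
  have d: "(c has_derivative (\<lambda>t. t *\<^sub>R v)) (at 0)" using c(1) unfolding has_vector_derivative_def .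
  have cd: "chart_diff X k \<mu> x" by (rule smooth_fun_diff[OF XM moment_smooth k])
  have "(\<mu> \<circ> coord_inv k has_derivative chart_deriv X k \<mu> x) (at (c 0) within range c)"
    unfolding c(2) by (rule has_derivative_subset[OF chart_diff_has_derivative[OF cd] c(3)])
  from has_derivative_in_compose[OF d this]
  have d\<mu>: "((\<lambda>t. (\<mu> \<circ> coord_inv k) (c t)) has_derivative (\<lambda>t. chart_deriv X k \<mu> x (t *\<^sub>R v))) (at 0)" .
  have "((\<lambda>t. \<sigma> * (\<mu> \<circ> coord_inv k) (c t)) has_derivative (\<lambda>t. \<sigma> * chart_deriv X k \<mu> x (t *\<^sub>R v))) (at 0)"
    by (rule has_derivative_mult_right[OF d\<mu>])
  moreover have "(\<lambda>t. \<sigma> * chart_deriv X k \<mu> x (t *\<^sub>R v)) = (*) (\<sigma> * chart_deriv X k \<mu> x v)"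
    by (simp add: linear_scale[OF linear_chart_deriv[OF cd]] fun_eq_iff)
  ultimately have D: "((\<lambda>t. \<sigma> * (\<mu> \<circ> coord_inv k) (c t)) has_real_derivative \<sigma> * chart_deriv X k \<mu> x v) (at 0)"
    unfolding has_field_derivative_def by simp
  have z: "(\<mu> \<circ> coord_inv k) (c 0) = 0" unfolding c(2) using coord_inv_snd[OF k] seamD(2)[OF x] by simp
  obtain e where e: "0 < e" "\<And>h. 0 < h \<Longrightarrow> h < e \<Longrightarrow> 0 < \<sigma> * (\<mu> \<circ> coord_inv k) (c h)"
    using DERIV_pos_inc_right[OF D pos] z by auto
  have ev1: "\<forall>\<^sub>F t in at_right 0. 0 < \<sigma> * (\<mu> \<circ> coord_inv k) (c t)"
    unfolding eventually_at_right_field using e by blast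
  obtain O' where O': "open O'" "snd k ` fst k = model X \<inter> O'"
    using smooth_chartD(2)[OF k(1)] by (auto simp: openin_open)
  have "isCont c 0" using has_derivative_continuous[OF d] by simp
  then have "(c \<longlongrightarrow> c 0) (at_right 0)" unfolding isCont_def by (rule filterlim_mono) (auto simp: at_le)
  moreover have "c 0 \<in> O'" unfolding c(2) using O'(2) k(2) by blast
  ultimately have ev2: "\<forall>\<^sub>F t in at_right 0. c t \<in> O'" using O'(1) topological_tendstoD by blast
  from ev1 ev2 show ?thesis
  proof eventually_elim
    case (elim t)
    have ct: "c t \<in> snd k ` fst k" using elim(2) O'(2) c(3) by blast
    then have i: "coord_inv k (c t) \<in> fst k" "snd k (coord_inv k (c t)) = c t"
      using coord_inv_in[OF k(1)] snd_coord_inv[OF k(1)] by blast+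
    have "coord_inv k (c t) \<in> half \<sigma>" using smooth_chart_pts[OF k(1) i(1)] elim(1) by simp
    then show ?case using i by (intro image_eqI[of _ _ "coord_inv k (c t)"]) simp_all
  qed
qed

text \<open>\<open>g\<^sub>1 = \<mu>\<close> holds on one side of the seam only, but \<open>d\<mu> \<noteq> 0\<close> there.\<close>

lemma moment_derivative:
  assumes half: "lagrangian_half X \<omega> (half \<sigma>) f g" and \<sigma>: "\<sigma> \<noteq> 0" and x: "x \<in> S" and u: "u \<in> model X"
  shows "dfun X g x u $ one = dfun X \<mu> x u"
proof -
  have xX: "x \<in> pts X" by (rule seamD(1)[OF x])
  note g = lagrangian_halfD[OF half]
  note k = chart_at[OF XM xX]
  let ?k = "chart_at X x"
  let ?g = "\<lambda>y. g y $ one"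
  have sg: "smooth_fun X ?g" by (rule smooth_component[OF g(1)])
  have cg: "chart_diff X ?k ?g x" by (rule smooth_fun_diff[OF XM sg k(3,2)])
  have c\<mu>: "chart_diff X ?k \<mu> x" by (rule smooth_fun_diff[OF XM moment_smooth k(3,2)])
  have lg: "linear (dfun X ?g x)" and l\<mu>: "linear (dfun X \<mu> x)"
    by (rule linear_dfun[OF XM sg xX], rule linear_dfun[OF XM moment_smooth xX])
  \<comment> \<open>If v points into the half, g_1 - \<mu> vanishes along a short ray in direction
    v, and its derivative there is zero.\<close>
  have pos: "dfun X ?g x v = dfun X \<mu> x v" if v: "v \<in> model X" "0 < \<sigma> * dfun X \<mu> x v" for v
  proof -
    let ?y = "snd ?k x"
    let ?l = "\<lambda>t. ?y + t *\<^sub>R v"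
    have yE: "?y \<in> model X" by (rule chart_in_model[OF k(3,2)])
    have dl: "(?l has_vector_derivative v) (at 0)"
      by (auto intro!: derivative_eq_intros)
    have lE: "range ?l \<subseteq> model X" using subspace_add[OF EX yE subspace_scale[OF EX v(1)]] by blast
    have d: "((\<lambda>t. (h \<circ> coord_inv ?k) (?l t)) has_vector_derivative chart_deriv X ?k h x v) (at 0)"
      if "chart_diff X ?k h x" for h :: "'a \<Rightarrow> real"
      by (rule has_vector_derivative_line[OF EX openin_subtopology_self yE v(1) chart_diff_has_derivative[OF that]])
    have "chart_deriv X ?k ?g x v - chart_deriv X ?k \<mu> x v = 0"
    proof (rule one_sided_zero_derivative)
      show "((\<lambda>t. (?g \<circ> coord_inv ?k) (?l t) - (\<mu> \<circ> coord_inv ?k) (?l t)) has_real_derivative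
          chart_deriv X ?k ?g x v - chart_deriv X ?k \<mu> x v) (at 0)"
        by (intro DERIV_diff) (simp_all only: has_real_derivative_iff_has_vector_derivative d[OF cg] d[OF c\<mu>])
      have "\<forall>\<^sub>F t in at_right 0. ?l t \<in> snd ?k ` (fst ?k \<inter> half \<sigma>)"
        by (rule curve_enters_half[OF k(3,2) x dl _ lE]) (use v(2) in \<open>simp_all add: dfun_eq[OF XM xX]\<close>)
      then show "\<forall>\<^sub>F t in at_right 0. (?g \<circ> coord_inv ?k) (?l t) - (\<mu> \<circ> coord_inv ?k) (?l t) = 0"
      proof eventually_elim
        case (elim t)
        then obtain z where z: "z \<in> fst ?k" "z \<in> half \<sigma>" "?l t = snd ?k z" by blast
        have "coord_inv ?k (?l t) = z" unfolding z(3) by (rule coord_inv_snd[OF k(3) z(1)])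
        then show ?case using g(2)[OF z(2)] by simp
      qed
    qed
    then show ?thesis unfolding dfun_eq[OF XM xX] by simp
  qed
  obtain w where w: "w \<in> model X" "dfun X \<mu> x w \<noteq> 0" using moment_regular[OF xX] .
  \<comment> \<open>Chosen so that s w dominates u: both s w and u + s w then point into the half,
    and u is their difference.\<close>
  define s where "s = (\<bar>dfun X \<mu> x u\<bar> * \<bar>\<sigma>\<bar> + 1) / (\<sigma> * dfun X \<mu> x w)"
  have s: "\<sigma> * dfun X \<mu> x (s *\<^sub>R w) = \<bar>dfun X \<mu> x u\<bar> * \<bar>\<sigma>\<bar> + 1"
    using \<sigma> w(2) by (simp add: linear_scale[OF l\<mu>] s_def)
  have sw: "s *\<^sub>R w \<in> model X" by (rule subspace_scale[OF EX w(1)])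
  have ab: "- (\<bar>dfun X \<mu> x u\<bar> * \<bar>\<sigma>\<bar>) \<le> \<sigma> * dfun X \<mu> x u"
    using abs_ge_minus_self[of "\<sigma> * dfun X \<mu> x u"] by (simp add: abs_mult mult.commute)
  have "0 < \<sigma> * dfun X \<mu> x (s *\<^sub>R w)" unfolding s by (simp add: add_nonneg_pos)
  then have 1: "dfun X ?g x (s *\<^sub>R w) = dfun X \<mu> x (s *\<^sub>R w)" by (rule pos[OF sw])
  have "0 < \<sigma> * dfun X \<mu> x (u + s *\<^sub>R w)"
    unfolding linear_add[OF l\<mu>] distrib_left s using ab by linarith
  then have 2: "dfun X ?g x (u + s *\<^sub>R w) = dfun X \<mu> x (u + s *\<^sub>R w)"
    by (rule pos[OF subspace_add[OF EX u sw]])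
  have "dfun X ?g x u = dfun X \<mu> x u" using 1 2 by (simp add: linear_add[OF lg] linear_add[OF l\<mu>])
  then show ?thesis unfolding dfun_component[OF g(1) xX u] .
qed

lemma half_isotropic:
  assumes half: "lagrangian_half X \<omega> P f g" "P \<subseteq> pts X" and x: "x \<in> P"
    and uv: "u \<in> model X" "v \<in> model X" "dfun X g x u = 0" "dfun X g x v = 0"
  shows "\<omega> x u v = 0"
proof (rule lagrangian_fibre_isotropic[OF symplectic refl lagrangian_halfD(1)[OF half(1)] lagrangian_halfD(4)[OF half(1) x] _ _
    lagrangian_halfD(3)[OF half(1) x] uv])
  show "x \<in> {z \<in> P. f z = f x}" using x by simp
  show "g z = f x" if "z \<in> {z \<in> P. f z = f x}" for z using lagrangian_halfD(2)[OF half(1), of z] that by simp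
qed

lemma seam_half: "x \<in> S \<Longrightarrow> x \<in> half \<sigma>"
  using seamD by simp

lemmas fp = lagrangian_halfD[OF half_plus] and fm = lagrangian_halfD[OF half_minus]

lemma moment_plus: "x \<in> S \<Longrightarrow> u \<in> model X \<Longrightarrow> dfun X fp x u $ one = dfun X \<mu> x u"
  by (rule moment_derivative[OF half_plus]) simp_all

lemma moment_minus: "x \<in> S \<Longrightarrow> u \<in> model X \<Longrightarrow> dfun X fm x u $ one = dfun X \<mu> x u"
  by (rule moment_derivative[OF half_minus]) simp_all

text \<open>Contraction with \<omega> turns the relation between Hamiltonian fields in
  \<open>a_eq\<close> into one between differentials.\<close>

lemma plus_minus_derivative:
  assumes x: "x \<in> S" and u: "u \<in> model X" and j: "j \<noteq> one"
  shows "dfun X fp x u $ j = dfun X fm x u $ j + a j x * dfun X \<mu> x u"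
proof -
  have xX: "x \<in> pts X" by (rule seamD(1)[OF x])
  interpret symplectic_subspace "model X" "\<omega> x" by (rule symplectic_subspace_at[OF symplectic xX])
  note hp = ham_vf[OF symplectic smooth_component[OF fp(1), of j] xX]
  note hm = ham_vf[OF symplectic smooth_component[OF fm(1), of j] xX]
  note h1 = ham_vf[OF symplectic moment_smooth xX]
  note l = linear_on_subspaceD[OF lin[OF u] E]
  have "dfun X fp x u $ j - dfun X fm x u $ j =
      \<omega> x (ham_vf X \<omega> (\<lambda>y. fp y $ j) x - ham_vf X \<omega> (\<lambda>y. fm y $ j) x) u"
    unfolding l(3)[OF hp(1) hm(1)] hp(2)[OF u] hm(2)[OF u] dfun_component[OF fp(1) xX u] dfun_component[OF fm(1) xX u] ..
  also have "\<dots> = a j x * dfun X \<mu> x u"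
    unfolding a_eq[OF j x] l(2)[OF h1(1) h1(1)] h1(2)[OF u] ..
  finally show ?thesis by simp
qed

text \<open>That the Hamiltonian fields of the components are tangent to the fibre is a Lagrangian
  property: by duality the kernel of dfp contains a vector v with \<omega>(v, .) equal to the j-th
  component of dfp, and nondegeneracy identifies it with the Hamiltonian field.\<close>

lemma ham_plus:
  assumes x: "x \<in> S"
  shows "ham_vf X \<omega> (\<lambda>y. fp y $ j) x \<in> model X"
    and "u \<in> model X \<Longrightarrow> \<omega> x (ham_vf X \<omega> (\<lambda>y. fp y $ j) x) u = dfun X fp x u $ j"
    and "dfun X fp x (ham_vf X \<omega> (\<lambda>y. fp y $ j) x) = 0"
proof -
  have xX: "x \<in> pts X" by (rule seamD(1)[OF x])
  have xP: "x \<in> half 1" by (rule seam_half[OF x])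
  interpret symplectic_subspace "model X" "\<omega> x" by (rule symplectic_subspace_at[OF symplectic xX])
  note h = ham_vf[OF symplectic smooth_component[OF fp(1), of j] xX]
  show "ham_vf X \<omega> (\<lambda>y. fp y $ j) x \<in> model X" by (rule h(1))
  show "\<omega> x (ham_vf X \<omega> (\<lambda>y. fp y $ j) x) u = dfun X fp x u $ j" if u: "u \<in> model X" for u
    using h(2)[OF u] unfolding dfun_component[OF fp(1) xX u] .
  have lin: "linear (dfun X fp x)" by (rule linear_dfun[OF XM fp(1) xX])
  have d: "dim (model X) = 2 * DIM(real^'n)" using manifold_chart(2)[OF XM] by simp
  obtain v where v: "v \<in> model X" "dfun X fp x v = 0" "\<And>u. u \<in> model X \<Longrightarrow> \<omega> x v u = axis j 1 \<bullet> dfun X fp x u"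
    using lagrangian_kernel(2)[OF lin fp(3)[OF xP] d, of "axis j 1"] half_isotropic[OF half_plus _ xP] by blast
  have "ham_vf X \<omega> (\<lambda>y. fp y $ j) x = v"
  proof (rule h(3)[OF v(1)])
    fix u assume u: "u \<in> model X"
    show "\<omega> x v u = dfun X (\<lambda>y. fp y $ j) x u"
      unfolding v(3)[OF u] dfun_component[OF fp(1) xX u] by (simp add: inner_axis' )
  qed
  then show "dfun X fp x (ham_vf X \<omega> (\<lambda>y. fp y $ j) x) = 0" using v(2) by simp
qed

text \<open>A Hamiltonian field depends on the differential only, and \<open>moment_plus\<close>
  gives equality of differentials on the seam. So the field of \<mu> can be treated as the member
  with index \<open>one\<close> of the family of the fields of \<open>fp\<close>.\<close>

lemma ham_moment: "x \<in> S \<Longrightarrow> ham_vf X \<omega> (\<lambda>y. fp y $ one) x = ham_vf X \<omega> \<mu> x"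
proof -
  assume x: "x \<in> S"
  have xX: "x \<in> pts X" by (rule seamD(1)[OF x])
  note h1 = ham_vf[OF symplectic moment_smooth xX]
  show ?thesis
  proof (rule ham_vf(3)[OF symplectic smooth_component[OF fp(1)] xX h1(1)])
    fix u assume u: "u \<in> model X"
    show "\<omega> x (ham_vf X \<omega> \<mu> x) u = dfun X (\<lambda>y. fp y $ one) x u"
      unfolding h1(2)[OF u] dfun_component[OF fp(1) xX u] moment_plus[OF x u] ..
  qed
qed

section \<open>The quotient of the seam and the reduced map \<open>fbar\<close>\<close>

lemma pushes_to_zero:
  assumes x: "x \<in> S"
  shows "pushes_to X Z Zbar p x (ham_vf X \<omega> \<mu> x) 0"
proof (rule action_pushes_to_zero[OF symplectic ham seam_mfd(1) _ BM quotient_map _ seamD(1)[OF x]])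
  show t: "\<theta> t x \<in> S" for t
    using f_invariant[OF seamD(1)[OF x]] action_pts[OF symplectic ham seamD(1)[OF x]] seamD(2)[OF x]
    unfolding seam_def by simp
  show "p (\<theta> t x) = p x" for t using quotient_orbit[OF x t[of t]] by metis
qed

text \<open>\<open>fbar\<close> is determined by its composition with p, so smoothness is read off
  through a local section of p. Along the section \<open>fbar\<close> is f on the seam, which equals
  the restriction of \<open>fp\<close>, a smooth map on X.\<close>

lemma fbar_smooth: "smooth_fun Zbar fbar"
  unfolding smooth_fun_def
proof (rule ballI)
  fix c assume cB: "c \<in> charts Zbar"
  have c: "smooth_chart Zbar c" by (rule manifold_chart(3)[OF BM cB])
  show "smooth_on (model Zbar) (snd c ` fst c) (fbar \<circ> coord_inv c)"
  proof (rule smooth_on_local[OF EB smooth_chartD(2)[OF c]])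
    fix y0 assume "y0 \<in> snd c ` fst c"
    then obtain z0 where z0: "z0 \<in> fst c" "y0 = snd c z0" by blast
    have "z0 \<in> p ` S" unfolding quotient_onto by (rule smooth_chart_pts[OF c z0(1)])
    then obtain x0 where x0: "x0 \<in> S" "z0 = p x0" by blast
    obtain k where k: "slice_chart X E1 S k" "x0 \<in> fst k" using slice_chart_at[OF XM seam_mfd(1) x0(1)] .
    let ?k = "(fst k \<inter> S, snd k)"
    have sk: "smooth_chart X k" by (rule slice_chart_smooth[OF XM seam_mfd(1) k(1)])
    have sk': "smooth_chart Z ?k" by (rule smooth_chart_submfd[OF XM seam_mfd(1) k(1)])
    have px0: "p x0 \<in> fst c" "x0 \<in> pts Z" "x0 \<in> fst ?k" "dmap Z Zbar p x0 ` model Z = model Zbar"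
      using z0 x0 k(2) quotient_surj[OF x0(1)] by simp_all
    obtain V s where V: "openin (top_of_set (model Zbar)) V" "snd c (p x0) \<in> V" "V \<subseteq> snd c ` fst c"
      "smooth_on (model Zbar) V s" "s ` V \<subseteq> snd ?k ` fst ?k" "s (snd c (p x0)) = snd ?k x0"
      "\<And>y. y \<in> V \<Longrightarrow> p (coord_inv ?k (s y)) = coord_inv c y"
      using submersion_section[OF ZM BM quotient_map px0(2,4) c px0(1) sk' px0(3)] by blast
    have sV: "s ` V \<subseteq> snd k ` fst k" using V(5) by auto
    have "smooth_on (model Zbar) V (\<lambda>y. (fp \<circ> coord_inv k) (s y))"
      by (rule smooth_on_compose[OF EB V(1) EX sV openin_imp_subset[OF smooth_chartD(2)[OF sk]] V(4)
            smooth_fun_chart[OF XM fp(1) sk]])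
    then have "smooth_on (model Zbar) V (fbar \<circ> coord_inv c)"
    proof (rule smooth_on_transform)
      fix y assume y: "y \<in> V"
      have sy: "s y \<in> snd k ` (fst k \<inter> S)" using V(5) y by auto
      have xy: "coord_inv ?k (s y) = coord_inv k (s y)"
        by (rule coord_inv_slice[OF XM seam_mfd(1) k(1) sy])
      have xS: "coord_inv k (s y) \<in> S" using coord_inv_in[OF sk'] V(5) y xy by force
      have "fbar (coord_inv c y) = f (coord_inv k (s y))" using V(7)[OF y] fbar[OF xS] xy by simp
      then show "(fp \<circ> coord_inv k) (s y) = (fbar \<circ> coord_inv c) y" using fp(2)[OF seam_half[OF xS]] by simp
    qed
    then show "\<exists>T. y0 \<in> T \<and> openin (top_of_set (model Zbar)) T \<and> T \<subseteq> snd c ` fst c \<and>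
        smooth_on (model Zbar) T (fbar \<circ> coord_inv c)"
      using V(1-3) z0(2) x0(2) by (intro exI[of _ V]) simp
  qed
qed

text \<open>Both sides are the differential of f restricted to the seam, written once as
  \<open>fbar\<close> after p and once as \<open>fp\<close> after the inclusion.\<close>

lemma dfun_fbar:
  assumes x: "x \<in> S" and u: "u \<in> E1"
  shows "dfun Zbar fbar (p x) (dmap Z Zbar p x u) = dfun X fp x (dmap Z X id x u)"
proof -
  have xZ: "x \<in> pts Z" and uZ: "u \<in> model Z" using x u by simp_all
  note k = chart_at[OF ZM xZ]
  have c: "chart_diff Z (chart_at Z x) (fp \<circ> id) x"
    using chart_at[OF XM seamD(1)[OF x]]
    by (intro map_chain(1)[OF ZM XM inc k(3) _ k(2) _ smooth_fun_diff[OF XM fp(1)]]) simp_all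
  have "chart_deriv Z (chart_at Z x) (fp \<circ> id) x u = chart_deriv Z (chart_at Z x) (fbar \<circ> p) x u"
  proof (rule chart_deriv_cong(2)[OF k(3) manifold_chart(1)[OF ZM] openin_subtopology_self xZ k(2) _ c uZ])
    fix z assume "z \<in> pts Z"
    then have z: "z \<in> S" by simp
    show "(fp \<circ> id) z = (fbar \<circ> p) z" using fp(2)[OF seam_half[OF z]] fbar[OF z] by simp
  qed
  then have "dfun Z (fp \<circ> id) x u = dfun Z (fbar \<circ> p) x u" unfolding dfun_eq[OF ZM xZ] .
  then show ?thesis
    using dfun_dmap[OF ZM BM quotient_map fbar_smooth xZ uZ] dfun_dmap[OF ZM XM inc fp(1) xZ uZ] by simp
qed

text \<open>\<mu> is constant on the seam, which gives one inclusion. Both spaces have dimension 2n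
  - 1 since d\<mu> is nonzero and the inclusion has injective differential.\<close>

lemma seam_tangent:
  assumes x: "x \<in> S"
  shows "dmap Z X id x ` E1 = {u \<in> model X. dfun X \<mu> x u = 0}"
proof -
  have xX: "x \<in> pts X" by (rule seamD(1)[OF x])
  have xZ: "x \<in> pts Z" using x by simp
  let ?J = "dmap Z X id x" and ?K = "{u \<in> model X. dfun X \<mu> x u = 0}"
  have linJ: "linear ?J" by (rule linear_dmap[OF ZM XM inc xZ])
  have lin\<mu>: "linear (dfun X \<mu> x)" by (rule linear_dfun[OF XM moment_smooth xX])
  have K: "subspace ?K"
    using EX by (auto simp: subspace_def linear_0[OF lin\<mu>] linear_add[OF lin\<mu>] linear_scale[OF lin\<mu>])
  have JK: "?J ` E1 \<subseteq> ?K"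
  proof
    fix w assume "w \<in> ?J ` E1"
    then obtain u where u: "u \<in> E1" "w = ?J u" by blast
    have uZ: "u \<in> model Z" using u by simp
    have "dfun X \<mu> (id x) (?J u) = dfun Z (\<mu> \<circ> id) x u"
      by (rule dfun_dmap[OF ZM XM inc moment_smooth xZ uZ])
    also have "\<dots> = 0" by (rule dfun_const_on[OF ZM xZ uZ, of _ 0]) (simp add: seamD(2))
    finally show "w \<in> ?K" using dmap_in[OF ZM XM inc xZ uZ] u(2) by simp
  qed
  have inj: "inj_on ?J E1"
  proof (rule inj_onI)
    fix y z assume yz: "y \<in> E1" "z \<in> E1" "?J y = ?J z"
    then have "?J (y - z) = 0" using linear_diff[OF linJ] by simp
    then have "y - z = 0"
      by (rule dmap_inclusion_eq_0[OF XM seam_mfd(1) x subspace_diff[OF E1X(1) yz(1,2)]])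
    then show "y = z" by simp
  qed
  have sp: "span E1 = E1" using E1X(1) by (rule span_eq_iff[THEN iffD2])
  have dJ: "dim (?J ` E1) = 2 * CARD('n) - 1"
    using dim_image_eq[OF linJ, of E1] inj seam_mfd(2) unfolding sp by simp
  obtain w where w: "w \<in> model X" "dfun X \<mu> x w \<noteq> 0" using moment_regular[OF xX] .
  have "dfun X \<mu> x ` model X = UNIV"
  proof (intro equalityI subsetI UNIV_I)
    fix r :: real
    have "dfun X \<mu> x ((r / dfun X \<mu> x w) *\<^sub>R w) = r" using w(2) by (simp add: linear_scale[OF lin\<mu>])
    then show "r \<in> dfun X \<mu> x ` model X"
      using subspace_scale[OF EX w(1), of "r / dfun X \<mu> x w"] by (metis imageI)
  qed
  then have "dim ?K + 1 = 2 * CARD('n)"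
    using rank_nullity_on[OF EX lin\<mu>] manifold_chart(2)[OF XM] by simp
  then show ?thesis
    using subspace_dim_equal[OF linear_subspace_image[OF linJ E1X(1)] K JK] dJ by simp
qed

text \<open>The tangent space of the seam is ker d\<mu>, the full preimage under dfp of the
  hyperplane b_1 = 0, and dfp is onto.\<close>

lemma dfun_fbar_image:
  assumes z: "z \<in> pts Zbar"
  shows "dfun Zbar fbar z ` model Zbar = {b. b $ one = 0}"
proof -
  obtain x where x: "x \<in> S" "z = p x" using z unfolding quotient_onto[symmetric] by blast
  have "dfun Zbar fbar z ` model Zbar = dfun X fp x ` dmap Z X id x ` E1"
    unfolding quotient_surj[OF x(1), symmetric] x(2) image_image using dfun_fbar[OF x(1)] by simp
  also have "\<dots> = {b. b $ one = 0}" unfolding seam_tangent[OF x(1)]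
  proof (intro equalityI subsetI)
    fix b assume "b \<in> dfun X fp x ` {u \<in> model X. dfun X \<mu> x u = 0}"
    then show "b \<in> {b. b $ one = 0}" using moment_plus[OF x(1)] by auto
  next
    fix b :: "real^'n" assume b: "b \<in> {b. b $ one = 0}"
    have "b \<in> dfun X fp x ` model X" unfolding fp(3)[OF seam_half[OF x(1)]] by simp
    then obtain u where u: "u \<in> model X" "b = dfun X fp x u" by blast
    then have "dfun X \<mu> x u = 0" using moment_plus[OF x(1) u(1)] b by simp
    then show "b \<in> dfun X fp x ` {u \<in> model X. dfun X \<mu> x u = 0}" using u by blast
  qed
  finally show ?thesis .
qed

lemma subspace_wall: "subspace {b :: real^'n. b $ one = 0}"
  by (simp add: subspace_def)

lemma dim_wall: "dim {b :: real^'n. b $ one = 0} + 1 = CARD('n)"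
proof -
  have l: "linear (\<lambda>b :: real^'n. b $ one)" using bounded_linear_vec_nth bounded_linear.linear by blast
  have "range (\<lambda>b :: real^'n. b $ one) = UNIV"
    by (rule surjI[of _ "\<lambda>r. axis one r"]) simp
  then show ?thesis using rank_nullity_on[OF subspace_UNIV l] by simp
qed

text \<open>The quotient has dimension 2n - 2 and the differential of \<open>fbar\<close> has rank n
  - 1, so any subspace of dimension n - 1 of the model is admissible.\<close>

lemma fibre_submanifold:
  assumes b: "b $ one = 0"
  obtains E0 where "embedded_submanifold Zbar E0 {z \<in> pts Zbar. fbar z = b}"
proof -
  have d: "dim (model Zbar) = 2 * (CARD('n) - 1)"
    using manifold_chart(2)[OF BM] seam_mfd(2) by simp
  then obtain E0 where E0: "subspace E0" "E0 \<subseteq> span (model Zbar)" "dim E0 = CARD('n) - 1"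
    using choose_subspace_of_subspace[of "CARD('n) - 1" "model Zbar"] by auto
  have sp: "span (model Zbar) = model Zbar" using EB by (rule span_eq_iff[THEN iffD2])
  have "embedded_submanifold Zbar E0 {z \<in> pts Zbar. fbar z = b}"
  proof (rule level_set_submanifold[OF BM fbar_smooth subspace_wall _ dfun_fbar_image E0(1)])
    fix z assume "z \<in> pts Zbar"
    then obtain x where "x \<in> S" "z = p x" unfolding quotient_onto[symmetric] by blast
    then show "fbar z - b \<in> {b. b $ one = 0}" using fbar seamD(2) b by simp
  next
    show "E0 \<subseteq> model Zbar" using E0(2) sp by simp
    show "dim E0 + dim {b :: real^'n. b $ one = 0} = dim (model Zbar)" using E0(3) dim_wall d by simp
  qed
  then show ?thesis using that by blast
qed

text \<open>Write \<open>\<omega>(v, \<cdot>) = \<Sum>\<^sub>j c\<^sub>j dfp\<^sub>j\<close>, so that \<open>v = \<Sum>\<^sub>j c\<^sub>j \<eta>\<^sub>j\<close>. Expanding with respect to \<open>dfm\<close> instead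
  changes only the first coefficient, by \<open>\<Sum>\<^sub>j c\<^sub>j a\<^sub>j = \<ell>\<^sub>1(p\<^sub>* v)\<close>; first coefficients are
  evaluations on vectors over \<open>e\<^sub>1\<close>.\<close>

lemma ell_as_difference:
  assumes x: "x \<in> S" and push: "pushes_to X Z Zbar p x v w" and w: "w \<in> ker_dfun Zbar fbar (p x)"
    and Wp: "Wp \<in> model X" "dfun X fp x Wp = axis one 1"
    and Wm: "Wm \<in> model X" "dfun X fm x Wm = axis one 1"
  shows "ell (p x) w = \<omega> x v Wm - \<omega> x v Wp"
proof -
  have xX: "x \<in> pts X" by (rule seamD(1)[OF x])
  have xZ: "x \<in> pts Z" using x by simp
  have xP: "x \<in> half 1" by (rule seam_half[OF x])
  interpret symplectic_subspace "model X" "\<omega> x" by (rule symplectic_subspace_at[OF symplectic xX])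
  let ?J = "dmap Z X id x" and ?P = "dmap Z Zbar p x" and ?h = "\<lambda>j. ham_vf X \<omega> (\<lambda>y. fp y $ j) x"
  have linJ: "linear ?J" by (rule linear_dmap[OF ZM XM inc xZ])
  have linP: "linear ?P" by (rule linear_dmap[OF ZM BM quotient_map xZ])
  have linfp: "linear (dfun X fp x)" by (rule linear_dfun[OF XM fp(1) xX])
  have px: "p x \<in> pts Zbar" using x unfolding quotient_onto[symmetric] by simp
  have linfb: "linear (dfun Zbar fbar (p x))" by (rule linear_dfun[OF BM fbar_smooth px])
  obtain u where u: "u \<in> E1" "?J u = v" "?P u = w" using push unfolding pushes_to_def by auto
  have vX: "v \<in> model X" using dmap_in[OF ZM XM inc xZ, of u] u by simp
  have v0: "dfun X fp x v = 0" using dfun_fbar[OF x u(1)] u w unfolding ker_dfun_def by simp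
  have d: "dim (model X) = 2 * DIM(real^'n)" using manifold_chart(2)[OF XM] by simp
  obtain c where c: "\<And>u. u \<in> model X \<Longrightarrow> \<omega> x v u = c \<bullet> dfun X fp x u"
    using lagrangian_kernel(1)[OF linfp fp(3)[OF xP] d half_isotropic[OF half_plus _ xP] vX v0] by blast
  have cj: "c \<bullet> y = (\<Sum>j\<in>UNIV. c $ j * y $ j)" for y by (simp add: inner_vec_def)
  \<comment> \<open>Lifts of the Hamiltonian fields to the tangent space of the seam, on which the
    pushforward by p is defined. The generator of the action lifts to a vector that p sends to
    0.\<close>
  have "\<exists>U. \<forall>j. U j \<in> E1 \<and> ?J (U j) = ?h j \<and> ?P (U j) = (if j = one then 0 else etabar j (p x))"
  proof (rule choice, rule allI)
    fix j
    show "\<exists>y. y \<in> E1 \<and> ?J y = ?h j \<and> ?P y = (if j = one then 0 else etabar j (p x))"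
    proof (cases "j = one")
      case True
      then show ?thesis using pushes_to_zero[OF x] ham_moment[OF x] unfolding pushes_to_def by auto
    next
      case False
      then show ?thesis using etabar_plus[OF False x] unfolding pushes_to_def by auto
    qed
  qed
  then obtain U where U: "\<And>j. U j \<in> E1" "\<And>j. ?J (U j) = ?h j"
    "\<And>j. ?P (U j) = (if j = one then 0 else etabar j (p x))" by blast
  have hv: "v = (\<Sum>j\<in>UNIV. c $ j *\<^sub>R ?h j)"
  proof (rule dual_unique[OF vX])
    show hE: "(\<Sum>j\<in>UNIV. c $ j *\<^sub>R ?h j) \<in> model X"
      by (rule subspace_sum[OF E], rule subspace_scale[OF E], rule ham_plus(1)[OF x])
    fix y assume y: "y \<in> model X"
    \<comment> \<open>\<open>\<omega> x\<close> is additive only on the model; composed with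
      \<open>orth_proj\<close> it becomes linear on the whole space, so that it can be taken through
      the sum.\<close>
    have l: "linear (\<lambda>z. \<omega> x (orth_proj (model X) z) y)" by (rule linear_on_subspace_orth_proj[OF E lin[OF y]])
    have "\<omega> x (\<Sum>j\<in>UNIV. c $ j *\<^sub>R ?h j) y = \<omega> x (orth_proj (model X) (\<Sum>j\<in>UNIV. c $ j *\<^sub>R ?h j)) y"
      unfolding orth_proj_eq[OF E hE] ..
    also have "\<dots> = (\<Sum>j\<in>UNIV. c $ j * \<omega> x (orth_proj (model X) (?h j)) y)"
      by (simp add: linear_sum[OF l] linear_scale[OF l])
    also have "\<dots> = (\<Sum>j\<in>UNIV. c $ j * dfun X fp x y $ j)"
      unfolding orth_proj_eq[OF E ham_plus(1)[OF x]] ham_plus(2)[OF x y] ..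
    finally show "\<omega> x v y = \<omega> x (\<Sum>j\<in>UNIV. c $ j *\<^sub>R ?h j) y" unfolding c[OF y] cj by simp
  qed
  let ?s = "\<Sum>j\<in>UNIV. c $ j *\<^sub>R U j"
  have sE: "?s \<in> E1" by (rule subspace_sum[OF E1X(1)], rule subspace_scale[OF E1X(1)], rule U(1))
  have "?J ?s = v" unfolding hv by (simp add: linear_sum[OF linJ] linear_scale[OF linJ] U(2))
  \<comment> \<open>The differential of the inclusion is injective, so u itself is the combination
    of the lifts, and p can be applied to each of them.\<close>
  then have "?J (u - ?s) = 0" using u(2) by (simp add: linear_diff[OF linJ])
  then have "u - ?s = 0"
    by (rule dmap_inclusion_eq_0[OF XM seam_mfd(1) x subspace_diff[OF E1X(1) u(1) sE]])
  then have us: "u = ?s" by simp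
  let ?K = "ker_dfun Zbar fbar (p x)"
  have K: "subspace ?K"
    using EB unfolding ker_dfun_def
    by (auto simp: subspace_def linear_0[OF linfb] linear_add[OF linfb] linear_scale[OF linfb])
  have PK: "?P (U j) \<in> ?K" for j
    unfolding ker_dfun_def
    using dfun_fbar[OF x U(1), of j] ham_plus(3)[OF x] U(2) dmap_in[OF ZM BM quotient_map xZ, of "U j"] U(1) by simp
  have ls: "linear_on_subspace ?K (ell (p x))" by (rule ell_section[OF px])
  have ells: "ell (p x) (\<Sum>j\<in>I. c $ j *\<^sub>R ?P (U j)) = (\<Sum>j\<in>I. c $ j * ell (p x) (?P (U j)))"
    if "finite I" for I
    using that
  proof (induction I rule: finite_induct)
    case empty
    show ?case using linear_on_subspaceD(4)[OF ls K subspace_0[OF K] subspace_0[OF K]] by simp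
  next
    case (insert i I)
    have 1: "c $ i *\<^sub>R ?P (U i) \<in> ?K" by (rule subspace_scale[OF K PK])
    have 2: "(\<Sum>j\<in>I. c $ j *\<^sub>R ?P (U j)) \<in> ?K" by (rule subspace_sum[OF K], rule subspace_scale[OF K PK])
    show ?case
      using insert linear_on_subspaceD(1)[OF ls K 1 2] linear_on_subspaceD(2)[OF ls K PK PK] by simp
  qed
  have ell0: "ell (p x) 0 = 0" using linear_on_subspaceD(4)[OF ls K subspace_0[OF K] subspace_0[OF K]] .
  have "w = (\<Sum>j\<in>UNIV. c $ j *\<^sub>R ?P (U j))"
    unfolding u(3)[symmetric] us by (simp add: linear_sum[OF linP] linear_scale[OF linP])
  then have "ell (p x) w = (\<Sum>j\<in>UNIV. c $ j * (if j = one then 0 else a j x))"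
    unfolding U(3) using ells[of UNIV] ell0 ell_def[OF _ x] unfolding U(3) by (auto intro!: sum.cong)
  moreover have "\<omega> x v Wp = c $ one"
    unfolding c[OF Wp(1)] Wp(2) by (simp add: inner_axis)
  \<comment> \<open>On \<open>Wm\<close> the differential of \<mu> is 1 and the other components of
    dfm vanish, so the j-th component of dfp is \<open>a j x\<close>.\<close>
  moreover have "\<omega> x v Wm = (\<Sum>j\<in>UNIV. c $ j * (if j = one then 1 else a j x))"
    unfolding c[OF Wm(1)] cj
  proof (intro sum.cong refl)
    fix j
    have \<mu>: "dfun X \<mu> x Wm = 1" using moment_minus[OF x Wm(1)] Wm(2) by simp
    show "c $ j * dfun X fp x Wm $ j = c $ j * (if j = one then 1 else a j x)"
      using moment_plus[OF x Wm(1)] plus_minus_derivative[OF x Wm(1), of j] \<mu> Wm(2)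
      by (auto simp: axis_def)
  qed
  moreover have "(\<Sum>j\<in>UNIV. c $ j * (if j = one then 1 else a j x)) =
      c $ one + (\<Sum>j\<in>UNIV. c $ j * (if j = one then 0 else a j x))"
    by (simp add: sum.remove[of UNIV one])
  ultimately show ?thesis by simp
qed

text \<open>The transversal direction is \<sigma> e_1, so that \<sigma> \<mu> grows at rate \<sigma>
  \<sigma> = 1 along it and it points into the half at hand. The fibre patch is given by a
  parametrization \<phi> in a chart of X; it need not fill a fibre of f, being a lift of a patch of
  the quotient.\<close>

lemma half_closed:
  assumes half: "lagrangian_half X \<omega> (half \<sigma>) f g" and \<sigma>: "\<sigma> * \<sigma> = 1"
    and k: "k \<in> charts X" and E0: "subspace E0" "openin (top_of_set E0) V"
    and \<phi>: "smooth_on E0 V \<phi>" "\<phi> ` V \<subseteq> snd k ` fst k" "\<And>y. y \<in> V \<Longrightarrow> coord_inv k (\<phi> y) \<in> S"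
      "\<And>y. y \<in> V \<Longrightarrow> f (coord_inv k (\<phi> y)) = b"
    and y0: "y0 \<in> (V :: 'd set)"
  obtains V' W where "openin (top_of_set E0) V'" "y0 \<in> V'" "V' \<subseteq> V" "\<And>y. y \<in> V' \<Longrightarrow> W y \<in> model X"
    "\<And>y. y \<in> V' \<Longrightarrow> dfun X g (coord_inv k (\<phi> y)) (coord_vec X k (coord_inv k (\<phi> y)) (W y)) = axis one \<sigma>"
    "\<And>u. u \<in> E0 \<Longrightarrow> smooth_on E0 V' (\<lambda>y. coeff2 X \<omega> k (frechet_derivative \<phi> (at y within V) u) (W y) (\<phi> y))"
    "\<And>y u v. y \<in> V' \<Longrightarrow> u \<in> E0 \<Longrightarrow> v \<in> E0 \<Longrightarrow>
       frechet_derivative (\<lambda>y. coeff2 X \<omega> k (frechet_derivative \<phi> (at y within V) u) (W y) (\<phi> y)) (at y within V') v =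
       frechet_derivative (\<lambda>y. coeff2 X \<omega> k (frechet_derivative \<phi> (at y within V) v) (W y) (\<phi> y)) (at y within V') u"
proof -
  note g = lagrangian_halfD[OF half]
  have sk: "smooth_chart X k" by (rule manifold_chart(3)[OF XM k])
  interpret form: closed_form_on_subspace "model X" "snd k ` fst k" "\<lambda>y u v. coeff2 X \<omega> k u v y"
    by (rule closed_form_on_chart[OF symplectic k])
  let ?G = "g \<circ> coord_inv k"
  have dG: "frechet_derivative ?G (at y within snd k ` fst k) u =
      dfun X g (coord_inv k y) (coord_vec X k (coord_inv k y) u)"
    if "y \<in> snd k ` fst k" "u \<in> model X" for y u
    unfolding frechet_derivative_chart[OF sk that(1)]
    by (rule dfun_coord_vec[OF XM g(1) sk coord_inv_in[OF sk that(1)] that(2), symmetric])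
  have \<phi>k: "\<phi> y \<in> snd k ` fst k" if "y \<in> V" for y using \<phi>(2) that by blast
  obtain V' W where V': "openin (top_of_set E0) V'" "y0 \<in> V'" "V' \<subseteq> V" "\<And>y. y \<in> V' \<Longrightarrow> W y \<in> model X"
    "\<And>y. y \<in> V' \<Longrightarrow> frechet_derivative ?G (at (\<phi> y) within snd k ` fst k) (W y) = axis one \<sigma>"
    "\<And>u. u \<in> E0 \<Longrightarrow> smooth_on E0 V' (\<lambda>y. coeff2 X \<omega> k (frechet_derivative \<phi> (at y within V) u) (W y) (\<phi> y))"
    "\<And>y u v. y \<in> V' \<Longrightarrow> u \<in> E0 \<Longrightarrow> v \<in> E0 \<Longrightarrow>
       frechet_derivative (\<lambda>y. coeff2 X \<omega> k (frechet_derivative \<phi> (at y within V) u) (W y) (\<phi> y)) (at y within V') v =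
       frechet_derivative (\<lambda>y. coeff2 X \<omega> k (frechet_derivative \<phi> (at y within V) v) (W y) (\<phi> y)) (at y within V') u"
  proof (rule form.closed_along_fibre[where g = ?G and \<phi> = \<phi> and P = "snd k ` (fst k \<inter> half \<sigma>)" and b = b
        and e = "axis one \<sigma>" and ?E0.0 = E0 and V = V and ?y0.0 = y0])
    show "smooth_on (model X) (snd k ` fst k) ?G" by (rule smooth_fun_chart[OF XM g(1) sk])
    show "coeff2 X \<omega> k u v y = 0" if y: "y \<in> snd k ` fst k" "y \<in> snd k ` (fst k \<inter> half \<sigma>)"
      and uv: "u \<in> model X" "v \<in> model X"
      and 0: "frechet_derivative ?G (at y within snd k ` fst k) u = 0"
        "frechet_derivative ?G (at y within snd k ` fst k) v = 0" for y u v
    proof -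
      obtain z where z: "z \<in> fst k" "z \<in> half \<sigma>" "y = snd k z" using y(2) by blast
      have "coord_inv k y \<in> half \<sigma>" using coord_inv_snd[OF sk z(1)] z by simp
      then show ?thesis unfolding coeff2_def Let_def
        by (intro half_isotropic[OF half] coord_vec_in[OF XM sk coord_inv_in[OF sk y(1)]] uv)
          (use 0 dG[OF y(1)] uv in auto)
    qed
    show "?G (\<phi> y) = b" if "y \<in> V" for y
      using g(2)[OF seam_half[OF \<phi>(3)[OF that]]] \<phi>(4)[OF that] by simp
    show "frechet_derivative ?G (at (\<phi> y0) within snd k ` fst k) ` model X = UNIV"
    proof (intro equalityI subsetI UNIV_I)
      fix r :: "real^'n"
      let ?x = "coord_inv k (\<phi> y0)"
      have xk: "?x \<in> fst k" by (rule coord_inv_in[OF sk \<phi>k[OF y0]])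
      have "r \<in> dfun X g ?x ` model X" unfolding g(3)[OF seam_half[OF \<phi>(3)[OF y0]]] by simp
      then obtain v where v: "v \<in> model X" "r = dfun X g ?x v" by blast
      obtain u where "u \<in> model X" "coord_vec X k ?x u = v" using coord_vec_surj[OF XM sk xk v(1)] .
      then show "r \<in> frechet_derivative ?G (at (\<phi> y0) within snd k ` fst k) ` model X"
        using dG[OF \<phi>k[OF y0]] v(2) by (intro image_eqI[of _ _ u]) simp_all
    qed
    show "\<forall>\<^sub>F t in at_right 0. c t \<in> snd k ` (fst k \<inter> half \<sigma>)"
      if y: "y \<in> V" and c: "(c has_vector_derivative v) (at 0)" "c 0 = \<phi> y" "range c \<subseteq> model X" "v \<in> model X"
        and d: "frechet_derivative ?G (at (\<phi> y) within snd k ` fst k) v = axis one \<sigma>" for y c v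
    proof -
      let ?x = "coord_inv k (\<phi> y)"
      have xk: "?x \<in> fst k" by (rule coord_inv_in[OF sk \<phi>k[OF y]])
      have cE: "coord_vec X k ?x v \<in> model X" by (rule coord_vec_in[OF XM sk xk c(4)])
      have "chart_deriv X k \<mu> ?x v = dfun X \<mu> ?x (coord_vec X k ?x v)"
        by (rule dfun_coord_vec[OF XM moment_smooth sk xk c(4), symmetric])
      also have "\<dots> = dfun X g ?x (coord_vec X k ?x v) $ one"
        by (rule moment_derivative[OF half _ \<phi>(3)[OF y] cE, symmetric]) (use \<sigma> in auto)
      also have "\<dots> = axis one \<sigma> $ one" using dG[OF \<phi>k[OF y] c(4)] d by simp
      also have "\<dots> = \<sigma>" by simp
      finally have pos: "0 < \<sigma> * chart_deriv X k \<mu> ?x v" using \<sigma> by simp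
      have "c 0 = snd k ?x" using c(2) snd_coord_inv[OF sk \<phi>k[OF y]] by simp
      then show ?thesis by (rule curve_enters_half[OF sk xk \<phi>(3)[OF y] c(1) _ c(3) pos])
    qed
  qed (use E0 \<phi> y0 in blast)+
  show ?thesis
  proof (rule that[OF V'(1-4) _ V'(6,7)])
    fix y assume y: "y \<in> V'"
    then have "y \<in> V" using V'(3) by blast
    then show "dfun X g (coord_inv k (\<phi> y)) (coord_vec X k (coord_inv k (\<phi> y)) (W y)) = axis one \<sigma>"
      using dG[OF \<phi>k V'(4)[OF y]] V'(5)[OF y] by simp
  qed
qed

end


section \<open>Closedness on the fibres of the reduced map\<close>

context stitched_seam
begin

lemma fibre_tangent_ker:
  assumes F: "embedded_submanifold Zbar E0 {z \<in> pts Zbar. fbar z = b}"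
    and z: "z \<in> pts Zbar" "fbar z = b" and u: "u \<in> E0"
  shows "dmap (submfd Zbar E0 {z \<in> pts Zbar. fbar z = b}) Zbar id z u \<in> ker_dfun Zbar fbar z"
proof -
  let ?F = "{z \<in> pts Zbar. fbar z = b}"
  let ?M = "submfd Zbar E0 ?F"
  note FM = smooth_manifold_submfd[OF BM F] and incF = smooth_map_inclusion[OF BM F]
  have zM: "z \<in> pts ?M" and uM: "u \<in> model ?M" using z u by simp_all
  have "dfun Zbar fbar (id z) (dmap ?M Zbar id z u) = dfun ?M (fbar \<circ> id) z u"
    by (rule dfun_dmap[OF FM BM incF fbar_smooth zM uM])
  also have "\<dots> = 0" by (rule dfun_const_on[OF FM zM uM, of _ b]) simp
  finally show ?thesis
    unfolding ker_dfun_def using dmap_in[OF FM BM incF zM uM] by simp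
qed

text \<open>Through a local section of the quotient map, a coordinate patch of a fibre of \<open>fbar\<close> lifts to a
  fibre of \<open>f\<close> in the seam, where both one-sided closedness statements apply.\<close>

lemma local_closed_form:
  assumes b: "b $ one = 0"
    and F: "embedded_submanifold Zbar E0 {z \<in> pts Zbar. fbar z = b}"
    and c: "slice_chart Zbar E0 {z \<in> pts Zbar. fbar z = b} c"
    and y0: "y0 \<in> snd c ` (fst c \<inter> {z \<in> pts Zbar. fbar z = b})"
  obtains V' B where "openin (top_of_set E0) V'" "y0 \<in> V'"
    "V' \<subseteq> snd c ` (fst c \<inter> {z \<in> pts Zbar. fbar z = b})"
    "\<And>u. u \<in> E0 \<Longrightarrow> smooth_on E0 V' (B u)"
    "\<And>u y. u \<in> E0 \<Longrightarrow> y \<in> V' \<Longrightarrow> ell (coord_inv c y) (coord_vec Zbar c (coord_inv c y) u) = B u y"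
    "\<And>u v y. u \<in> E0 \<Longrightarrow> v \<in> E0 \<Longrightarrow> y \<in> V' \<Longrightarrow>
       frechet_derivative (B u) (at y within V') v = frechet_derivative (B v) (at y within V') u"
proof -
  let ?F = "{z \<in> pts Zbar. fbar z = b}"
  let ?T = "snd c ` (fst c \<inter> ?F)"
  note E0 = submanifold_model[OF BM F]
  have sc: "smooth_chart Zbar c" by (rule slice_chart_smooth[OF BM F c])
  obtain z0 where z0: "z0 \<in> fst c" "z0 \<in> ?F" "y0 = snd c z0" using y0 by blast
  have "z0 \<in> p ` S" unfolding quotient_onto using z0(2) by simp
  then obtain x0 where x0: "x0 \<in> S" "z0 = p x0" by blast
  obtain k where k: "slice_chart X E1 S k" "x0 \<in> fst k" using slice_chart_at[OF XM seam_mfd(1) x0(1)] .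
  let ?k = "(fst k \<inter> S, snd k)"
  have sk: "smooth_chart X k" by (rule slice_chart_smooth[OF XM seam_mfd(1) k(1)])
  have sk': "smooth_chart Z ?k" by (rule smooth_chart_submfd[OF XM seam_mfd(1) k(1)])
  \<comment> \<open>\<open>half_closed\<close> is stated for charts of the atlas, while k is a slice
    chart and only known to be compatible with it.\<close>
  define h where "h = chart_at X x0"
  have h: "h \<in> charts X" "x0 \<in> fst h" "smooth_chart X h"
    unfolding h_def using chart_at[OF XM seamD(1)[OF x0(1)]] by blast+
  have px0: "p x0 \<in> fst c" "x0 \<in> pts Z" "x0 \<in> fst ?k" "dmap Z Zbar p x0 ` model Z = model Zbar"
    using z0 x0 k(2) quotient_surj[OF x0(1)] by simp_all
  obtain V1 s where V1: "openin (top_of_set (model Zbar)) V1" "snd c (p x0) \<in> V1" "V1 \<subseteq> snd c ` fst c"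
    "smooth_on (model Zbar) V1 s" "s ` V1 \<subseteq> snd ?k ` fst ?k" "s (snd c (p x0)) = snd ?k x0"
    "\<And>y. y \<in> V1 \<Longrightarrow> p (coord_inv ?k (s y)) = coord_inv c y"
    using submersion_section[OF ZM BM quotient_map px0(2,4) sc px0(1) sk' px0(3)] by blast
  let ?W = "snd k ` (fst k \<inter> fst h)"
  have W: "openin (top_of_set (model X)) ?W"
    by (rule chart_image_openin[OF sk openin_Int[OF smooth_chartD(1)[OF sk] smooth_chartD(1)[OF h(3)]] Int_lower1])
  have s_in: "s y \<in> snd k ` (fst k \<inter> S)" if "y \<in> V1" for y using V1(5) that by auto
  have E1k: "snd k ` (fst k \<inter> S) \<subseteq> E1" using slice_image[OF XM seam_mfd(1) k(1)] by blast
  \<comment> \<open>E0 cuts out the fibre from the domain of the section, and the preimage of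
    \<open>?W\<close> keeps the lift inside the domain of h.\<close>
  define V where "V = (V1 \<inter> E0) \<inter> s -` ?W"
  have V: "openin (top_of_set E0) V"
  proof -
    obtain O' where O': "open O'" "V1 = model Zbar \<inter> O'" using V1(1) by (auto simp: openin_open)
    have 1: "openin (top_of_set E0) (V1 \<inter> E0)"
      unfolding openin_open using O' E0(2) by (intro exI[of _ O']) blast
    have cs: "continuous_on (V1 \<inter> E0) s"
      by (rule continuous_on_subset[OF smooth_on_continuous[OF V1(4)] Int_lower1])
    have "openin (top_of_set (V1 \<inter> E0)) V" unfolding V_def
      by (rule continuous_openin_preimage[OF cs _ W]) (use s_in E1k E1X(2) in blast)
    then show ?thesis by (rule openin_trans[OF _ 1])
  qed
  have VV1: "V \<subseteq> V1" and VE0: "V \<subseteq> E0" unfolding V_def by blast+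
  have VT: "V \<subseteq> ?T" unfolding slice_image[OF BM F c] using VV1 VE0 V1(3) by blast
  have y0V: "y0 \<in> V"
  proof -
    have "y0 \<in> E0" using y0 slice_image[OF BM F c] by blast
    moreover have "y0 \<in> V1" using V1(2) z0(3) x0(2) by simp
    moreover have "s y0 \<in> ?W" using V1(6) z0(3) x0(2) k(2) h(2) by simp
    ultimately show ?thesis unfolding V_def by blast
  qed
  define x where "x y = coord_inv k (s y)" for y
  define \<phi> where "\<phi> y = (snd h \<circ> coord_inv k) (s y)" for y
  have xk: "x y \<in> fst k" "x y \<in> fst h" "x y \<in> S" "s y = snd k (x y)" "coord_inv ?k (s y) = x y" "p (x y) = coord_inv c y"
    "\<phi> y = snd h (x y)" "coord_inv h (\<phi> y) = x y" "coord_inv c y \<in> fst c" "coord_inv c y \<in> ?F" "f (x y) = b"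
    if y: "y \<in> V" for y
  proof -
    have yV1: "y \<in> V1" using y VV1 by blast
    obtain z where z: "z \<in> fst k \<inter> S" "s y = snd k z" using s_in[OF yV1] by blast
    have xz: "x y = z" unfolding x_def z(2) using coord_inv_snd[OF sk] z(1) by blast
    show 1: "x y \<in> fst k" "x y \<in> S" "s y = snd k (x y)" unfolding xz using z by blast+
    obtain z' where z': "z' \<in> fst k \<inter> fst h" "s y = snd k z'" using y unfolding V_def by blast
    have "x y = z'" unfolding x_def z'(2) using coord_inv_snd[OF sk] z'(1) by blast
    then show 2: "x y \<in> fst h" using z'(1) by blast
    show 3: "coord_inv ?k (s y) = x y"
      unfolding x_def by (rule coord_inv_slice[OF XM seam_mfd(1) k(1) s_in[OF yV1]])
    show 4: "p (x y) = coord_inv c y" using V1(7)[OF yV1] unfolding 3 .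
    show 5: "\<phi> y = snd h (x y)" unfolding \<phi>_def x_def by simp
    show "coord_inv h (\<phi> y) = x y" unfolding 5 by (rule coord_inv_snd[OF h(3) 2])
    obtain q where q: "q \<in> fst c \<inter> ?F" "y = snd c q" using VT y by blast
    have "coord_inv c y = q" unfolding q(2) using coord_inv_snd[OF sc] q(1) by blast
    then show 6: "coord_inv c y \<in> fst c" "coord_inv c y \<in> ?F" using q(1) by blast+
    show "f (x y) = b" using fbar[OF 1(2)] 4 6(2) by simp
  qed
  have smtr: "smooth_on (model X) ?W (snd h \<circ> coord_inv k)"
    by (rule smooth_transition_charts[OF XM sk h(3)])
  have sms: "smooth_on E0 V s" by (rule smooth_on_mono[OF V1(4) E0(2) VV1])
  have sm\<phi>: "smooth_on E0 V \<phi>" unfolding \<phi>_def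
    by (rule smooth_on_compose[OF E0(1) V EX _ openin_imp_subset[OF W] sms smtr])
      (unfold V_def, blast)
  have \<phi>h: "\<phi> ` V \<subseteq> snd h ` fst h" using xk(2,7) by blast
  have \<phi>S: "coord_inv h (\<phi> y) \<in> S" if "y \<in> V" for y using xk(3,8)[OF that] by simp
  have \<phi>b: "f (coord_inv h (\<phi> y)) = b" if "y \<in> V" for y using xk(8,11)[OF that] by simp
  have \<phi>X: "\<phi> ` V \<subseteq> model X" by (rule subset_trans[OF \<phi>h openin_imp_subset[OF smooth_chartD(2)[OF h(3)]]])
  let ?D = "\<lambda>y u. frechet_derivative \<phi> (at y within V) u"
  have D_in: "?D y u \<in> model X" if "y \<in> V" "u \<in> E0" for y u
    by (rule has_derivative_in_subspace[OF E0(1) V that smooth_on_has_derivative[OF sm\<phi> that(1)] EX \<phi>X])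
  \<comment> \<open>The section inverts p in coordinates, so the lifted vector \<open>Ds u\<close>
    projects back to u (\<open>D2\<close>), while the transition from k to h turns it into the
    derivative of \<phi> (\<open>D1\<close>).\<close>
  have push: "pushes_to X Z Zbar p (x y) (coord_vec X h (x y) (?D y u)) (coord_vec Zbar c (coord_inv c y) u)"
    if y: "y \<in> V" and u: "u \<in> E0" for y u
  proof -
    note xy = xk[OF y]
    have yV1: "y \<in> V1" using y VV1 by blast
    have uB: "u \<in> model Zbar" using u E0(2) by blast
    define Ds where "Ds = frechet_derivative s (at y within V1)"
    have ds: "(s has_derivative Ds) (at y within V1)"
      unfolding Ds_def by (rule smooth_on_has_derivative[OF V1(4) yV1])
    have sE1: "s ` V1 \<subseteq> E1" using s_in E1k by blast
    have DsE: "Ds u \<in> E1" by (rule has_derivative_in_subspace[OF EB V1(1) yV1 uB ds E1X(1) sE1])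
    have xk': "x y \<in> fst ?k" using xy by simp
    let ?uu = "coord_vec Z ?k (x y) (Ds u)"
    have uu: "?uu \<in> model Z" by (rule coord_vec_in[OF ZM sk' xk']) (use DsE in simp)
    have D1: "?D y u = chart_deriv X k (snd h) (x y) (Ds u)"
    proof (rule frechet_derivative_on[OF E0(1) V y u])
      have td: "chart_diff X k (snd h) (x y)" by (rule transition_diff[OF XM sk h(3) xy(1,2)])
      have d1: "(s has_derivative Ds) (at y within V)" by (rule has_derivative_subset[OF ds VV1])
      have d2: "(snd h \<circ> coord_inv k has_derivative chart_deriv X k (snd h) (x y)) (at (s y) within s ` V)"
        unfolding xy(4)
        by (rule has_derivative_subset[OF chart_diff_has_derivative[OF td]])
          (use sE1 VV1 E1X(2) in blast)
      show "(\<phi> has_derivative (\<lambda>u. chart_deriv X k (snd h) (x y) (Ds u))) (at y within V)"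
        unfolding \<phi>_def by (rule has_derivative_in_compose[OF d1 d2])
    qed
    have "dmap Z X id (x y) ?uu = coord_vec X k (x y) (Ds u)"
      by (rule dmap_inclusion[OF XM seam_mfd(1) k(1) xy(1,3) DsE])
    also have "\<dots> = coord_vec X h (x y) (?D y u)"
      unfolding D1 by (rule coord_vec_change[OF XM sk h(3) xy(1,2), symmetric]) (use DsE E1X(2) in blast)
    finally have 1: "dmap Z X id (x y) ?uu = coord_vec X h (x y) (?D y u)" .
    have pc: "p (x y) \<in> fst c" unfolding xy(6) by (rule xy(9))
    have cd: "chart_diff Z ?k (snd c \<circ> p) (x y)" by (rule smooth_map_diff[OF ZM BM quotient_map sk' sc xk' pc])
    have D2: "chart_deriv Z ?k (snd c \<circ> p) (x y) (Ds u) = u"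
    proof (rule has_derivative_unique_on[OF EB V1(1) yV1 uB])
      have "(snd c \<circ> p \<circ> coord_inv ?k has_derivative chart_deriv Z ?k (snd c \<circ> p) (x y)) (at (s y) within s ` V1)"
      proof -
        have "s y = snd ?k (x y)" using xy(4) by simp
        then show ?thesis
          using has_derivative_subset[OF chart_diff_has_derivative[OF cd], of "s ` V1"] sE1 by simp
      qed
      from has_derivative_in_compose[OF ds this]
      show "((\<lambda>y. (snd c \<circ> p \<circ> coord_inv ?k) (s y)) has_derivative
          (\<lambda>u. chart_deriv Z ?k (snd c \<circ> p) (x y) (Ds u))) (at y within V1)" .
      show "((\<lambda>y. (snd c \<circ> p \<circ> coord_inv ?k) (s y)) has_derivative (\<lambda>u. u)) (at y within V1)"
      proof (rule has_derivative_transform[OF yV1 _ has_derivative_ident])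
        fix q assume q: "q \<in> V1"
        then show "(snd c \<circ> p \<circ> coord_inv ?k) (s q) = q"
          using V1(7)[OF q] snd_coord_inv[OF sc, of q] V1(3) by auto
      qed
    qed
    have "dmap Z Zbar p (x y) ?uu = coord_vec Zbar c (p (x y)) (chart_deriv Z ?k (snd c \<circ> p) (x y) (Ds u))"
      by (rule dmap_coord_vec[OF ZM BM quotient_map sk' sc xk' pc]) (use DsE in simp)
    then have 2: "dmap Z Zbar p (x y) ?uu = coord_vec Zbar c (coord_inv c y) u" unfolding D2 xy(6) .
    show ?thesis unfolding pushes_to_def using uu 1 2 by blast
  qed
  \<comment> \<open>The patch lies in a fibre of \<open>fbar\<close>, so its coordinate vectors
    belong to the kernel, the only place where \<open>ell\<close> is specified.\<close>
  have ker: "coord_vec Zbar c (coord_inv c y) u \<in> ker_dfun Zbar fbar (coord_inv c y)"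
    if y: "y \<in> V" and u: "u \<in> E0" for y u
  proof -
    let ?z = "coord_inv c y"
    have z: "?z \<in> fst c" "?z \<in> ?F" "?z \<in> pts Zbar" "fbar ?z = b" using xk(9,10)[OF y] by simp_all
    let ?c = "(fst c \<inter> ?F, snd c)"
    have "coord_vec (submfd Zbar E0 ?F) ?c ?z u \<in> model (submfd Zbar E0 ?F)"
      by (rule coord_vec_in[OF smooth_manifold_submfd[OF BM F] smooth_chart_submfd[OF BM F c]]) (use z u in simp_all)
    then have "dmap (submfd Zbar E0 ?F) Zbar id ?z (coord_vec (submfd Zbar E0 ?F) ?c ?z u) \<in> ker_dfun Zbar fbar ?z"
      by (intro fibre_tangent_ker[OF F z(3,4)]) simp
    then show ?thesis unfolding dmap_inclusion[OF BM F c z(1,2) u] .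
  qed
  obtain Vp Wp where Vp: "openin (top_of_set E0) Vp" "y0 \<in> Vp" "Vp \<subseteq> V" "\<And>y. y \<in> Vp \<Longrightarrow> Wp y \<in> model X"
    "\<And>y. y \<in> Vp \<Longrightarrow> dfun X fp (coord_inv h (\<phi> y)) (coord_vec X h (coord_inv h (\<phi> y)) (Wp y)) = axis one 1"
    "\<And>u. u \<in> E0 \<Longrightarrow> smooth_on E0 Vp (\<lambda>y. coeff2 X \<omega> h (?D y u) (Wp y) (\<phi> y))"
    "\<And>y u v. y \<in> Vp \<Longrightarrow> u \<in> E0 \<Longrightarrow> v \<in> E0 \<Longrightarrow>
       frechet_derivative (\<lambda>y. coeff2 X \<omega> h (?D y u) (Wp y) (\<phi> y)) (at y within Vp) v =
       frechet_derivative (\<lambda>y. coeff2 X \<omega> h (?D y v) (Wp y) (\<phi> y)) (at y within Vp) u"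
    using half_closed[OF half_plus _ h(1) E0(1) V sm\<phi> \<phi>h \<phi>S \<phi>b y0V] by auto
  obtain Vm Wm where Vm: "openin (top_of_set E0) Vm" "y0 \<in> Vm" "Vm \<subseteq> V" "\<And>y. y \<in> Vm \<Longrightarrow> Wm y \<in> model X"
    "\<And>y. y \<in> Vm \<Longrightarrow> dfun X fm (coord_inv h (\<phi> y)) (coord_vec X h (coord_inv h (\<phi> y)) (Wm y)) = axis one (-1)"
    "\<And>u. u \<in> E0 \<Longrightarrow> smooth_on E0 Vm (\<lambda>y. coeff2 X \<omega> h (?D y u) (Wm y) (\<phi> y))"
    "\<And>y u v. y \<in> Vm \<Longrightarrow> u \<in> E0 \<Longrightarrow> v \<in> E0 \<Longrightarrow>
       frechet_derivative (\<lambda>y. coeff2 X \<omega> h (?D y u) (Wm y) (\<phi> y)) (at y within Vm) v =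
       frechet_derivative (\<lambda>y. coeff2 X \<omega> h (?D y v) (Wm y) (\<phi> y)) (at y within Vm) u"
    using half_closed[OF half_minus _ h(1) E0(1) V sm\<phi> \<phi>h \<phi>S \<phi>b y0V] by auto
  let ?Bp = "\<lambda>u y. coeff2 X \<omega> h (?D y u) (Wp y) (\<phi> y)" and ?Bm = "\<lambda>u y. coeff2 X \<omega> h (?D y u) (Wm y) (\<phi> y)"
  \<comment> \<open>\<open>Wm\<close> lies over -e_1, so it is - \<open>Wm\<close> that
    \<open>ell_as_difference\<close> requires; \<omega>(v, -Wm) - \<omega>(v, Wp) then becomes minus
    the sum of the two contractions.\<close>
  define B where "B u y = - (?Bm u y + ?Bp u y)" for u y
  define V' where "V' = Vp \<inter> Vm"
  have V': "openin (top_of_set E0) V'" "y0 \<in> V'" "V' \<subseteq> V" "V' \<subseteq> Vp" "V' \<subseteq> Vm"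
    unfolding V'_def using Vp Vm by (auto intro: openin_Int)
  have dB: "frechet_derivative (B u) (at y within V') v =
      - (frechet_derivative (?Bm u) (at y within Vm) v + frechet_derivative (?Bp u) (at y within Vp) v)"
    if y: "y \<in> V'" and uv: "u \<in> E0" "v \<in> E0" for y u v
  proof (rule frechet_derivative_on[OF E0(1) V'(1) y uv(2)])
    have "(?Bm u has_derivative frechet_derivative (?Bm u) (at y within Vm)) (at y within V')"
      by (rule has_derivative_subset[OF smooth_on_has_derivative[OF Vm(6)[OF uv(1)]] V'(5)]) (use y V'(5) in blast)
    moreover have "(?Bp u has_derivative frechet_derivative (?Bp u) (at y within Vp)) (at y within V')"
      by (rule has_derivative_subset[OF smooth_on_has_derivative[OF Vp(6)[OF uv(1)]] V'(4)]) (use y V'(4) in blast)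
    ultimately show "(B u has_derivative (\<lambda>v. - (frechet_derivative (?Bm u) (at y within Vm) v +
        frechet_derivative (?Bp u) (at y within Vp) v))) (at y within V')"
      unfolding B_def by (intro has_derivative_minus has_derivative_add)
  qed
  show ?thesis
  proof (rule that[OF V'(1,2)])
    show "V' \<subseteq> ?T" using V'(3) VT by blast
    show "smooth_on E0 V' (B u)" if u: "u \<in> E0" for u
      unfolding B_def
      by (intro smooth_on_linear[OF bounded_linear_minus[OF bounded_linear_ident]] smooth_on_add
          smooth_on_mono[OF Vm(6)[OF u] order_refl V'(5)] smooth_on_mono[OF Vp(6)[OF u] order_refl V'(4)])
    show "frechet_derivative (B u) (at y within V') v = frechet_derivative (B v) (at y within V') u"
      if "u \<in> E0" "v \<in> E0" "y \<in> V'" for u v y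
    proof -
      have "y \<in> Vp" "y \<in> Vm" using that(3) V' by blast+
      then show ?thesis
        unfolding dB[OF that(3,1,2)] dB[OF that(3,2,1)] using Vp(7) Vm(7) that(1,2) by simp
    qed
    show "ell (coord_inv c y) (coord_vec Zbar c (coord_inv c y) u) = B u y" if u: "u \<in> E0" and y': "y \<in> V'" for u y
    proof -
      have y: "y \<in> V" "y \<in> Vp" "y \<in> Vm" using y' V' by blast+
      note xy = xk[OF y(1)]
      have xX: "x y \<in> pts X" by (rule seamD(1)[OF xy(3)])
      interpret symplectic_subspace "model X" "\<omega> (x y)" by (rule symplectic_subspace_at[OF symplectic xX])
      let ?v = "coord_vec X h (x y) (?D y u)" and ?Wp = "coord_vec X h (x y) (Wp y)" and ?Wm = "coord_vec X h (x y) (Wm y)"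
      have in_X: "?v \<in> model X" "?Wp \<in> model X" "?Wm \<in> model X"
        by (intro coord_vec_in[OF XM h(3) xy(2)] D_in[OF y(1) u] Vp(4)[OF y(2)] Vm(4)[OF y(3)])+
      have mWm: "- ?Wm \<in> model X" by (rule subspace_neg[OF E in_X(3)])
      have "dfun X fm (x y) (- ?Wm) = - axis one (-1)"
        using Vm(5)[OF y(3)] unfolding xy(8) by (simp add: linear_neg[OF linear_dfun[OF XM fm(1) xX]])
      also have "\<dots> = axis one 1" by (simp add: axis_def vec_eq_iff)
      finally have dm: "dfun X fm (x y) (- ?Wm) = axis one 1" .
      have dp: "dfun X fp (x y) ?Wp = axis one 1" using Vp(5)[OF y(2)] unfolding xy(8) .
      have "ell (p (x y)) (coord_vec Zbar c (coord_inv c y) u) = \<omega> (x y) ?v (- ?Wm) - \<omega> (x y) ?v ?Wp"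
        by (rule ell_as_difference[OF xy(3) push[OF y(1) u] _ in_X(2) dp mWm dm])
          (unfold xy(6), rule ker[OF y(1) u])
      also have "\<omega> (x y) ?v (- ?Wm) = - \<omega> (x y) ?v ?Wm"
        using linear_on_subspaceD(2)[OF lin2[OF in_X(1)] E in_X(3,3), of "-1"] by simp
      finally show ?thesis unfolding xy(6) B_def coeff2_def Let_def xy(8) by simp
    qed
  qed
qed

text \<open>Smoothness and closedness are local. Near each point the coefficients of the restricted
  form are the functions \<open>B\<close> of \<open>local_closed_form\<close>, and derivatives
  within the patch agree with those within the chart image because the patch is open.\<close>

lemma fibre_closed:
  assumes b: "b $ one = 0"
    and F: "embedded_submanifold Zbar E0 {z \<in> pts Zbar. fbar z = b}"
  shows "closed_one_form (submfd Zbar E0 {z \<in> pts Zbar. fbar z = b})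
    (\<lambda>z u. ell z (dmap (submfd Zbar E0 {z \<in> pts Zbar. fbar z = b}) Zbar id z u))"
proof -
  let ?F = "{z \<in> pts Zbar. fbar z = b}"
  let ?M = "submfd Zbar E0 ?F"
  let ?al = "\<lambda>z u. ell z (dmap ?M Zbar id z u)"
  note E0 = submanifold_model[OF BM F]
  note FM = smooth_manifold_submfd[OF BM F] and incF = smooth_map_inclusion[OF BM F]
  have lin: "linear_on_subspace E0 (?al z)" if z: "z \<in> ?F" for z
    unfolding linear_on_subspace_def
  proof (intro ballI allI)
    fix u v r s assume uv: "u \<in> E0" "v \<in> E0"
    have zM: "z \<in> pts ?M" using z by simp
    have zB: "z \<in> pts Zbar" "fbar z = b" using z by simp_all
    note l = linear_dmap[OF FM BM incF zM]
    show "?al z (r *\<^sub>R u + s *\<^sub>R v) = r * ?al z u + s * ?al z v"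
      using ell_section[OF zB(1)] fibre_tangent_ker[OF F zB uv(1)] fibre_tangent_ker[OF F zB uv(2)]
      unfolding linear_on_subspace_def linear_add[OF l] linear_scale[OF l] by blast
  qed
  have chart: "smooth_on E0 (snd c' ` fst c') (coeff1 ?M ?al c' u) \<and>
      frechet_derivative (coeff1 ?M ?al c' v) (at y within snd c' ` fst c') u =
      frechet_derivative (coeff1 ?M ?al c' u) (at y within snd c' ` fst c') v"
    if c': "c' \<in> charts ?M" and y: "y \<in> snd c' ` fst c'" and uv: "u \<in> E0" "v \<in> E0" for c' y u v
  proof -
    obtain c where c: "slice_chart Zbar E0 ?F c" "c' = (fst c \<inter> ?F, snd c)"
      using c' unfolding charts_submfd_iff by blast
    let ?T = "snd c ` (fst c \<inter> ?F)"
    have sc: "smooth_chart Zbar c" by (rule slice_chart_smooth[OF BM F c(1)])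
    have sc': "smooth_chart ?M c'" by (rule charts_submfd[OF BM F c'])
    have im: "snd c' ` fst c' = ?T" unfolding c(2) by simp
    have T: "openin (top_of_set E0) ?T" using smooth_chartD(2)[OF sc'] unfolding im by simp
    have co: "coeff1 ?M ?al c' u y = ell (coord_inv c y) (coord_vec Zbar c (coord_inv c y) u)"
      if y: "y \<in> ?T" and u: "u \<in> E0" for y u
    proof -
      have ci: "coord_inv c' y = coord_inv c y" unfolding c(2) by (rule coord_inv_slice[OF BM F c(1) y])
      obtain q where q: "q \<in> fst c \<inter> ?F" "y = snd c q" using y by blast
      have qc: "q \<in> fst c" "q \<in> ?F" using q(1) by blast+
      have iq: "coord_inv c y = q" unfolding q(2) by (rule coord_inv_snd[OF sc qc(1)])
      show ?thesis unfolding coeff1_def Let_def ci iq unfolding c(2) dmap_inclusion[OF BM F c(1) qc u] ..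
    qed
    have loc: "\<exists>V'. y0 \<in> V' \<and> openin (top_of_set E0) V' \<and> V' \<subseteq> ?T \<and>
        smooth_on E0 V' (coeff1 ?M ?al c' u) \<and>
        frechet_derivative (coeff1 ?M ?al c' v) (at y0 within ?T) u =
        frechet_derivative (coeff1 ?M ?al c' u) (at y0 within ?T) v" if y0: "y0 \<in> ?T" for y0
    proof -
      obtain V' B where V': "openin (top_of_set E0) V'" "y0 \<in> V'" "V' \<subseteq> ?T"
        and B: "\<And>u. u \<in> E0 \<Longrightarrow> smooth_on E0 V' (B u)"
        "\<And>u y. u \<in> E0 \<Longrightarrow> y \<in> V' \<Longrightarrow> ell (coord_inv c y) (coord_vec Zbar c (coord_inv c y) u) = B u y"
        "\<And>u v y. u \<in> E0 \<Longrightarrow> v \<in> E0 \<Longrightarrow> y \<in> V' \<Longrightarrow>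
           frechet_derivative (B u) (at y within V') v = frechet_derivative (B v) (at y within V') u"
        using local_closed_form[OF b F c(1) y0] by blast
      have eq: "B u y = coeff1 ?M ?al c' u y" if "u \<in> E0" "y \<in> V'" for u y
        using co[OF _ that(1)] V'(3) B(2)[OF that] that(2) by auto
      have at: "at y0 within V' = at y0 within ?T"
        by (rule at_within_openin[OF openin_subset_trans[OF V'(1,3) openin_imp_subset[OF T]] V'(2)])
      have fd: "frechet_derivative (coeff1 ?M ?al c' u) (at y0 within ?T) v = frechet_derivative (B u) (at y0 within V') v"
        if "u \<in> E0" "v \<in> E0" for u v
      proof (rule frechet_derivative_on[OF E0(1) T y0 that(2)])
        show "(coeff1 ?M ?al c' u has_derivative frechet_derivative (B u) (at y0 within V')) (at y0 within ?T)"
          unfolding at[symmetric]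
          by (rule has_derivative_transform[OF V'(2) _ smooth_on_has_derivative[OF B(1)[OF that(1)] V'(2)]])
            (rule eq[OF that(1), symmetric])
      qed
      have "smooth_on E0 V' (coeff1 ?M ?al c' u)"
        by (rule smooth_on_transform[OF B(1)[OF uv(1)]]) (rule eq[OF uv(1)])
      then show ?thesis using V' fd[OF uv] fd[OF uv(2,1)] B(3)[OF uv V'(2)] by (intro exI[of _ V']) simp
    qed
    have "smooth_on E0 ?T (coeff1 ?M ?al c' u)"
      by (rule smooth_on_local[OF E0(1) T]) (use loc in blast)
    moreover have "y \<in> ?T" using y unfolding im .
    ultimately show ?thesis unfolding im using loc by blast
  qed
  \<comment> \<open>\<open>chart\<close> presupposes a point of the chart image, so a chart with
    empty domain is treated separately; there smoothness is vacuous.\<close>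
  have chart_smooth: "smooth_on E0 (snd c' ` fst c') (coeff1 ?M ?al c' u)" if "c' \<in> charts ?M" "u \<in> E0" for c' u
  proof (cases "snd c' ` fst c' = {}")
    case True
    have "openin (top_of_set E0) ({} :: 'd set)" by simp
    then show ?thesis unfolding True by (rule smooth_on_local[OF E0(1)]) simp
  next
    case False
    then show ?thesis using chart[OF that(1) _ that(2,2)] by blast
  qed
  show ?thesis unfolding closed_one_form_def one_form_def submfd_simps
    using lin chart chart_smooth by simp
qed

lemma fibrewise_closed_ell:
  assumes "\<And>b. b \<in> \<Gamma> \<Longrightarrow> b $ one = 0"
  shows "fibrewise_closed Zbar fbar \<Gamma> ell"
  unfolding fibrewise_closed_def Let_def
proof (rule ballI)
  fix b assume "b \<in> \<Gamma>"
  then have b: "b $ one = 0" by (rule assms)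
  obtain E0 where "embedded_submanifold Zbar E0 {z \<in> pts Zbar. fbar z = b}" using fibre_submanifold[OF b] .
  then show "\<exists>E0. embedded_submanifold Zbar E0 {z \<in> pts Zbar. fbar z = b} \<and>
      closed_one_form (submfd Zbar E0 {z \<in> pts Zbar. fbar z = b})
        (\<lambda>z u. ell z (dmap (submfd Zbar E0 {z \<in> pts Zbar. fbar z = b}) Zbar id z u))"
    using fibre_closed[OF b] by blast
qed

end


theorem proposition4p1:
  fixes X :: "('a::{t2_space,second_countable_topology}, 'e::euclidean_space) mfd"
    and \<omega> :: "'a \<Rightarrow> 'e \<Rightarrow> 'e \<Rightarrow> real"
    and \<theta> :: "real \<Rightarrow> 'a \<Rightarrow> 'a"
    and one :: "'n::finite"
    and f fp fm :: "'a \<Rightarrow> real^'n"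
    and U \<Gamma> :: "(real^'n) set"
    and Z :: "('a, 'e) mfd"
    and E1 :: "'e set"
    and Zbar :: "('c::{t2_space,second_countable_topology}, 'd::euclidean_space) mfd"
    and p :: "'a \<Rightarrow> 'c"
    and fbar :: "'c \<Rightarrow> real^'n"
    and a :: "'n \<Rightarrow> 'a \<Rightarrow> real"
    and etabar :: "'n \<Rightarrow> 'c \<Rightarrow> 'd"
    and ell :: "'c \<Rightarrow> 'd \<Rightarrow> real"
  assumes stitched: "stitched_lagrangian_fibration X \<omega> \<theta> one f fp fm"
    and base: "f ` pts X = U" "open U" "contractible U" "0 \<in> U"
    and wall: "\<Gamma> = {b\<in>U. b $ one = 0}"
    and disc_pair: "\<exists>(h :: real^'n \<Rightarrow> real^'n) k. homeomorphism U (ball 0 1) h k \<and> h ` \<Gamma> = {b\<in>ball 0 1. b $ one = 0}"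
    and seam_mfd: "embedded_submanifold X E1 (seam X one f)" "dim E1 = 2 * CARD('n) - 1"
      "Z = submfd X E1 (seam X one f)"
    and quotient: "orbit_quotient Z \<theta> Zbar p"
    and fbar: "\<And>x. x \<in> pts Z \<Longrightarrow> fbar (p x) = f x"
    and a_invariant: "\<And>j x t. j \<noteq> one \<Longrightarrow> x \<in> pts Z \<Longrightarrow> a j (\<theta> t x) = a j x"
    and a_eq: "\<And>j x. j \<noteq> one \<Longrightarrow> x \<in> pts Z \<Longrightarrow>
        ham_vf X \<omega> (\<lambda>y. fp y $ j) x - ham_vf X \<omega> (\<lambda>y. fm y $ j) x
          = a j x *\<^sub>R ham_vf X \<omega> (\<lambda>y. f y $ one) x"
    and etabar_plus: "\<And>j x. j \<noteq> one \<Longrightarrow> x \<in> pts Z \<Longrightarrow>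
        pushes_to X Z Zbar p x (ham_vf X \<omega> (\<lambda>y. fp y $ j) x) (etabar j (p x))"
    and etabar_minus: "\<And>j x. j \<noteq> one \<Longrightarrow> x \<in> pts Z \<Longrightarrow>
        pushes_to X Z Zbar p x (ham_vf X \<omega> (\<lambda>y. fm y $ j) x) (etabar j (p x))"
    and ell_section: "\<And>z. z \<in> pts Zbar \<Longrightarrow> linear_on_subspace (ker_dfun Zbar fbar z) (ell z)"
    and ell_def: "\<And>j x. j \<noteq> one \<Longrightarrow> x \<in> pts Z \<Longrightarrow> ell (p x) (etabar j (p x)) = a j x"
  shows "fibrewise_closed Zbar fbar \<Gamma> ell"
proof -
  interpret stitched_seam X \<omega> \<theta> one f fp fm E1 Zbar p fbar a etabar ell
    by (unfold_locales; use assms in simp)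
  show ?thesis by (rule fibrewise_closed_ell) (simp add: wall)
qed

end
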